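(* Assume (A1)-(A3) and that $S$ is finite. Then the value function $V_\alpha$ is the unique function $v$ in $C_b((0,1)\times S)\cap C^1((0,1)\times S)$ satisfying $$\alpha\theta\Bigl[v(\theta,i)+\theta\frac{dv}{d\theta}(\theta,i)\Bigr]e^{\theta v(\theta,i)}=\inf_{u\in U_i}\Bigl[\theta c(i,u)e^{\theta v(\theta,i)}+\sum_{j\in S}\lambda_{ij}(u)e^{\theta v(\theta,j)}\Bigr]\quad\text{on }(0,1)\times S,$$ with, for each $i\in S$, $$\lim_{\theta\to0}v(\theta,i)=\inf_{\mathbf u\in\mathcal U}\mathbb E^{\mathbf u}_i\int_0^\infty e^{-\alpha t}c(X_t,U_t)\,dt.$$ For each $\theta\in(0,1)$, an optimal control is given by the Markov control $U_t=\mathbf u^*(\theta e^{-\alpha t},X_{t-})$, where $\mathbf u^*$ is given by $$\inf_{u\in U_i}\Bigl[\theta c(i,u)e^{\theta V_\alpha(\theta,i)}+\sum_j\lambda_{ij}(u)e^{\theta V_\alpha(\theta,j)}\Bigr]=\theta c(i,\mathbf u^*(\theta,i))e^{\theta V_\alpha(\theta,i)}+\sum_j\lambda_{ij}(\mathbf u^*(\theta,i))e^{\theta V_\alpha(\theta,j)},\qquad(\theta,i)\in(0,1)\times S.$$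
   Context: $S$ is a finite (discrete) state space. For each $i\in S$, $U_i$ is a (nonempty) compact metric space of actions; $U=\bigcup_i U_i$, $K=\{(i,u): i\in S,u\in U_i\}$. For $j\ne i$, $\lambda_{ij}:U_i\to[0,\infty)$ are given transition rates, and $\lambda_{ii}(u)=-\sum_{j\ne i}\lambda_{ij}(u)$. Assumptions: (A1) every $\lambda_{ij}$ is continuous; (A2) $\sup_i\sup_{u\in U_i}\{-\lambda_{ii}(u)\}\le M<\infty$; (A3) for each $i$ the sum $\sum_{j\neq i}\lambda_{ij}(u)$ converges uniformly in $u\in U_i$ (so $\lambda_{ii}$ is continuous). A Markov control is a map $\mathbf{u}:[0,\infty)\times S\to U$ with $\mathbf{u}(\cdot,i)$ measurable and $U_i$-valued for each $i$; $\mathcal U$ is the set of Markov controls. Let $\Lambda^{\mathbf u}_tf(i)=\sum_j\lambda_{ij}(\mathbf u(t,i))f(j)$ for bounded $f:S\to\mathbb R$. Let $(X_t)_{t\ge0}$ be the canonical process on the space of right-continuous $S$-valued paths with left limits. $\mathbb P^{\mathbf u}_i$ (expectation $\mathbb E^{\mathbf u}_i$) is the law solving the well-posed martingale problem: $X_0=i$ a.s. and $f(X_t)-\int_0^t\Lambda^{\mathbf u}_rf(X_r)\,dr$ is a martingale for every bounded $f$; i.e. $X$ is a Markov jump process started at $i$ with rates $\lambda_{ij}(\mathbf u(t,i))$. The control process is $U_t=\mathbf u(t,X_{t-})$. Discounted cost data: $c:K\to[0,\infty)$ bounded with $c(i,\cdot)$ continuous for each $i$; discount factor $\alpha>0$.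 For $\theta\in(0,1)$, $$I_\alpha(\theta,i,\mathbf u)=\frac1\theta\log\mathbb E^{\mathbf u}_i\Bigl[\exp\Bigl(\theta\int_0^\infty e^{-\alpha t}c(X_t,U_t)\,dt\Bigr)\Bigr],\qquad V_\alpha(\theta,i)=\inf_{\mathbf u\in\mathcal U}I_\alpha(\theta,i,\mathbf u).$$ A control is optimal (for given $\theta$) if it attains the infimum $V_\alpha(\theta,i)$ for every $i\in S$. The function $\mathbf u^*:(0,1)\times S\to U$ is understood to be a selector with $\mathbf u^*(\cdot,i)$ measurable and $U_i$-valued for each $i$. $C_b((0,1)\times S)$ is the space of bounded continuous functions; $C^1((0,1)\times S)$ is the set of functions continuously differentiable in the first variable on $(0,1)$ for each $i$. *)

theory Defs
  imports "HOL-Probability.Probability"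
begin

text \<open>
  The state space is a finite type \<open>'s\<close> with the discrete topology and \<open>\<sigma>\<close>-algebra. The action
  sets \<open>U i\<close> are subsets of one metric space \<open>'u\<close> (the paper's union of the \<open>U i\<close>).
  Only the off-diagonal values of \<open>lam\<close> are data; the diagonal is overwritten below.
\<close>

definition rate :: "('s::finite \<Rightarrow> 's \<Rightarrow> 'u \<Rightarrow> real) \<Rightarrow> 's \<Rightarrow> 's \<Rightarrow> 'u \<Rightarrow> real" where
  "rate lam i j a = (if j = i then - (\<Sum>k\<in>UNIV - {i}. lam i k a) else lam i j a)"

text \<open>Controls are functions on all of \<open>real\<close>; their values at negative times are irrelevant.\<close>

definition markov_controls :: "('s \<Rightarrow> 'u::metric_space set) \<Rightarrow> (real \<Rightarrow> 's \<Rightarrow> 'u) set" where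
  "markov_controls U =
     {u. \<forall>i. (\<lambda>t. u t i) \<in> restrict_space borel {0..} \<rightarrow>\<^sub>M borel \<and> (\<forall>t\<ge>0. u t i \<in> U i)}"

definition generator ::
  "('s::finite \<Rightarrow> 's \<Rightarrow> 'u \<Rightarrow> real) \<Rightarrow> (real \<Rightarrow> 's \<Rightarrow> 'u) \<Rightarrow> real \<Rightarrow> ('s \<Rightarrow> real) \<Rightarrow> 's \<Rightarrow> real" where
  "generator lam u t f i = (\<Sum>j\<in>UNIV. rate lam i j (u t i) * f j)"

definition cadlag_paths :: "(real \<Rightarrow> 's) set" where
  "cadlag_paths = {x \<in> extensional {0..}.
     (\<forall>t\<ge>0. limitin (discrete_topology UNIV) x (x t) (at_right t)) \<and>
     (\<forall>t>0. \<exists>l. limitin (discrete_topology UNIV) x l (at_left t))}"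

text \<open>The left limit \<open>X\<^sub>t\<^sub>-\<close>, with the convention \<open>X\<^sub>0\<^sub>- = X\<^sub>0\<close>.\<close>

definition left_lim :: "(real \<Rightarrow> 's) \<Rightarrow> real \<Rightarrow> 's" where
  "left_lim x t =
     (if t \<le> 0 then x 0 else (THE l. limitin (discrete_topology UNIV) x l (at_left t)))"

definition path_space :: "(real \<Rightarrow> 's) measure" where
  "path_space = restrict_space (PiM {0..} (\<lambda>_. count_space UNIV)) cadlag_paths"

text \<open>The \<open>\<sigma>\<close>-algebra on path space generated by the coordinates up to time \<open>t\<close>.\<close>

definition path_filtration :: "real \<Rightarrow> (real \<Rightarrow> 's) measure" where
  "path_filtration t =
     vimage_algebra cadlag_paths (\<lambda>x. restrict x {0..t}) (PiM {0..t} (\<lambda>_. count_space UNIV))"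

definition martingale ::
  "'a measure \<Rightarrow> (real \<Rightarrow> 'a measure) \<Rightarrow> (real \<Rightarrow> 'a \<Rightarrow> real) \<Rightarrow> bool" where
  "martingale P F Y \<longleftrightarrow>
     (\<forall>t\<ge>0. Y t \<in> borel_measurable (F t) \<and> integrable P (Y t)) \<and>
     (\<forall>s\<ge>0. \<forall>t\<ge>s. AE x in P. real_cond_exp P (F s) (Y t) x = Y s x)"

text \<open>Every \<open>f\<close> is bounded here, the state space being finite.\<close>

definition solves_martingale_problem ::
  "('s::finite \<Rightarrow> 's \<Rightarrow> 'u \<Rightarrow> real) \<Rightarrow> (real \<Rightarrow> 's \<Rightarrow> 'u) \<Rightarrow> 's \<Rightarrow> (real \<Rightarrow> 's) measure \<Rightarrow> bool" where
  "solves_martingale_problem lam u i P \<longleftrightarrow>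
     prob_space P \<and> sets P = sets path_space \<and>
     (AE x in P. x 0 = i) \<and>
     (\<forall>f. martingale P path_filtration
        (\<lambda>t x. f (x t) - (LINT r:{0..t}|lborel. generator lam u r f (x r))))"

definition discounted_cost ::
  "('s \<Rightarrow> 'u \<Rightarrow> real) \<Rightarrow> real \<Rightarrow> (real \<Rightarrow> 's \<Rightarrow> 'u) \<Rightarrow> (real \<Rightarrow> 's) \<Rightarrow> real" where
  "discounted_cost c \<alpha> u x = (LINT t:{0..}|lborel. exp (- \<alpha> * t) * c (x t) (u t (left_lim x t)))"

text \<open>
  Below, \<open>P u i\<close> is the law of the canonical process under the control \<open>u\<close> started at \<open>i\<close>.
\<close>

definition risk_cost ::
  "((real \<Rightarrow> 's \<Rightarrow> 'u) \<Rightarrow> 's \<Rightarrow> (real \<Rightarrow> 's) measure) \<Rightarrow> ('s \<Rightarrow> 'u \<Rightarrow> real) \<Rightarrow> real \<Rightarrow>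
    real \<Rightarrow> 's \<Rightarrow> (real \<Rightarrow> 's \<Rightarrow> 'u) \<Rightarrow> real" where
  "risk_cost P c \<alpha> \<theta> i u = 1 / \<theta> * ln (LINT x|P u i. exp (\<theta> * discounted_cost c \<alpha> u x))"

definition risk_value ::
  "((real \<Rightarrow> 's \<Rightarrow> 'u::metric_space) \<Rightarrow> 's \<Rightarrow> (real \<Rightarrow> 's) measure) \<Rightarrow> ('s \<Rightarrow> 'u set) \<Rightarrow>
    ('s \<Rightarrow> 'u \<Rightarrow> real) \<Rightarrow> real \<Rightarrow> real \<Rightarrow> 's \<Rightarrow> real" where
  "risk_value P U c \<alpha> \<theta> i = (INF u\<in>markov_controls U. risk_cost P c \<alpha> \<theta> i u)"

definition optimal_control ::
  "((real \<Rightarrow> 's \<Rightarrow> 'u::metric_space) \<Rightarrow> 's \<Rightarrow> (real \<Rightarrow> 's) measure) \<Rightarrow> ('s \<Rightarrow> 'u set) \<Rightarrow>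
    ('s \<Rightarrow> 'u \<Rightarrow> real) \<Rightarrow> real \<Rightarrow> real \<Rightarrow> (real \<Rightarrow> 's \<Rightarrow> 'u) \<Rightarrow> bool" where
  "optimal_control P U c \<alpha> \<theta> u \<longleftrightarrow>
     u \<in> markov_controls U \<and> (\<forall>i. risk_cost P c \<alpha> \<theta> i u = risk_value P U c \<alpha> \<theta> i)"

text \<open>The bracket inside the infimum of the HJB equation.\<close>

definition hamiltonian ::
  "('s::finite \<Rightarrow> 's \<Rightarrow> 'u \<Rightarrow> real) \<Rightarrow> ('s \<Rightarrow> 'u \<Rightarrow> real) \<Rightarrow> (real \<Rightarrow> 's \<Rightarrow> real) \<Rightarrow>
    real \<Rightarrow> 's \<Rightarrow> 'u \<Rightarrow> real" where
  "hamiltonian lam c v \<theta> i a =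
     \<theta> * c i a * exp (\<theta> * v \<theta> i) + (\<Sum>j\<in>UNIV. rate lam i j a * exp (\<theta> * v \<theta> j))"

text \<open>
  Membership in \<open>C\<^sub>b((0,1) \<times> S) \<inter> C\<^sup>1((0,1) \<times> S)\<close>, the HJB equation on \<open>(0,1) \<times> S\<close> and the limit
  at \<open>\<theta> = 0\<close>. Since \<open>S\<close> is discrete, continuity on \<open>(0,1) \<times> S\<close> is continuity in \<open>\<theta>\<close> for each state.
\<close>

definition hjb_solution ::
  "((real \<Rightarrow> 's \<Rightarrow> 'u::metric_space) \<Rightarrow> 's \<Rightarrow> (real \<Rightarrow> 's) measure) \<Rightarrow> ('s::finite \<Rightarrow> 'u set) \<Rightarrow>
    ('s \<Rightarrow> 's \<Rightarrow> 'u \<Rightarrow> real) \<Rightarrow> ('s \<Rightarrow> 'u \<Rightarrow> real) \<Rightarrow> real \<Rightarrow> (real \<Rightarrow> 's \<Rightarrow> real) \<Rightarrow> bool" where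
  "hjb_solution P U lam c \<alpha> v \<longleftrightarrow>
     (\<exists>B. \<forall>\<theta>\<in>{0<..<1}. \<forall>i. \<bar>v \<theta> i\<bar> \<le> B) \<and>
     (\<forall>i. continuous_on {0<..<1} (\<lambda>\<theta>. v \<theta> i)) \<and>
     (\<forall>i. (\<lambda>\<theta>. v \<theta> i) C1_differentiable_on {0<..<1}) \<and>
     (\<forall>\<theta>\<in>{0<..<1}. \<forall>i.
        \<alpha> * \<theta> * (v \<theta> i + \<theta> * deriv (\<lambda>\<eta>. v \<eta> i) \<theta>) * exp (\<theta> * v \<theta> i)
          = (INF a\<in>U i. hamiltonian lam c v \<theta> i a)) \<and>
     (\<forall>i. ((\<lambda>\<theta>. v \<theta> i) \<longlongrightarrow>
        (INF u\<in>markov_controls U. LINT x|P u i. discounted_cost c \<alpha> u x)) (at_right 0))"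

text \<open>
  The selectors \<open>u\<^sup>*\<close>: measurable on \<open>(0,1)\<close> in the first argument, \<open>U i\<close>-valued, and attaining
  the infimum of the bracket formed with \<open>v\<close>.
\<close>

definition minimizing_selector ::
  "('s::finite \<Rightarrow> 'u::metric_space set) \<Rightarrow> ('s \<Rightarrow> 's \<Rightarrow> 'u \<Rightarrow> real) \<Rightarrow> ('s \<Rightarrow> 'u \<Rightarrow> real) \<Rightarrow>
    (real \<Rightarrow> 's \<Rightarrow> real) \<Rightarrow> (real \<Rightarrow> 's \<Rightarrow> 'u) \<Rightarrow> bool" where
  "minimizing_selector U lam c v us \<longleftrightarrow>
     (\<forall>i. (\<lambda>\<theta>. us \<theta> i) \<in> restrict_space borel {0<..<1} \<rightarrow>\<^sub>M borel) \<and>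
     (\<forall>\<theta>\<in>{0<..<1}. \<forall>i. us \<theta> i \<in> U i \<and>
        (INF a\<in>U i. hamiltonian lam c v \<theta> i a) = hamiltonian lam c v \<theta> i (us \<theta> i))"

end

theory Submission
  imports Defs
begin

text \<open>
  Write \<open>W \<theta> i = exp (\<theta> v(\<theta>, i))\<close>. The HJB equation becomes
  \<open>\<alpha> \<theta> W' = inf\<^sub>a (\<theta> c W + \<Sum> \<lambda> W)\<close>, and \<open>t \<mapsto> W (\<theta> exp (- \<alpha> t))\<close> solves the associated
  backward equation in time, with value \<open>1\<close> at infinity. A Feynman--Kac inequality therefore bounds
  \<open>W \<theta> i\<close> by the exponential cost of every control, with equality for minimizing selectors; this
  identifies any bounded solution with the value function. Feynman--Kac itself follows from the
  martingale problem because freezing the path on \<open>[s, t]\<close> costs only \<open>O((t - s)\<^sup>2)\<close>.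

  A solution is obtained as the increasing limit of \<open>W\<^sub>0 = 1\<close>,
  \<open>W\<^sub>k\<^sub>+\<^sub>1 \<theta> = (\<alpha> \<theta>\<^sup>n)\<^sup>-\<^sup>1 \<integral>\<^sub>0\<^sup>\<theta> \<eta>\<^sup>n\<^sup>-\<^sup>1 (inf\<^sub>a (\<eta> c W\<^sub>k + \<Sum> \<lambda> W\<^sub>k) + \<alpha> n W\<^sub>k) d\<eta>\<close>; the weight \<open>\<eta>\<^sup>n\<close>
  absorbs the singularity at \<open>0\<close> and, for large \<open>n\<close>, makes the iteration monotone. It stays between
  \<open>1\<close> and \<open>exp (\<theta> sup c / \<alpha>)\<close>.
\<close>

subsection \<open>Right-continuous paths\<close>

text \<open>The martingale problem speaks only of functions of the state, while Feynman--Kac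
  concerns \<open>A t x * \<phi> t (x t)\<close>, which depends on time and on the past. The rates
  are merely measurable in time, so the mean of this quantity is not differentiated: its increments
  over [s, t] are bounded below by a multiple of -(t - s)^2, and a uniform partition removes the
  error. Only a one-sided inequality is proved; as it holds for \<open>\<phi>\<close> of either
  sign, applying it to \<open>- \<phi>\<close> gives the reverse inequality when the control
  minimizes. To identify a solution with an infimum one needs a control that attains it, hence a
  measurable selector. A bounded \<open>v\<close> forces W to 1 as the time-changed argument tends
  to 0, which serves as the terminal condition. The limit of the value function at \<theta> = 0
  comes directly from the costs, by estimates uniform over controls.\<close>

lemma limitin_discrete_UNIV_iff:
  "limitin (discrete_topology UNIV) x l F \<longleftrightarrow> eventually (\<lambda>t. x t = l) F"
proof
  assume "limitin (discrete_topology UNIV) x l F"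
  then have "\<forall>\<^sub>F t in F. x t \<in> {l}"
    unfolding limitin_def openin_discrete_topology by blast
  then show "\<forall>\<^sub>F t in F. x t = l"
    by simp
next
  assume "\<forall>\<^sub>F t in F. x t = l"
  then show "limitin (discrete_topology UNIV) x l F"
    by (auto simp: limitin_def elim!: eventually_mono)
qed

lemma cadlag_right:
  assumes "x \<in> cadlag_paths" "0 \<le> t"
  shows "\<forall>\<^sub>F r in at_right t. x r = x t"
  using assms by (auto simp: cadlag_paths_def limitin_discrete_UNIV_iff)

lemma left_lim_eqI:
  assumes "0 < t" "\<forall>\<^sub>F r in at_left t. x r = l"
  shows "left_lim x t = l"
proof -
  have "m = l" if "\<forall>\<^sub>F r in at_left t. x r = m" for m
    using eventually_conj[OF that assms(2)]
    by (auto dest!: eventually_happens'[OF trivial_limit_at_left_real])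
  with assms(2) have "(THE m. \<forall>\<^sub>F r in at_left t. x r = m) = l"
    by (intro the_equality)
  with assms(1) show ?thesis
    unfolding left_lim_def limitin_discrete_UNIV_iff by simp
qed

text \<open>A left limit in a discrete space is attained on some interval (b, t), which therefore
  contains no jump; a rational in it labels the jump t injectively. Countability makes the jump
  times a null set, so \<open>x t\<close> may replace \<open>left_lim x t\<close> in time
  integrals.\<close>

lemma countable_jumps:
  assumes x: "x \<in> cadlag_paths"
  shows "countable {t. 0 < t \<and> left_lim x t \<noteq> x t}" (is "countable ?J")
proof -
  have "\<exists>q\<in>\<rat>. q < t \<and> (\<forall>s. q < s \<and> s < t \<longrightarrow> s \<notin> ?J)" if "t \<in> ?J" for t
  proof -
    from that have t: "0 < t" by simp
    with x obtain l where "\<forall>\<^sub>F r in at_left t. x r = l"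
      by (auto simp: cadlag_paths_def limitin_discrete_UNIV_iff)
    then obtain b where b: "b < t" "\<And>r. b < r \<Longrightarrow> r < t \<Longrightarrow> x r = l"
      by (auto simp: eventually_at_left[OF t])
    obtain q where q: "q \<in> \<rat>" "b < q" "q < t"
      using Rats_dense_in_real[OF b(1)] by auto
    have "left_lim x s = x s" if s: "q < s" "s < t" "0 < s" for s
    proof (rule left_lim_eqI)
      show "\<forall>\<^sub>F r in at_left s. x r = x s"
        unfolding eventually_at_left[OF s(1)]
        by (intro exI[of _ q]) (use b q s in auto)
    qed (use s in auto)
    with q show ?thesis by blast
  qed
  then have "\<forall>t\<in>?J. \<exists>q. q \<in> \<rat> \<and> q < t \<and> (\<forall>s. q < s \<and> s < t \<longrightarrow> s \<notin> ?J)"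
    by blast
  from bchoice[OF this]
  obtain q where q: "\<And>t. t \<in> ?J \<Longrightarrow> q t \<in> \<rat> \<and> q t < t \<and> (\<forall>s. q t < s \<and> s < t \<longrightarrow> s \<notin> ?J)"
    by blast
  \<comment> \<open>Two jumps s < t with the same label would put s inside the jump-free interval
    before t.\<close>
  have inj: "inj_on q ?J"
  proof (rule inj_onI)
    fix s t assume st: "s \<in> ?J" "t \<in> ?J" "q s = q t"
    then have "\<not> s < t" "\<not> t < s"
      using q[OF st(1)] q[OF st(2)] by auto
    then show "s = t"
      by simp
  qed
  have "q ` ?J \<subseteq> \<rat>"
    using q by auto
  then have "countable (q ` ?J)"
    using countable_rat countable_subset by blast
  then show ?thesis
    using inj countable_image_inj_on by blast
qed

text \<open>Right endpoint of the k-th cell of mesh \<open>1 / Suc n\<close>. It lies strictly to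
  the right of every point of that half-open cell, which is what right continuity can use.\<close>

definition upper_grid :: "nat \<Rightarrow> int \<Rightarrow> real" where
  "upper_grid n k = (of_int k + 1) / real (Suc n)"

lemma upper_grid_bounds:
  "r < upper_grid n \<lfloor>real (Suc n) * r\<rfloor>" "upper_grid n \<lfloor>real (Suc n) * r\<rfloor> \<le> r + 1 / real (Suc n)"
proof -
  define m where "m = real (Suc n)"
  have m: "0 < m"
    by (simp add: m_def)
  have "m * r < of_int \<lfloor>m * r\<rfloor> + 1" "of_int \<lfloor>m * r\<rfloor> \<le> m * r"
    by linarith+
  with m have "r < (of_int \<lfloor>m * r\<rfloor> + 1) / m" "(of_int \<lfloor>m * r\<rfloor> + 1) / m \<le> r + 1 / m"
    by (simp_all add: field_simps)
  then show "r < upper_grid n \<lfloor>real (Suc n) * r\<rfloor>"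
    "upper_grid n \<lfloor>real (Suc n) * r\<rfloor> \<le> r + 1 / real (Suc n)"
    unfolding upper_grid_def m_def .
qed

text \<open>Right continuity in a discrete space makes the approximation eventually exact. Clamping
  to [0, s] keeps it adapted: no coordinate after s is read, and at r = s the clamp returns s
  itself.\<close>

lemma cadlag_upper_grid:
  assumes x: "x \<in> cadlag_paths" and r: "0 \<le> r" "r \<le> s"
  shows "\<forall>\<^sub>F n in sequentially. x (max 0 (min s (upper_grid n \<lfloor>real (Suc n) * r\<rfloor>))) = x r"
proof (cases "r = s")
  case True
  then show ?thesis
    using upper_grid_bounds(1)[of r] r by (auto simp: min_def less_imp_le)
next
  case False
  obtain b where b: "r < b" "\<And>q. r < q \<Longrightarrow> q < b \<Longrightarrow> x q = x r"
    using cadlag_right[OF x r(1)] by (auto simp: eventually_at_right[of r "r + 1"])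
  have "\<forall>\<^sub>F n in sequentially. 1 / real (Suc n) < min b s - r"
    using b False r by (intro order_tendstoD(2)[OF LIMSEQ_inverse_real_of_nat[unfolded inverse_eq_divide]]) auto
  then show ?thesis
  proof eventually_elim
    case (elim n)
    then have "upper_grid n \<lfloor>real (Suc n) * r\<rfloor> < min b s"
      using upper_grid_bounds(2)[of n r] by linarith
    then show ?case
      using upper_grid_bounds(1)[of r n] r
      by (simp add: b(2) min.absorb2 max.absorb2)
  qed
qed

text \<open>Progressive measurability: the n-th approximation reads one of countably many
  coordinates, selected by an integer part, hence is jointly measurable; pointwise convergence
  passes this to the limit. \<open>F\<close> is left abstract to cover path space, a law on it and
  the filtration.\<close>

lemma measurable_path_indicator:
  assumes space: "space F \<subseteq> cadlag_paths"
    and coord: "\<And>r. 0 \<le> r \<Longrightarrow> r \<le> s \<Longrightarrow> (\<lambda>x. x r) \<in> F \<rightarrow>\<^sub>M count_space UNIV"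
    and s: "0 \<le> s"
  shows "(\<lambda>(r, x). indicator {0..s} r * (indicator {j} (x r) :: real)) \<in> borel_measurable (borel \<Otimes>\<^sub>M F)"
proof -
  let ?g = "\<lambda>n p. indicator {0..s} (fst p) *
      (indicator {j} ((snd p) (max 0 (min s (upper_grid n \<lfloor>real (Suc n) * fst p\<rfloor>)))) :: real)"
  have coord': "(\<lambda>p. (snd p) (max 0 (min s q))) \<in> borel \<Otimes>\<^sub>M F \<rightarrow>\<^sub>M count_space UNIV" for q
    by (rule measurable_compose[OF measurable_snd coord]) (use s in auto)
  have fl: "(\<lambda>p. \<lfloor>real (Suc n) * fst p\<rfloor>) \<in> (borel \<Otimes>\<^sub>M F) \<rightarrow>\<^sub>M count_space UNIV" for n
    by measurable
  have "(\<lambda>p. (snd p) (max 0 (min s (upper_grid n \<lfloor>real (Suc n) * fst p\<rfloor>))))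
      \<in> borel \<Otimes>\<^sub>M F \<rightarrow>\<^sub>M count_space UNIV" for n
    by (rule measurable_compose_countable[OF coord' fl])
  then have "(\<lambda>p. indicator {j} ((snd p) (max 0 (min s (upper_grid n \<lfloor>real (Suc n) * fst p\<rfloor>)))) :: real)
      \<in> borel_measurable (borel \<Otimes>\<^sub>M F)" for n
    by (rule measurable_compose) simp
  then have g: "?g n \<in> borel_measurable (borel \<Otimes>\<^sub>M F)" for n
    by measurable
  have "(\<lambda>p. indicator {0..s} (fst p) * (indicator {j} ((snd p) (fst p)) :: real))
      \<in> borel_measurable (borel \<Otimes>\<^sub>M F)"
  proof (rule borel_measurable_LIMSEQ_real[OF _ g])
    fix p :: "real \<times> (real \<Rightarrow> 'a)" assume "p \<in> space (borel \<Otimes>\<^sub>M F)"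
    then have x: "snd p \<in> cadlag_paths"
      using space by (auto simp: space_pair_measure)
    show "(\<lambda>n. ?g n p) \<longlonglongrightarrow> indicator {0..s} (fst p) * indicator {j} ((snd p) (fst p))"
    proof (cases "fst p \<in> {0..s}")
      case True
      then have "\<forall>\<^sub>F n in sequentially. ?g n p = indicator {0..s} (fst p) * indicator {j} ((snd p) (fst p))"
        by (intro eventually_mono[OF cadlag_upper_grid[OF x]]) auto
      then show ?thesis
        by (rule tendsto_eventually)
    qed simp
  qed
  then show ?thesis
    by (simp add: case_prod_beta)
qed

text \<open>Rates and costs are only controlled at nonnegative times.\<close>

definition bounded_rate :: "(real \<Rightarrow> 's \<Rightarrow> real) \<Rightarrow> real \<Rightarrow> bool" where
  "bounded_rate h B \<longleftrightarrow> (\<forall>j. (\<lambda>r. indicator {0..} r * h r j) \<in> borel_measurable borel) \<and>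
     (\<forall>r\<ge>0. \<forall>j. \<bar>h r j\<bar> \<le> B)"

lemma bounded_rateD:
  assumes "bounded_rate h B"
  shows "(\<lambda>r. indicator {0..} r * h r j) \<in> borel_measurable borel"
    and "0 \<le> r \<Longrightarrow> \<bar>h r j\<bar> \<le> B"
  using assms by (auto simp: bounded_rate_def)

lemma bounded_rate_nonneg: "bounded_rate h B \<Longrightarrow> 0 \<le> B"
  using abs_ge_zero order_trans unfolding bounded_rate_def by blast

text \<open>On a finite state space, \<open>h r (x r)\<close> is the sum over j of
  \<open>h r j\<close> times the indicator of \<open>x r = j\<close>, which separates the
  deterministic time dependence from the path.\<close>

lemma measurable_path_rate:
  fixes h :: "real \<Rightarrow> 's::finite \<Rightarrow> real"
  assumes "space F \<subseteq> cadlag_paths"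
    and "\<And>r. 0 \<le> r \<Longrightarrow> r \<le> s \<Longrightarrow> (\<lambda>x. x r) \<in> F \<rightarrow>\<^sub>M count_space UNIV"
    and "0 \<le> s" and h: "bounded_rate h B"
  shows "(\<lambda>(r, x). indicator {0..s} r * h r (x r)) \<in> borel_measurable (borel \<Otimes>\<^sub>M F)"
proof -
  have *: "(\<lambda>(r, x). indicator {0..s} r * (indicator {j} (x r) :: real)) \<in> borel_measurable (borel \<Otimes>\<^sub>M F)" for j
    by (rule measurable_path_indicator) (use assms in auto)
  have "(\<lambda>p. \<Sum>j\<in>UNIV. (indicator {0..} (fst p) * h (fst p) j) *
      (case p of (r, x) \<Rightarrow> indicator {0..s} r * (indicator {j} (x r) :: real)))
      \<in> borel_measurable (borel \<Otimes>\<^sub>M F)"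
    by (intro borel_measurable_sum borel_measurable_times * measurable_compose[OF measurable_fst bounded_rateD(1)[OF h]])
  also have "(\<lambda>p. \<Sum>j\<in>UNIV. (indicator {0..} (fst p) * h (fst p) j) *
      (case p of (r, x) \<Rightarrow> indicator {0..s} r * (indicator {j} (x r) :: real)))
      = (\<lambda>(r, x). indicator {0..s} r * h r (x r))"
    by (auto simp: fun_eq_iff indicator_def if_distrib if_distribR cong: if_cong)
  finally show ?thesis .
qed

section \<open>Path space and its filtration\<close>

lemma space_path_space [simp]: "space path_space = cadlag_paths"
  by (auto simp: path_space_def space_restrict_space space_PiM cadlag_paths_def PiE_def)

lemma space_path_filtration [simp]: "space (path_filtration t) = cadlag_paths"
  by (simp add: path_filtration_def)

lemma measurable_coord_path_space:
  "0 \<le> r \<Longrightarrow> (\<lambda>x. x r) \<in> path_space \<rightarrow>\<^sub>M count_space UNIV"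
  unfolding path_space_def by (intro measurable_restrict_space1 measurable_component_singleton) auto

lemma measurable_coord_filtration:
  assumes "0 \<le> r" "r \<le> s"
  shows "(\<lambda>x. x r) \<in> path_filtration s \<rightarrow>\<^sub>M count_space UNIV"
proof -
  have "(\<lambda>x. restrict x {0..s}) \<in> path_filtration s \<rightarrow>\<^sub>M PiM {0..s} (\<lambda>_. count_space UNIV)"
    unfolding path_filtration_def by (rule measurable_vimage_algebra1) (auto simp: space_PiM)
  then have "(\<lambda>x. restrict x {0..s} r) \<in> path_filtration s \<rightarrow>\<^sub>M count_space UNIV"
    by (rule measurable_compose) (use assms in \<open>auto intro!: measurable_component_singleton\<close>)
  then show ?thesis
    using assms by simp
qed

lemma subalgebra_path_filtration:
  assumes "sets P = sets path_space"
  shows "subalgebra P (path_filtration s)"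
proof -
  let ?f = "\<lambda>x. \<lambda>r\<in>{0..s}. x r" and ?M = "PiM {0..s} (\<lambda>_. count_space UNIV)"
  have f: "?f \<in> path_space \<rightarrow>\<^sub>M ?M"
    by (rule measurable_restrict) (auto intro: measurable_coord_path_space)
  have "sets (path_filtration s) = {?f -` A \<inter> cadlag_paths |A. A \<in> sets ?M}"
    unfolding path_filtration_def by (rule sets_vimage_algebra2) (auto simp: space_PiM)
  also have "\<dots> \<subseteq> sets path_space"
    using measurable_sets[OF f] by auto
  finally show ?thesis
    using assms sets_eq_imp_space_eq[OF assms] by (simp add: subalgebra_def)
qed

subsection \<open>The martingale problem\<close>

text \<open>Additive functional of the path; the compensators of the martingales and the accumulated
  cost are both of this form.\<close>

definition running :: "(real \<Rightarrow> 's \<Rightarrow> real) \<Rightarrow> real \<Rightarrow> real \<Rightarrow> (real \<Rightarrow> 's) \<Rightarrow> real" where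
  "running h s t x = (LINT r:{s..t}|lborel. h r (x r))"

lemma measurable_path_section:
  fixes h :: "real \<Rightarrow> 's::finite \<Rightarrow> real"
  assumes h: "bounded_rate h B" and x: "x \<in> cadlag_paths" and t: "0 \<le> t"
  shows "(\<lambda>r. indicator {0..t} r * h r (x r)) \<in> borel_measurable borel"
proof -
  have "(\<lambda>(r, x). indicator {0..t} r * h r (x r)) \<in> borel_measurable (borel \<Otimes>\<^sub>M path_space)"
    by (rule measurable_path_rate[OF _ measurable_coord_path_space t h]) auto
  from measurable_Pair_compose_split[OF this measurable_ident_sets[OF refl] measurable_const[of x]] x
  show ?thesis
    by simp
qed

lemma set_integrable_bounded:
  fixes f :: "real \<Rightarrow> real"
  assumes "(\<lambda>r. indicator {s..t} r * f r) \<in> borel_measurable borel" "\<And>r. s \<le> r \<Longrightarrow> r \<le> t \<Longrightarrow> \<bar>f r\<bar> \<le> B"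
  shows "set_integrable lborel {s..t} f"
  unfolding set_integrable_def
  by (rule integrableI_bounded_set[where A="{s..t}" and B=B])
     (use assms in \<open>auto simp: indicator_def emeasure_lborel_Icc_eq\<close>)

lemma set_integral_Icc_abs_le:
  fixes f :: "real \<Rightarrow> real"
  assumes "set_integrable lborel {s..t} f" "\<And>r. s \<le> r \<Longrightarrow> r \<le> t \<Longrightarrow> \<bar>f r\<bar> \<le> B" "s \<le> t"
  shows "\<bar>LINT r:{s..t}|lborel. f r\<bar> \<le> B * (t - s)"
proof -
  have "\<bar>LINT r:{s..t}|lborel. f r\<bar> \<le> (LINT r:{s..t}|lborel. \<bar>f r\<bar>)"
    using set_integral_norm_bound[OF assms(1)] by simp
  also have "\<dots> \<le> (LINT r:{s..t}|lborel. B)"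
    using assms by (intro set_integral_mono set_integrable_abs set_integrable_bounded[where B="\<bar>B\<bar>" and f="\<lambda>_. B"]) auto
  also have "\<dots> = B * (t - s)"
    using assms(3) by (simp add: set_lebesgue_integral_def)
  finally show ?thesis .
qed

lemma set_integrable_rate:
  assumes h: "bounded_rate h B" and s: "0 \<le> s"
  shows "set_integrable lborel {s..t} (\<lambda>r. h r j)"
proof (rule set_integrable_bounded[where B=B])
  have [measurable]: "(\<lambda>r. indicator {0..} r * h r j) \<in> borel_measurable borel"
    by (rule bounded_rateD(1)[OF h])
  have "(\<lambda>r. indicator {s..t} r * (indicator {0..} r * h r j)) \<in> borel_measurable borel"
    by measurable
  also have "(\<lambda>r. indicator {s..t} r * (indicator {0..} r * h r j)) = (\<lambda>r. indicator {s..t} r * h r j)"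
    using s by (auto simp: indicator_def)
  finally show "(\<lambda>r. indicator {s..t} r * h r j) \<in> borel_measurable borel" .
qed (use s bounded_rateD(2)[OF h] in auto)

lemma set_integrable_path:
  fixes h :: "real \<Rightarrow> 's::finite \<Rightarrow> real"
  assumes h: "bounded_rate h B" and x: "x \<in> cadlag_paths" and s: "0 \<le> s"
  shows "set_integrable lborel {s..t} (\<lambda>r. h r (x r))"
proof (cases "s \<le> t")
  case True
  with s have t: "0 \<le> t" by simp
  have [measurable]: "(\<lambda>r. indicator {0..t} r * h r (x r)) \<in> borel_measurable borel"
    by (rule measurable_path_section[OF h x t])
  have "(\<lambda>r. indicator {s..t} r * (indicator {0..t} r * h r (x r))) \<in> borel_measurable borel"
    by measurable
  also have "(\<lambda>r. indicator {s..t} r * (indicator {0..t} r * h r (x r))) = (\<lambda>r. indicator {s..t} r * h r (x r))"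
    using s by (auto simp: indicator_def)
  finally show ?thesis
    using s bounded_rateD(2)[OF h] by (intro set_integrable_bounded[where B=B]) auto
qed (simp add: set_integrable_def)

lemma running_abs_le:
  fixes h :: "real \<Rightarrow> 's::finite \<Rightarrow> real"
  assumes h: "bounded_rate h B" and x: "x \<in> cadlag_paths" and s: "0 \<le> s" "s \<le> t"
  shows "\<bar>running h s t x\<bar> \<le> B * (t - s)"
  unfolding running_def using s bounded_rateD(2)[OF h]
  by (intro set_integral_Icc_abs_le set_integrable_path[OF h x s(1)]) auto

lemma running_add:
  fixes h :: "real \<Rightarrow> 's::finite \<Rightarrow> real"
  assumes h: "bounded_rate h B" and x: "x \<in> cadlag_paths" and s: "0 \<le> s" "s \<le> t"
  shows "running h 0 t x = running h 0 s x + running h s t x"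
proof -
  have "{0..t} = {0..s} \<union> {s..t}" using s by auto
  moreover have "(LINT r:{0..s} \<union> {s..t}|lborel. h r (x r)) = (LINT r:{0..s}|lborel. h r (x r)) + (LINT r:{s..t}|lborel. h r (x r))"
  proof (rule set_integral_Un_AE)
    show "AE r in lborel. \<not> (r \<in> {0..s} \<and> r \<in> {s..t})"
      using AE_lborel_singleton[of s] by eventually_elim auto
  qed (use set_integrable_path[OF h x] s in auto)
  ultimately show ?thesis
    by (simp add: running_def)
qed

lemma measurable_running:
  fixes h :: "real \<Rightarrow> 's::finite \<Rightarrow> real"
  assumes h: "bounded_rate h B" and t: "0 \<le> t"
  shows "running h 0 t \<in> borel_measurable (path_filtration t)"
proof -
  have "(\<lambda>(r, x). indicator {0..t} r * h r (x r)) \<in> borel_measurable (borel \<Otimes>\<^sub>M path_filtration t)"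
    by (rule measurable_path_rate[OF _ measurable_coord_filtration t h]) auto
  then have "(\<lambda>(r, x). indicator {0..t} r * h r (x r)) \<in> borel_measurable (lborel \<Otimes>\<^sub>M path_filtration t)"
    by (simp cong: measurable_cong_sets sets_pair_measure_cong)
  from measurable_pair_swap[OF this]
  have "(\<lambda>x. LINT r|lborel. indicator {0..t} r * h r (x r)) \<in> borel_measurable (path_filtration t)"
    by (intro lborel.borel_measurable_lebesgue_integral) (simp add: case_prod_beta)
  then show ?thesis
    by (simp add: running_def[abs_def] set_lebesgue_integral_def)
qed

text \<open>Over a partition into \<open>Suc N\<close> equal pieces the errors add up to
  \<open>C * T\<^sup>2 / real (Suc N)\<close>, which vanishes as N grows. This takes the place of
  differentiating \<open>g\<close>.\<close>

lemma le_of_quadratic_increments: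
  fixes g :: "real \<Rightarrow> real"
  assumes T: "0 \<le> T" and incr: "\<And>s t. 0 \<le> s \<Longrightarrow> s \<le> t \<Longrightarrow> t \<le> T \<Longrightarrow> - (C * (t - s)\<^sup>2) \<le> g t - g s"
  shows "g 0 \<le> g T"
proof -
  have "- (C * T\<^sup>2) * (1 / real (Suc N)) \<le> g T - g 0" for N
  proof -
    define d where "d = T / real (Suc N)"
    have d: "0 \<le> d" "real (Suc N) * d = T"
      using T by (simp_all add: d_def)
    have "- (C * d\<^sup>2) \<le> g (real (Suc k) * d) - g (real k * d)" if "k \<in> {..<Suc N}" for k
    proof -
      have "real (Suc k) * d \<le> real (Suc N) * d"
        using that d(1) by (intro mult_right_mono) auto
      with incr[of "real k * d" "real (Suc k) * d"] d show ?thesis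
        by (simp add: algebra_simps)
    qed
    then have "(\<Sum>k<Suc N. - (C * d\<^sup>2)) \<le> (\<Sum>k<Suc N. g (real (Suc k) * d) - g (real k * d))"
      by (rule sum_mono)
    also have "\<dots> = g T - g 0"
      by (subst sum_lessThan_telescope) (simp only: d(2), simp)
    also have "(\<Sum>k<Suc N. - (C * d\<^sup>2)) = - (C * T\<^sup>2) * (1 / real (Suc N))"
      by (simp add: d_def power2_eq_square field_simps del: of_nat_Suc)
    finally show ?thesis .
  qed
  moreover have "(\<lambda>N. - (C * T\<^sup>2) * (1 / real (Suc N))) \<longlonglongrightarrow> - (C * T\<^sup>2) * 0"
    by (intro tendsto_mult tendsto_const LIMSEQ_inverse_real_of_nat[unfolded inverse_eq_divide])
  ultimately have "- (C * T\<^sup>2) * 0 \<le> g T - g 0"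
    by (intro LIMSEQ_le_const2) auto
  then show ?thesis by simp
qed

text \<open>The control is absorbed into the time-dependent rates \<rho>, so the probabilistic
  estimates see no actions. All that is known about the dynamics is \<open>mart\<close>, for
  functions of the state alone.\<close>

locale jump_law =
  fixes P :: "(real \<Rightarrow> 's::finite) measure" and \<rho> :: "real \<Rightarrow> 's \<Rightarrow> 's \<Rightarrow> real" and i0 :: 's and R :: real
  assumes prob: "prob_space P" and sets_P: "sets P = sets path_space"
    and init: "AE x in P. x 0 = i0"
    and rate: "\<And>j. bounded_rate (\<lambda>r i. \<rho> r i j) R"
    and mart: "\<And>f. martingale P path_filtration
      (\<lambda>t x. f (x t) - running (\<lambda>r i. \<Sum>j\<in>UNIV. \<rho> r i j * f j) 0 t x)"
begin

interpretation prob_space P by (rule prob)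

abbreviation gen :: "('s \<Rightarrow> real) \<Rightarrow> real \<Rightarrow> 's \<Rightarrow> real" where
  "gen f r i \<equiv> \<Sum>j\<in>UNIV. \<rho> r i j * f j"

lemma space_P: "space P = cadlag_paths"
  using sets_eq_imp_space_eq[OF sets_P] by simp

lemma subalg: "subalgebra P (path_filtration s)"
  by (rule subalgebra_path_filtration[OF sets_P])

lemma measurable_coord: "0 \<le> r \<Longrightarrow> (\<lambda>x. x r) \<in> P \<rightarrow>\<^sub>M count_space UNIV"
  using measurable_coord_path_space[of r] unfolding measurable_cong_sets[OF sets_P refl] .

lemma measurable_fun_coord: "0 \<le> r \<Longrightarrow> (\<lambda>x. f (x r) :: real) \<in> borel_measurable P"
  by (rule measurable_compose[OF measurable_coord]) simp_all

lemma R_nonneg: "0 \<le> R"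
  by (rule bounded_rate_nonneg[OF rate])

lemma gen_abs_le:
  assumes "\<And>j. \<bar>f j\<bar> \<le> B" "0 \<le> r"
  shows "\<bar>gen f r i\<bar> \<le> real CARD('s) * R * B"
proof -
  have "\<bar>gen f r i\<bar> \<le> (\<Sum>j\<in>UNIV. \<bar>\<rho> r i j * f j\<bar>)"
    by (rule sum_abs)
  also have "\<dots> \<le> (\<Sum>j\<in>(UNIV::'s set). R * B)"
    using assms bounded_rateD(2)[OF rate assms(2)] R_nonneg
    by (intro sum_mono) (auto simp: abs_mult intro!: mult_mono)
  finally show ?thesis by simp
qed

lemma bounded_rate_gen:
  assumes "\<And>j. \<bar>f j\<bar> \<le> B"
  shows "bounded_rate (gen f) (real CARD('s) * R * B)"
  unfolding bounded_rate_def
proof (intro conjI allI impI gen_abs_le assms)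
  fix i
  have "(\<lambda>r. \<Sum>j\<in>UNIV. (indicator {0..} r * \<rho> r i j) * f j) \<in> borel_measurable borel"
    by (intro borel_measurable_sum borel_measurable_times bounded_rateD(1)[OF rate]) simp
  then show "(\<lambda>r. indicator {0..} r * gen f r i) \<in> borel_measurable borel"
    by (simp add: sum_distrib_left mult.assoc)
qed

lemma integrable_bounded:
  assumes "f \<in> borel_measurable P" "\<And>x. x \<in> cadlag_paths \<Longrightarrow> \<bar>f x\<bar> \<le> (b::real)"
  shows "integrable P f"
  by (rule integrable_const_bound[where B=b]) (use assms in \<open>auto simp: space_P\<close>)

text \<open>Martingale increments are orthogonal to bounded functions of the past. \<open>Z\<close>
  will be the indicator of the state at time s, and later the weight \<open>A s\<close>.\<close>

lemma martingale_increment: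
  assumes Z: "Z \<in> borel_measurable (path_filtration s)" "\<And>x. x \<in> cadlag_paths \<Longrightarrow> \<bar>Z x\<bar> \<le> b"
    and s: "0 \<le> s" "s \<le> t"
  shows "(LINT x|P. Z x * (f (x t) - f (x s) - running (gen f) s t x)) = 0"
proof -
  interpret sigma_finite_subalgebra P "path_filtration s"
    by (intro finite_measure_subalgebra_is_sigma_finite finite_measure_subalgebra.intro
        finite_measure_subalgebra_axioms.intro subalg) unfold_locales
  define Y where "Y = (\<lambda>t x. f (x t) - running (gen f) 0 t x)"
  have t: "0 \<le> t" using s by simp
  have Y: "Y r \<in> borel_measurable P" "integrable P (Y r)" if "0 \<le> r" for r
    using mart[of f] that measurable_from_subalg[OF subalg]
    by (auto simp: martingale_def Y_def)
  have ce: "AE x in P. real_cond_exp P (path_filtration s) (Y t) x = Y s x"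
    using mart[of f] s by (auto simp: martingale_def Y_def)
  have ZP: "Z \<in> borel_measurable P"
    by (rule measurable_from_subalg[OF subalg Z(1)])
  have int: "integrable P (\<lambda>x. Z x * Y r x)" if "0 \<le> r" for r
    by (rule Bochner_Integration.integrable_bound[OF integrable_mult_right[OF integrable_abs[OF Y(2)[OF that]], of b]])
       (use ZP Y(1)[OF that] Z(2) in \<open>auto simp: abs_mult space_P intro!: AE_I2 mult_mono order_trans[OF Z(2) abs_ge_self]\<close>)
  have "(LINT x|P. Z x * Y t x) = (LINT x|P. Z x * real_cond_exp P (path_filtration s) (Y t) x)"
    by (rule real_cond_exp_intg(2)[symmetric]) (use int t Z Y in auto)
  also have "\<dots> = (LINT x|P. Z x * Y s x)"
    by (rule integral_cong_AE) (use ce ZP Y(1)[OF s(1)] in \<open>auto intro!: borel_measurable_times borel_measurable_cond_exp2\<close>)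
  finally have "(LINT x|P. Z x * Y t x - Z x * Y s x) = 0"
    using int s t by simp
  also have "(LINT x|P. Z x * Y t x - Z x * Y s x) = (LINT x|P. Z x * (f (x t) - f (x s) - running (gen f) s t x))"
  proof (rule Bochner_Integration.integral_cong[OF refl])
    fix x assume "x \<in> space P"
    then have "running (gen f) 0 t x = running (gen f) 0 s x + running (gen f) s t x"
      \<comment> \<open>\<open>f\<close> takes finitely many values, so the maximum supplies a
        bound.\<close>
      by (intro running_add[OF bounded_rate_gen[of f "Max (range (\<lambda>j. \<bar>f j\<bar>))"]] s) (auto simp: space_P)
    then show "Z x * Y t x - Z x * Y s x = Z x * (f (x t) - f (x s) - running (gen f) s t x)"
      by (simp add: Y_def algebra_simps)
  qed
  finally show ?thesis .
qed

text \<open>Test the increment with \<open>f\<close> the indicator of j and \<open>Z\<close> the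
  indicator of being in j at time s: the probability of having left j is, up to sign, an expected
  compensator, hence at most \<open>R * (t - s)\<close>. Summing over j gives the factor
  \<open>CARD('s)\<close>.\<close>

lemma prob_moved_le:
  assumes s: "0 \<le> s" "s \<le> t"
  shows "(LINT x|P. of_bool (x t \<noteq> x s)) \<le> real CARD('s) * (R * (t - s))"
proof -
  have t: "0 \<le> t" using s by simp
  have one: "(LINT x|P. of_bool (x s = j \<and> x t \<noteq> j)) \<le> R * (t - s)" for j
  proof -
    define Z :: "(real \<Rightarrow> 's) \<Rightarrow> real" where "Z = (\<lambda>x. of_bool (x s = j))"
    define f :: "'s \<Rightarrow> real" where "f = (\<lambda>k. of_bool (k = j))"
    have gen_f: "gen f r i = \<rho> r i j" for r i
      by (simp add: f_def)
    have Z: "Z \<in> borel_measurable (path_filtration s)"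
      unfolding Z_def by (rule measurable_compose[OF measurable_coord_filtration]) (use s in auto)
    have ZP: "Z \<in> borel_measurable P"
      by (rule measurable_from_subalg[OF subalg Z])
    have run: "\<bar>running (gen f) s t x\<bar> \<le> R * (t - s)" if "x \<in> cadlag_paths" for x
      unfolding gen_f by (rule running_abs_le[OF rate that s])
    have meas_run: "running (gen f) s t \<in> borel_measurable P"
    proof -
      have "(\<lambda>x. running (gen f) 0 t x - running (gen f) 0 s x) \<in> borel_measurable P"
        unfolding gen_f using measurable_running[OF rate] measurable_from_subalg[OF subalg] s t
        by (intro borel_measurable_diff) blast+
      then show ?thesis
        using running_add[OF rate _ s] unfolding gen_f by (subst measurable_cong) (auto simp: space_P)
    qed
    have "(LINT x|P. Z x * (f (x t) - f (x s) - running (gen f) s t x)) = 0"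
      by (rule martingale_increment[OF Z _ s, of 1]) (auto simp: Z_def)
    moreover have "(LINT x|P. - of_bool (x s = j \<and> x t \<noteq> j) + R * (t - s)) \<ge>
        (LINT x|P. Z x * (f (x t) - f (x s) - running (gen f) s t x))"
    proof (rule integral_mono)
      have m: "(\<lambda>x. of_bool (x s = j \<and> x t \<noteq> j) :: real) \<in> borel_measurable P"
        using measurable_coord[OF s(1)] measurable_coord[OF t] by measurable
      show "integrable P (\<lambda>x. - of_bool (x s = j \<and> x t \<noteq> j) + R * (t - s))"
        by (rule integrable_bounded[where b="1 + \<bar>R * (t - s)\<bar>"])
           (use m in auto)
      show "integrable P (\<lambda>x. Z x * (f (x t) - f (x s) - running (gen f) s t x))"
        by (rule integrable_bounded[where b="1 + R * (t - s)"])
           (use ZP meas_run measurable_fun_coord[of t f] measurable_fun_coord[of s f] s t R_nonneg run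
             in \<open>auto simp: Z_def f_def abs_le_iff intro!: borel_measurable_times borel_measurable_diff dest!: run\<close>)
      show "Z x * (f (x t) - f (x s) - running (gen f) s t x) \<le> - of_bool (x s = j \<and> x t \<noteq> j) + R * (t - s)"
        if "x \<in> space P" for x
        using run[of x] that s R_nonneg by (auto simp: Z_def f_def space_P abs_le_iff)
    qed
    moreover have "(LINT x|P. - of_bool (x s = j \<and> x t \<noteq> j) + R * (t - s)) = R * (t - s) - (LINT x|P. of_bool (x s = j \<and> x t \<noteq> j))"
    proof -
      have m: "(\<lambda>x. of_bool (x s = j \<and> x t \<noteq> j) :: real) \<in> borel_measurable P"
        using measurable_coord[OF s(1)] measurable_coord[OF t] by measurable
      have "integrable P (\<lambda>x. of_bool (x s = j \<and> x t \<noteq> j) :: real)"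
        by (rule integrable_bounded[where b=1, OF m]) auto
      then show ?thesis by (simp add: prob_space)
    qed
    ultimately show ?thesis by linarith
  qed
  have "(LINT x|P. of_bool (x t \<noteq> x s) :: real) = (LINT x|P. (\<Sum>j\<in>UNIV. of_bool (x s = j \<and> x t \<noteq> j)))"
  proof (rule Bochner_Integration.integral_cong[OF refl])
    fix x :: "real \<Rightarrow> 's"
    have "(\<Sum>j\<in>UNIV. of_bool (x s = j \<and> x t \<noteq> j) :: real) = (\<Sum>j\<in>UNIV. if j = x s then of_bool (x t \<noteq> x s) else 0)"
      by (rule sum.cong) auto
    then show "of_bool (x t \<noteq> x s) = (\<Sum>j\<in>UNIV. of_bool (x s = j \<and> x t \<noteq> j) :: real)"
      by simp
  qed
  also have "\<dots> = (\<Sum>j\<in>UNIV. (LINT x|P. of_bool (x s = j \<and> x t \<noteq> j)))"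
  proof (rule Bochner_Integration.integral_sum)
    fix j
    have "(\<lambda>x. of_bool (x s = j \<and> x t \<noteq> j) :: real) \<in> borel_measurable P"
      using measurable_coord[OF s(1)] measurable_coord[OF t] by measurable
    then show "integrable P (\<lambda>x. of_bool (x s = j \<and> x t \<noteq> j) :: real)"
      by (rule integrable_bounded[where b=1]) auto
  qed
  also have "\<dots> \<le> (\<Sum>j\<in>(UNIV::'s set). R * (t - s))"
    by (intro sum_mono one)
  finally show ?thesis by simp
qed

text \<open>By Fubini, the expected time spent away from the state at time s integrates a
  probability of order t - s over an interval of length t - s. This is where the quadratic order
  comes from.\<close>

lemma prob_moved_integral_le:
  assumes s: "0 \<le> s" "s \<le> t"
  shows "integrable P (\<lambda>x. LINT r:{s..t}|lborel. of_bool (x r \<noteq> x s) :: real)"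
    and "(LINT x|P. (LINT r:{s..t}|lborel. of_bool (x r \<noteq> x s))) \<le> real CARD('s) * R * (t - s)\<^sup>2"
proof -
  have t: "0 \<le> t" using s by simp
  interpret pair_sigma_finite P lborel ..
  define G :: "(real \<Rightarrow> 's) \<Rightarrow> real \<Rightarrow> real" where "G = (\<lambda>x r. indicator {s..t} r * of_bool (x r \<noteq> x s))"
  have "(\<lambda>(r, x). indicator {0..t} r * (indicator {j} (x r) :: real)) \<in> borel_measurable (borel \<Otimes>\<^sub>M P)" for j
    by (rule measurable_path_indicator[OF _ measurable_coord t]) (auto simp: space_P)
  then have j: "(\<lambda>(x, r). indicator {0..t} r * (indicator {j} (x r) :: real)) \<in> borel_measurable (P \<Otimes>\<^sub>M lborel)" for j
    by (subst measurable_cong_sets[OF sets_pair_measure_cong[OF refl sets_lborel] refl]) (auto dest: measurable_pair_swap simp: case_prod_beta)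
  have s': "(\<lambda>p. of_bool (fst p s \<noteq> j) :: real) \<in> borel_measurable (P \<Otimes>\<^sub>M lborel)" for j
    by (rule measurable_compose[OF measurable_compose[OF measurable_fst measurable_coord]]) (use s in auto)
  \<comment> \<open>Decomposing over the state j occupied at time r expresses the moved event
    through jointly measurable indicators.\<close>
  have "(\<lambda>p. \<Sum>j\<in>UNIV. indicator {s..t} (snd p) * (case p of (x, r) \<Rightarrow> indicator {0..t} r * (indicator {j} (x r) :: real)) * of_bool (fst p s \<noteq> j))
      \<in> borel_measurable (P \<Otimes>\<^sub>M lborel)"
    by (intro borel_measurable_sum borel_measurable_times j s') measurable
  also have "(\<lambda>p. \<Sum>j\<in>UNIV. indicator {s..t} (snd p) * (case p of (x, r) \<Rightarrow> indicator {0..t} r * (indicator {j} (x r) :: real)) * of_bool (fst p s \<noteq> j))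
      = case_prod G"
  proof
    fix p :: "(real \<Rightarrow> 's) \<times> real"
    have "(\<Sum>j\<in>UNIV. indicator {s..t} (snd p) * (case p of (x, r) \<Rightarrow> indicator {0..t} r * (indicator {j} (x r) :: real)) * of_bool (fst p s \<noteq> j))
      = (\<Sum>j\<in>UNIV. if j = fst p (snd p) then indicator {s..t} (snd p) * of_bool (fst p (snd p) \<noteq> fst p s) else 0)"
      using s by (intro sum.cong) (auto simp: indicator_def split: prod.splits)
    then show "(\<Sum>j\<in>UNIV. indicator {s..t} (snd p) * (case p of (x, r) \<Rightarrow> indicator {0..t} r * (indicator {j} (x r) :: real)) * of_bool (fst p s \<noteq> j)) = case_prod G p"
      by (simp add: G_def case_prod_beta)
  qed
  finally have G: "case_prod G \<in> borel_measurable (P \<Otimes>\<^sub>M lborel)" .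
  have int: "integrable (P \<Otimes>\<^sub>M lborel) (case_prod G)"
  proof (rule integrableI_bounded_set[where A="space P \<times> {s..t}" and B=1])
    show "emeasure (P \<Otimes>\<^sub>M lborel) (space P \<times> {s..t}) < \<infinity>"
      by (subst lborel.emeasure_pair_measure_Times) (use s in \<open>auto simp: emeasure_space_1\<close>)
    show "AE p in P \<Otimes>\<^sub>M lborel. p \<in> space P \<times> {s..t} \<longrightarrow> norm (case_prod G p) \<le> 1"
      by (rule AE_I2) (simp add: G_def case_prod_beta)
    show "AE p in P \<Otimes>\<^sub>M lborel. p \<notin> space P \<times> {s..t} \<longrightarrow> case_prod G p = 0"
      by (rule AE_I2) (auto simp: G_def case_prod_beta space_pair_measure indicator_eq_0_iff)
  qed (use G s in auto)
  show "integrable P (\<lambda>x. LINT r:{s..t}|lborel. of_bool (x r \<noteq> x s) :: real)"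
    using integrable_fst[OF int] by (simp add: G_def set_lebesgue_integral_def)
  have "(LINT x|P. (LINT r:{s..t}|lborel. of_bool (x r \<noteq> x s))) = (LINT x|P. (LINT r|lborel. G x r))"
    by (simp add: G_def set_lebesgue_integral_def)
  also have "\<dots> = (LINT r|lborel. (LINT x|P. G x r))"
    by (rule Fubini_integral[OF int, symmetric])
  also have "\<dots> \<le> (LINT r:{s..t}|lborel. real CARD('s) * (R * (t - s)))"
    unfolding set_lebesgue_integral_def
  proof (rule integral_mono)
    show "integrable lborel (\<lambda>r. LINT x|P. G x r)"
      by (rule integrable_snd[OF int])
    show "integrable lborel (\<lambda>r. indicator {s..t} r *\<^sub>R (real CARD('s) * (R * (t - s))))"
      using set_integrable_bounded[of s t "\<lambda>_. real CARD('s) * (R * (t - s))" "\<bar>real CARD('s) * (R * (t - s))\<bar>"]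
      by (simp add: set_integrable_def)
    fix r
    show "(LINT x|P. G x r) \<le> indicator {s..t} r *\<^sub>R (real CARD('s) * (R * (t - s)))"
    proof (cases "r \<in> {s..t}")
      case True
      have "(LINT x|P. of_bool (x r \<noteq> x s)) \<le> real CARD('s) * (R * (r - s))"
        using True s by (intro prob_moved_le) auto
      also have "\<dots> \<le> real CARD('s) * (R * (t - s))"
        using True R_nonneg by (intro mult_left_mono) auto
      finally show ?thesis
        using True by (simp add: G_def)
    qed (simp add: G_def)
  qed
  also have "\<dots> = real CARD('s) * R * (t - s)\<^sup>2"
    using s by (simp add: set_lebesgue_integral_def power2_eq_square)
  finally show "(LINT x|P. (LINT r:{s..t}|lborel. of_bool (x r \<noteq> x s))) \<le> real CARD('s) * R * (t - s)\<^sup>2" .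
qed

end

subsection \<open>The Feynman--Kac inequality\<close>

text \<open>Taylor expansion with Lagrange remainder. It serves both for the exponential weight over
  a short time step and for the risk-sensitive cost at small \<theta>.\<close>

lemma exp_second_order_bound:
  fixes y :: real
  assumes "\<bar>y\<bar> \<le> m"
  shows "\<bar>exp y - 1 - y\<bar> \<le> y\<^sup>2 * exp m"
proof -
  obtain t where t: "\<bar>t\<bar> \<le> \<bar>y\<bar>" "exp y = (\<Sum>m<2. y ^ m / fact m) + exp t / fact 2 * y ^ 2"
    using Maclaurin_exp_le[of y 2] by auto
  then have "\<bar>exp y - 1 - y\<bar> = exp t / 2 * y\<^sup>2"
    by (simp add: numeral_2_eq_2)
  also have "\<dots> \<le> exp m * y\<^sup>2"
  proof (rule mult_right_mono)
    have "exp t \<le> exp m"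
      using t(1) assms by auto
    then show "exp t / 2 \<le> exp m"
      using exp_ge_zero[of m] by linarith
  qed simp
  finally show ?thesis by (simp add: mult.commute)
qed

lemma (in jump_law) bounded_rate_gen_add:
  assumes \<kappa>: "bounded_rate \<kappa> B" and \<phi>: "bounded_rate \<phi> B"
  shows "bounded_rate (\<lambda>r j. gen (\<phi> r) r j + \<kappa> r j * \<phi> r j) (real CARD('s) * R * B + B * B)"
  unfolding bounded_rate_def
proof (intro conjI allI impI)
  fix j
  have "(\<lambda>r. (\<Sum>k\<in>UNIV. (indicator {0..} r * \<rho> r j k) * (indicator {0..} r * \<phi> r k))
      + (indicator {0..} r * \<kappa> r j) * (indicator {0..} r * \<phi> r j)) \<in> borel_measurable borel"
    by (intro borel_measurable_add borel_measurable_sum borel_measurable_times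
        bounded_rateD(1)[OF rate] bounded_rateD(1)[OF \<phi>] bounded_rateD(1)[OF \<kappa>])
  also have "(\<lambda>r. (\<Sum>k\<in>UNIV. (indicator {0..} r * \<rho> r j k) * (indicator {0..} r * \<phi> r k))
      + (indicator {0..} r * \<kappa> r j) * (indicator {0..} r * \<phi> r j)) =
      (\<lambda>r. indicator {0..} r * (gen (\<phi> r) r j + \<kappa> r j * \<phi> r j))"
    by (auto simp: indicator_def fun_eq_iff)
  finally show "(\<lambda>r. indicator {0..} r * (gen (\<phi> r) r j + \<kappa> r j * \<phi> r j)) \<in> borel_measurable borel" .
  fix r :: real assume r: "0 \<le> r"
  have "\<bar>\<kappa> r j * \<phi> r j\<bar> \<le> B * B"
    unfolding abs_mult using bounded_rateD(2)[OF \<kappa> r] bounded_rateD(2)[OF \<phi> r] bounded_rate_nonneg[OF \<phi>]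
    by (intro mult_mono) auto
  then show "\<bar>gen (\<phi> r) r j + \<kappa> r j * \<phi> r j\<bar> \<le> real CARD('s) * R * B + B * B"
    using gen_abs_le[of "\<phi> r" B r j, OF bounded_rateD(2)[OF \<phi> r] r] by linarith
qed

text \<open>Integrated form of -d\<phi>/dt <= gen \<phi> + \<kappa> \<phi>, which makes sense for
  coefficients measurable in time. The sign of \<open>\<phi>\<close> is left free so that its
  negative can be treated as well.\<close>

locale subsolution = jump_law P \<rho> i0 R
  for P :: "(real \<Rightarrow> 's::finite) measure" and \<rho> i0 R +
  fixes \<kappa> \<phi> :: "real \<Rightarrow> 's \<Rightarrow> real" and B L :: real
  assumes \<kappa>: "bounded_rate \<kappa> B" and \<phi>: "bounded_rate \<phi> B"
    and \<phi>_lipschitz: "\<And>s t j. 0 \<le> s \<Longrightarrow> s \<le> t \<Longrightarrow> \<bar>\<phi> t j - \<phi> s j\<bar> \<le> L * (t - s)"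
    and sub: "\<And>s t j. 0 \<le> s \<Longrightarrow> s \<le> t \<Longrightarrow>
      \<phi> s j - \<phi> t j \<le> (LINT r:{s..t}|lborel. gen (\<phi> r) r j + \<kappa> r j * \<phi> r j)"
begin

interpretation prob_space P by (rule prob)

lemma \<phi>_bound: "0 \<le> t \<Longrightarrow> \<bar>\<phi> t j\<bar> \<le> B"
  by (rule bounded_rateD(2)[OF \<phi>])

lemma B_nonneg: "0 \<le> B"
  by (rule bounded_rate_nonneg[OF \<kappa>])

lemma L_nonneg: "0 \<le> L"
  using \<phi>_lipschitz[of 0 1] by (auto intro: order_trans[OF abs_ge_zero])

abbreviation "H r j \<equiv> gen (\<phi> r) r j + \<kappa> r j * \<phi> r j"

lemmas bounded_rate_H = bounded_rate_gen_add[OF \<kappa> \<phi>]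

text \<open>Feynman--Kac weight; being adapted and bounded, \<open>A s\<close> is an admissible
  factor in \<open>martingale_increment\<close>.\<close>

definition A :: "real \<Rightarrow> (real \<Rightarrow> 's) \<Rightarrow> real" where
  "A t x = exp (running \<kappa> 0 t x)"

lemma A_le:
  assumes "x \<in> cadlag_paths" "0 \<le> t" "t \<le> T"
  shows "A t x \<le> exp (B * T)"
proof -
  have "running \<kappa> 0 t x \<le> B * (t - 0)"
    using running_abs_le[OF \<kappa> assms(1) _ assms(2)] by auto
  also have "\<dots> \<le> B * T"
    using assms B_nonneg by (intro mult_left_mono) auto
  finally show ?thesis by (simp add: A_def)
qed

lemma measurable_A: "0 \<le> t \<Longrightarrow> A t \<in> borel_measurable (path_filtration t)"
  unfolding A_def[abs_def] using measurable_running[OF \<kappa>, of t] by measurable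

text \<open>\<open>C1 * d\<close> is the price of replacing \<open>\<phi> r\<close> by
  \<open>\<phi> t\<close> at a fixed state; \<open>C2\<close>, twice the bound on \<open>H\<close>,
  is paid when the path has left \<open>x s\<close>.\<close>

definition C1 :: real where "C1 = real CARD('s) * R * L + B * L"
definition C2 :: real where "C2 = 2 * (real CARD('s) * R * B + B * B)"

text \<open>The increment of \<open>A t x * \<phi> t (x t)\<close> is \<open>A s x\<close> times a
  sum of three terms: the move \<open>\<phi> t (x t) - \<phi> t (x s)\<close>, the time change
  \<open>\<phi> t (x s) - \<phi> s (x s)\<close> and the weight change
  \<open>(exp J - 1) * \<phi> t (x t)\<close>. Freezing \<open>\<phi>\<close> at the right end makes
  the first a martingale increment plus the compensator \<open>g\<close>. The subsolution inequality
  bounds the second below by minus the integral of \<open>H r (x s)\<close>, and the third is close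
  to \<open>J * \<phi> t (x t)\<close>. Up to order d^2, what is left after cancellation with
  \<open>g\<close> is paid for by moves of the path.\<close>

lemma increment_lower:
  assumes x: "x \<in> cadlag_paths" and s: "0 \<le> s" "s \<le> t" "t \<le> T"
  defines "d \<equiv> t - s"
  shows "A s x * (\<phi> t (x t) - \<phi> t (x s) - running (gen (\<phi> t)) s t x)
      - exp (B * T) * ((C1 + B * (B\<^sup>2 * exp (B * T))) * d\<^sup>2
          + C2 * ((LINT r:{s..t}|lborel. of_bool (x r \<noteq> x s)) + d * of_bool (x t \<noteq> x s)))
      \<le> A t x * \<phi> t (x t) - A s x * \<phi> s (x s)"
proof -
  define J where "J = running \<kappa> s t x"
  define g where "g = running (gen (\<phi> t)) s t x"
  define m where "m = of_bool (x t \<noteq> x s) * (1::real)"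
  define N where "N = (LINT r:{s..t}|lborel. of_bool (x r \<noteq> x s) :: real)"
  define K where "K = B\<^sup>2 * exp (B * T)"
  have t: "0 \<le> t" and d: "0 \<le> d" "d \<le> T" using s by (auto simp: d_def)
  have At: "A t x = A s x * exp J"
    unfolding A_def J_def running_add[OF \<kappa> x s(1,2)] by (rule exp_add)
  have J: "\<bar>J\<bar> \<le> B * d"
    unfolding J_def d_def by (rule running_abs_le[OF \<kappa> x s(1,2)])
  have BdT: "B * d \<le> B * T"
    using d B_nonneg by (intro mult_left_mono) auto
  have "\<bar>exp J - 1 - J\<bar> \<le> J\<^sup>2 * exp (B * T)"
    by (rule exp_second_order_bound) (use J BdT in linarith)
  also have "\<dots> \<le> (B * d)\<^sup>2 * exp (B * T)"
    using J power_mono[of "\<bar>J\<bar>" "B * d" 2] by (intro mult_right_mono) auto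
  also have "\<dots> = K * d\<^sup>2"
    by (simp add: K_def power_mult_distrib)
  finally have expJ: "\<bar>exp J - 1 - J\<bar> \<le> K * d\<^sup>2" .
  have "\<bar>(exp J - 1 - J) * \<phi> t (x t)\<bar> \<le> (K * d\<^sup>2) * B"
    unfolding abs_mult using expJ \<phi>_bound[OF t] by (intro mult_mono) auto
  then have e1: "J * \<phi> t (x t) - B * K * d\<^sup>2 \<le> (exp J - 1) * \<phi> t (x t)"
    by (auto simp: abs_le_iff algebra_simps)
  have e2: "- (LINT r:{s..t}|lborel. H r (x s)) \<le> \<phi> t (x s) - \<phi> s (x s)"
    using sub[OF s(1,2), of "x s"] by simp
  have int_g: "set_integrable lborel {s..t} (\<lambda>r. gen (\<phi> t) r (x r))"
    by (rule set_integrable_path[OF bounded_rate_gen x s(1)]) (use \<phi>_bound t in auto)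
  have int_\<kappa>: "set_integrable lborel {s..t} (\<lambda>r. \<kappa> r (x r) * \<phi> t (x t))"
    by (rule set_integrable_mult_left) (use set_integrable_path[OF \<kappa> x s(1)] in auto)
  have int_H: "set_integrable lborel {s..t} (\<lambda>r. H r (x s))"
    by (rule set_integrable_rate[OF bounded_rate_H s(1)])
  have int_N: "set_integrable lborel {s..t} (\<lambda>r. of_bool (x r \<noteq> x s) :: real)"
  proof (rule set_integrable_path[OF _ x s(1)])
    show "bounded_rate (\<lambda>_ i. of_bool (i \<noteq> x s) :: real) 1"
      by (auto simp: bounded_rate_def)
  qed
  have int_c: "set_integrable lborel {s..t} (\<lambda>r. c :: real)" for c
    by (rule set_integrable_bounded[where B="\<bar>c\<bar>"]) auto
  have "(LINT r:{s..t}|lborel. - (C1 * d + C2 * m) - C2 * of_bool (x r \<noteq> x s))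
      \<le> (LINT r:{s..t}|lborel. gen (\<phi> t) r (x r) + \<kappa> r (x r) * \<phi> t (x t) - H r (x s))"
  proof (rule set_integral_mono)
    show "set_integrable lborel {s..t} (\<lambda>r. - (C1 * d + C2 * m) - C2 * of_bool (x r \<noteq> x s))"
      by (intro set_integral_diff(1) int_c set_integrable_mult_right int_N)
    show "set_integrable lborel {s..t} (\<lambda>r. gen (\<phi> t) r (x r) + \<kappa> r (x r) * \<phi> t (x t) - H r (x s))"
      by (intro set_integral_diff(1) set_integral_add(1) int_g int_\<kappa> int_H)
    fix r assume r: "r \<in> {s..t}"
    then have r0: "0 \<le> r" "0 \<le> t - r" "t - r \<le> d" using s by (auto simp: d_def)
    have C1d: "0 \<le> C1 * d" and C2m: "0 \<le> C2 * m" "0 \<le> C2"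
      using R_nonneg L_nonneg B_nonneg d by (auto simp: C1_def C2_def m_def)
    have g1: "\<bar>gen (\<phi> t) r i\<bar> \<le> real CARD('s) * R * B" for i
      by (rule gen_abs_le) (use \<phi>_bound t r0 in auto)
    have k1: "\<bar>\<kappa> r i * \<phi> t l\<bar> \<le> B * B" for i l
      unfolding abs_mult using bounded_rateD(2)[OF \<kappa> r0(1)] \<phi>_bound[OF t] B_nonneg by (intro mult_mono) auto
    show "- (C1 * d + C2 * m) - C2 * of_bool (x r \<noteq> x s)
        \<le> gen (\<phi> t) r (x r) + \<kappa> r (x r) * \<phi> t (x t) - H r (x s)"
    proof (cases "x r = x s")
      case False
      have "\<bar>H r (x s)\<bar> \<le> real CARD('s) * R * B + B * B"
        by (rule bounded_rateD(2)[OF bounded_rate_H r0(1)])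
      with False C1d C2m g1[of "x r"] k1[of "x r" "x t"] show ?thesis
        by (simp add: C2_def)
    next
      case True
      have Lr: "\<bar>\<phi> t k - \<phi> r k\<bar> \<le> L * d" for k
        using \<phi>_lipschitz[of r t k] r r0 L_nonneg mult_left_mono[OF r0(3), of L] by force
      have "gen (\<phi> t) r (x s) - gen (\<phi> r) r (x s) = gen (\<lambda>k. \<phi> t k - \<phi> r k) r (x s)"
        by (simp add: sum_subtractf right_diff_distrib)
      then have a1: "\<bar>gen (\<phi> t) r (x s) - gen (\<phi> r) r (x s)\<bar> \<le> real CARD('s) * R * (L * d)"
        using gen_abs_le[of "\<lambda>k. \<phi> t k - \<phi> r k" "L * d" r "x s"] Lr r0 by simp
      have a2: "\<bar>\<kappa> r (x s) * (\<phi> t (x t) - \<phi> r (x s))\<bar> \<le> B * (L * d + 2 * B * m)"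
        unfolding abs_mult
      proof (rule mult_mono)
        show "\<bar>\<phi> t (x t) - \<phi> r (x s)\<bar> \<le> L * d + 2 * B * m"
          using Lr[of "x s"] \<phi>_bound[OF t, of "x t"] \<phi>_bound[OF r0(1), of "x s"] L_nonneg d
          by (cases "x t = x s") (auto simp: m_def intro: order_trans[OF abs_triangle_ineq4])
      qed (use bounded_rateD(2)[OF \<kappa> r0(1)] B_nonneg in auto)
      have "B * (2 * B * m) \<le> C2 * m"
        using R_nonneg B_nonneg by (simp add: C2_def m_def)
      then have "- (C1 * d + C2 * m) \<le> - (real CARD('s) * R * (L * d)) - B * (L * d + 2 * B * m)"
        by (simp add: C1_def algebra_simps)
      also have "\<dots> \<le> (gen (\<phi> t) r (x s) - gen (\<phi> r) r (x s)) + \<kappa> r (x s) * (\<phi> t (x t) - \<phi> r (x s))"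
        using a1 a2 by linarith
      finally show ?thesis
        using True by (simp add: algebra_simps)
    qed
  qed
  also have "(LINT r:{s..t}|lborel. gen (\<phi> t) r (x r) + \<kappa> r (x r) * \<phi> t (x t) - H r (x s))
      = g + J * \<phi> t (x t) - (LINT r:{s..t}|lborel. H r (x s))"
    unfolding g_def J_def running_def
    by (subst set_integral_diff(2)[OF set_integral_add(1)[OF int_g int_\<kappa>] int_H],
        subst set_integral_add(2)[OF int_g int_\<kappa>]) simp
  also have "(LINT r:{s..t}|lborel. - (C1 * d + C2 * m) - C2 * of_bool (x r \<noteq> x s))
      = - (C1 * d + C2 * m) * d - C2 * N"
    unfolding N_def
    by (subst set_integral_diff(2)[OF int_c set_integrable_mult_right]) (use int_N s in \<open>auto simp: set_lebesgue_integral_def d_def\<close>)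
  finally have main: "- (C1 * d + C2 * m) * d - C2 * N - B * K * d\<^sup>2
      \<le> g + (\<phi> t (x s) - \<phi> s (x s)) + (exp J - 1) * \<phi> t (x t)"
    using e1 e2 by linarith
  define E where "E = (C1 + B * K) * d\<^sup>2 + C2 * (N + d * m)"
  have "0 \<le> N"
    unfolding N_def set_lebesgue_integral_def by (intro Bochner_Integration.integral_nonneg) simp
  \<comment> \<open>Nonnegativity of the error allows the random factor \<open>A s x\<close> to be
    replaced by its deterministic bound.\<close>
  then have E: "0 \<le> E"
    using R_nonneg L_nonneg B_nonneg d by (auto simp: E_def C1_def C2_def K_def m_def)
  have "- E \<le> g + (\<phi> t (x s) - \<phi> s (x s)) + (exp J - 1) * \<phi> t (x t)"
    using main by (simp add: E_def algebra_simps power2_eq_square)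
  then have "A s x * - E \<le> A s x * (g + (\<phi> t (x s) - \<phi> s (x s)) + (exp J - 1) * \<phi> t (x t))"
    by (intro mult_left_mono) (auto simp: A_def)
  moreover have "A s x * E \<le> exp (B * T) * E"
    using A_le[OF x s(1), of T] s E by (intro mult_right_mono) auto
  ultimately have "A s x * (\<phi> t (x t) - \<phi> t (x s) - g) - exp (B * T) * E \<le> A t x * \<phi> t (x t) - A s x * \<phi> s (x s)"
    unfolding At by (simp add: algebra_simps)
  then show ?thesis
    by (simp add: E_def g_def K_def N_def m_def)
qed

lemma integrable_A_\<phi>:
  assumes t: "0 \<le> t"
  shows "integrable P (\<lambda>x. A t x * \<phi> t (x t))"
proof (rule integrable_bounded)
  show "(\<lambda>x. A t x * \<phi> t (x t)) \<in> borel_measurable P"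
    using measurable_from_subalg[OF subalg measurable_A[OF t]] measurable_fun_coord[OF t]
    by (rule borel_measurable_times)
  show "\<bar>A t x * \<phi> t (x t)\<bar> \<le> exp (B * t) * B" if "x \<in> cadlag_paths" for x
    unfolding abs_mult using A_le[OF that t order_refl] \<phi>_bound[OF t]
    by (intro mult_mono) (auto simp: A_def)
qed

text \<open>In mean the martingale part of each increment vanishes, because \<open>A s\<close> is
  known at time s, and the errors are of order d^2 by the moving estimates. Hence the mean of
  \<open>A t x * \<phi> t (x t)\<close> is no smaller at T than at 0.\<close>

lemma feynman_kac_le:
  assumes T: "0 \<le> T"
  shows "\<phi> 0 i0 \<le> (LINT x|P. exp (running \<kappa> 0 T x) * \<phi> T (x T))"
proof -
  define g where "g = (\<lambda>t. LINT x|P. A t x * \<phi> t (x t))"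
  \<comment> \<open>The factor 2 collects the time spent away from \<open>x s\<close> and d times
    the probability of having moved at t; each is in mean at most
    \<open>CARD('s) * R * d\<^sup>2\<close>.\<close>
  define E where "E = exp (B * T) * (C1 + B * (B\<^sup>2 * exp (B * T)) + 2 * C2 * (real CARD('s) * R))"
  have "g 0 \<le> g T"
  proof (rule le_of_quadratic_increments[OF T])
    fix s t assume s: "0 \<le> s" "s \<le> t" "t \<le> T"
    define d where "d = t - s"
    have t: "0 \<le> t" and d: "0 \<le> d" using s by (auto simp: d_def)
    let ?D = "\<lambda>x. A s x * (\<phi> t (x t) - \<phi> t (x s) - running (gen (\<phi> t)) s t x)"
    let ?N = "\<lambda>x. LINT r:{s..t}|lborel. of_bool (x r \<noteq> x s) :: real"
    let ?m = "\<lambda>x. of_bool (x t \<noteq> x s) :: real"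
    let ?C = "(C1 + B * (B\<^sup>2 * exp (B * T))) * d\<^sup>2"
    have gen_rate: "bounded_rate (gen (\<phi> t)) (real CARD('s) * R * B)"
      by (rule bounded_rate_gen[OF \<phi>_bound[OF t]])
    have iD: "integrable P ?D"
    proof (rule integrable_bounded)
      have "(\<lambda>x. running (gen (\<phi> t)) 0 t x - running (gen (\<phi> t)) 0 s x) \<in> borel_measurable P"
        using measurable_running[OF gen_rate] measurable_from_subalg[OF subalg] s t
        by (intro borel_measurable_diff) blast+
      then have "running (gen (\<phi> t)) s t \<in> borel_measurable P"
        using running_add[OF gen_rate _ s(1,2)] by (subst measurable_cong) (auto simp: space_P)
      then show "?D \<in> borel_measurable P"
        using measurable_from_subalg[OF subalg measurable_A[OF s(1)]] measurable_fun_coord s t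
        by (intro borel_measurable_times borel_measurable_diff) auto
      fix x :: "real \<Rightarrow> 's" assume x: "x \<in> cadlag_paths"
      show "\<bar>?D x\<bar> \<le> exp (B * T) * (2 * B + real CARD('s) * R * B * (t - s))"
        unfolding abs_mult
      proof (rule mult_mono)
        show "\<bar>\<phi> t (x t) - \<phi> t (x s) - running (gen (\<phi> t)) s t x\<bar> \<le> 2 * B + real CARD('s) * R * B * (t - s)"
          using running_abs_le[OF gen_rate x s(1,2)] \<phi>_bound[OF t, of "x t"] \<phi>_bound[OF t, of "x s"]
          by (simp add: abs_le_iff)
      qed (use A_le[OF x s(1), of T] s in \<open>auto simp: A_def\<close>)
    qed
    have iN: "integrable P ?N"
      by (rule prob_moved_integral_le(1)[OF s(1,2)])
    have im: "integrable P ?m"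
    proof (rule integrable_bounded[where b=1])
      show "?m \<in> borel_measurable P"
        using measurable_coord[OF s(1)] measurable_coord[OF t] by measurable
    qed simp
    have D0: "(LINT x|P. ?D x) = 0"
      by (rule martingale_increment[OF measurable_A[OF s(1)] _ s(1,2), of "exp (B * s)"])
         (use A_le[OF _ s(1) order_refl] in \<open>auto simp: A_def\<close>)
    have "(LINT x|P. ?D x - exp (B * T) * (?C + C2 * (?N x + d * ?m x))) \<le> (LINT x|P. A t x * \<phi> t (x t) - A s x * \<phi> s (x s))"
    proof (rule integral_mono)
      show "integrable P (\<lambda>x. ?D x - exp (B * T) * (?C + C2 * (?N x + d * ?m x)))"
        by (intro Bochner_Integration.integrable_diff Bochner_Integration.integrable_add integrable_mult_right iD iN im integrable_const)
      show "integrable P (\<lambda>x. A t x * \<phi> t (x t) - A s x * \<phi> s (x s))"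
        by (intro Bochner_Integration.integrable_diff integrable_A_\<phi> s t)
    qed (use increment_lower[OF _ s] in \<open>auto simp: space_P d_def\<close>)
    also have "\<dots> = g t - g s"
      unfolding g_def by (intro Bochner_Integration.integral_diff integrable_A_\<phi> s t)
    also have "(LINT x|P. ?D x - exp (B * T) * (?C + C2 * (?N x + d * ?m x)))
        = - (exp (B * T) * (?C + C2 * ((LINT x|P. ?N x) + d * (LINT x|P. ?m x))))"
      using iD iN im D0 by (simp add: prob_space)
    finally have "- (exp (B * T) * (?C + C2 * ((LINT x|P. ?N x) + d * (LINT x|P. ?m x)))) \<le> g t - g s" .
    moreover have "(LINT x|P. ?N x) + d * (LINT x|P. ?m x) \<le> 2 * (real CARD('s) * R) * d\<^sup>2"
    proof -
      have "d * (LINT x|P. ?m x) \<le> d * (real CARD('s) * (R * d))"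
        using prob_moved_le[OF s(1,2)] d unfolding d_def by (intro mult_left_mono) auto
      then show ?thesis
        using prob_moved_integral_le(2)[OF s(1,2)] unfolding d_def by (simp add: power2_eq_square algebra_simps)
    qed
    then have "exp (B * T) * (?C + C2 * ((LINT x|P. ?N x) + d * (LINT x|P. ?m x)))
        \<le> exp (B * T) * (?C + C2 * (2 * (real CARD('s) * R) * d\<^sup>2))"
      using R_nonneg B_nonneg by (intro mult_left_mono add_left_mono) (auto simp: C2_def)
    moreover have "exp (B * T) * (?C + C2 * (2 * (real CARD('s) * R) * d\<^sup>2)) = E * d\<^sup>2"
      by (simp add: E_def algebra_simps)
    ultimately show "- (E * (t - s)\<^sup>2) \<le> g t - g s"
      unfolding d_def by linarith
  qed
  moreover have "g 0 = \<phi> 0 i0"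
  proof -
    have "g 0 = (LINT x|P. \<phi> 0 i0)"
      unfolding g_def
    proof (rule integral_cong_AE)
      show "AE x in P. A 0 x * \<phi> 0 (x 0) = \<phi> 0 i0"
        using init AE_space
      proof eventually_elim
        case (elim x)
        have "running \<kappa> 0 0 x = 0"
          using running_abs_le[OF \<kappa>, of x 0 0] elim(2) by (simp add: space_P)
        with elim show ?case by (simp add: A_def)
      qed
    qed (use integrable_A_\<phi>[of 0] in auto)
    then show ?thesis by (simp add: prob_space)
  qed
  ultimately show ?thesis
    by (simp add: g_def A_def)
qed

end

subsection \<open>Controlled chains\<close>

text \<open>Makes \<open>deriv\<close> the continuous derivative hidden in the existential
  definition, as the HJB equation is stated with \<open>deriv\<close>.\<close>

lemma C1_differentiable_on_real_iff:
  fixes f :: "real \<Rightarrow> real"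
  shows "f C1_differentiable_on S \<longleftrightarrow>
    (\<forall>x\<in>S. (f has_real_derivative deriv f x) (at x)) \<and> continuous_on S (deriv f)"
proof
  assume "f C1_differentiable_on S"
  then obtain D where D: "\<And>x. x \<in> S \<Longrightarrow> (f has_real_derivative D x) (at x)" "continuous_on S D"
    by (auto simp: C1_differentiable_on_def has_real_derivative_iff_has_vector_derivative)
  then have "\<And>x. x \<in> S \<Longrightarrow> deriv f x = D x"
    by (simp add: DERIV_imp_deriv)
  with D show "(\<forall>x\<in>S. (f has_real_derivative deriv f x) (at x)) \<and> continuous_on S (deriv f)"
    by (auto cong: continuous_on_cong)
next
  assume "(\<forall>x\<in>S. (f has_real_derivative deriv f x) (at x)) \<and> continuous_on S (deriv f)"
  then show "f C1_differentiable_on S"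
    by (auto simp: C1_differentiable_on_def has_real_derivative_iff_has_vector_derivative)
qed

lemma bounded_rate_mono: "bounded_rate h B \<Longrightarrow> B \<le> B' \<Longrightarrow> bounded_rate h B'"
  unfolding bounded_rate_def by (meson order_trans)

lemma set_integrable_exp_minus:
  assumes "0 < (\<alpha>::real)"
  shows "set_integrable lborel {0..} (\<lambda>t. exp (- \<alpha> * t))" "(LINT t:{0..}|lborel. exp (- \<alpha> * t)) = 1 / \<alpha>"
proof -
  have lim: "((\<lambda>t. - exp (- \<alpha> * t) / \<alpha>) \<longlongrightarrow> 0) at_top"
    using assms by real_asymp
  have nn: "(\<integral>\<^sup>+t. ennreal (exp (- \<alpha> * t)) * indicator {0..} t \<partial>lborel) = ennreal (0 - - exp (- \<alpha> * 0) / \<alpha>)"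
    by (rule nn_integral_FTC_atLeast[OF _ _ _ lim]) (use assms in \<open>auto intro!: derivative_eq_intros\<close>)
  then have "(\<integral>\<^sup>+t. ennreal (indicator {0..} t *\<^sub>R exp (- \<alpha> * t)) \<partial>lborel) = ennreal (1 / \<alpha>)"
    by (auto simp: indicator_mult_ennreal mult.commute intro!: nn_integral_cong arg_cong[where f=ennreal] elim!: trans[rotated])
  then have "has_bochner_integral lborel (\<lambda>t. indicator {0..} t *\<^sub>R exp (- \<alpha> * t)) (1 / \<alpha>)"
    by (intro has_bochner_integral_nn_integral) (use assms in auto)
  then show "set_integrable lborel {0..} (\<lambda>t. exp (- \<alpha> * t))" "(LINT t:{0..}|lborel. exp (- \<alpha> * t)) = 1 / \<alpha>"
    by (auto simp: set_integrable_def set_lebesgue_integral_def has_bochner_integral_iff)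
qed

locale controlled_chain =
  fixes U :: "'s::finite \<Rightarrow> 'u::metric_space set"
    and lam :: "'s \<Rightarrow> 's \<Rightarrow> 'u \<Rightarrow> real"
    and c :: "'s \<Rightarrow> 'u \<Rightarrow> real"
    and \<alpha> M C :: real
    and P :: "(real \<Rightarrow> 's \<Rightarrow> 'u) \<Rightarrow> 's \<Rightarrow> (real \<Rightarrow> 's) measure"
  assumes compact_U: "\<And>i. compact (U i)" and U_nonempty: "\<And>i. U i \<noteq> {}"
    and lam_nonneg: "\<And>i j a. j \<noteq> i \<Longrightarrow> a \<in> U i \<Longrightarrow> 0 \<le> lam i j a"
    and lam_continuous: "\<And>i j. j \<noteq> i \<Longrightarrow> continuous_on (U i) (lam i j)"
    and rate_bound: "\<And>i a. a \<in> U i \<Longrightarrow> - rate lam i i a \<le> M"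
    and c_nonneg: "\<And>i a. a \<in> U i \<Longrightarrow> 0 \<le> c i a"
    and c_le: "\<And>i a. a \<in> U i \<Longrightarrow> c i a \<le> C"
    and c_continuous: "\<And>i. continuous_on (U i) (c i)"
    and \<alpha>: "0 < \<alpha>"
    and law: "\<And>u i. u \<in> markov_controls U \<Longrightarrow> solves_martingale_problem lam u i (P u i)"
begin

lemma rate_sum: "(\<Sum>j\<in>UNIV. rate lam i j a) = 0"
proof -
  have "(\<Sum>j\<in>UNIV. rate lam i j a) = rate lam i i a + (\<Sum>j\<in>UNIV - {i}. rate lam i j a)"
    by (rule sum.remove) auto
  also have "(\<Sum>j\<in>UNIV - {i}. rate lam i j a) = (\<Sum>j\<in>UNIV - {i}. lam i j a)"
    by (rule sum.cong) (auto simp: rate_def)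
  finally show ?thesis by (simp add: rate_def)
qed

lemma rate_nonneg: "a \<in> U i \<Longrightarrow> j \<noteq> i \<Longrightarrow> 0 \<le> rate lam i j a"
  by (simp add: rate_def lam_nonneg)

text \<open>Off-diagonal rates are nonnegative and sum to minus the diagonal one, so the bound on
  the exit rate controls every entry.\<close>

lemma rate_abs_le:
  assumes "a \<in> U i"
  shows "\<bar>rate lam i j a\<bar> \<le> M"
proof (cases "j = i")
  case True
  have "0 \<le> (\<Sum>k\<in>UNIV - {i}. lam i k a)"
    using assms by (intro sum_nonneg lam_nonneg) auto
  with True rate_bound[OF assms] show ?thesis
    by (simp add: rate_def)
next
  case False
  have "lam i j a \<le> (\<Sum>k\<in>UNIV - {i}. lam i k a)"
    using False assms by (intro member_le_sum lam_nonneg) auto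
  then have "lam i j a \<le> M"
    using rate_bound[OF assms] by (simp add: rate_def)
  with False lam_nonneg[OF False assms] show ?thesis
    by (simp add: rate_def)
qed

lemma M_nonneg: "0 \<le> M"
  using rate_abs_le U_nonempty by (metis abs_ge_zero equals0I order_trans)

lemma C_nonneg: "0 \<le> C"
  using c_nonneg c_le U_nonempty by (metis equals0I order_trans)

lemma rate_continuous: "continuous_on (U i) (rate lam i j)"
proof (cases "j = i")
  case True
  have "continuous_on (U i) (\<lambda>a. - (\<Sum>k\<in>UNIV - {i}. lam i k a))"
    by (intro continuous_on_minus continuous_on_sum lam_continuous) auto
  with True show ?thesis by (simp add: rate_def)
next
  case False
  then show ?thesis
    using lam_continuous[OF False] by (simp add: rate_def)
qed

lemma control_in: "u \<in> markov_controls U \<Longrightarrow> 0 \<le> t \<Longrightarrow> u t i \<in> U i"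
  by (simp add: markov_controls_def)

text \<open>Continuity of \<open>g i\<close> is available on \<open>U i\<close> only, so the control
  is first viewed as a measurable map into the Borel space restricted to \<open>U i\<close>.\<close>

lemma bounded_rate_control:
  assumes u: "u \<in> markov_controls U"
    and g: "\<And>i. continuous_on (U i) (g i)" "\<And>i a. a \<in> U i \<Longrightarrow> \<bar>g i a\<bar> \<le> B"
  shows "bounded_rate (\<lambda>r i. g i (u r i)) B"
  unfolding bounded_rate_def
proof (intro conjI allI impI)
  fix i
  have "(\<lambda>t. u t i) \<in> restrict_space borel {0..} \<rightarrow>\<^sub>M restrict_space borel (U i)"
    using u by (intro measurable_restrict_space2) (auto simp: markov_controls_def space_restrict_space)
  from measurable_compose[OF this borel_measurable_continuous_on_restrict[OF g(1)]]
  show "(\<lambda>r. indicator {0..} r * g i (u r i)) \<in> borel_measurable borel"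
    by (subst (asm) borel_measurable_restrict_space_iff) auto
qed (use g(2) control_in[OF u] in auto)

lemma jump_law_control:
  assumes u: "u \<in> markov_controls U"
  shows "jump_law (P u i) (\<lambda>r j k. rate lam j k (u r j)) i M"
  using law[OF u, of i] bounded_rate_control[OF u rate_continuous rate_abs_le]
  by (simp add: jump_law_def solves_martingale_problem_def running_def generator_def)

text \<open>The action is evaluated at the current state rather than the left limit, which turns the
  cost into a functional of the form \<open>running\<close>. The two differ only at jumps.\<close>

definition run_cost :: "(real \<Rightarrow> 's \<Rightarrow> 'u) \<Rightarrow> real \<Rightarrow> 's \<Rightarrow> real" where
  "run_cost u r j = exp (- \<alpha> * r) * c j (u r j)"

lemma bounded_rate_run_cost:
  assumes u: "u \<in> markov_controls U"
  shows "bounded_rate (run_cost u) C"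
  unfolding bounded_rate_def
proof (intro conjI allI impI)
  have b: "bounded_rate (\<lambda>r j. c j (u r j)) C"
    by (rule bounded_rate_control[OF u c_continuous]) (auto simp: c_nonneg c_le)
  fix j
  have "(\<lambda>r. exp (- \<alpha> * r) * (indicator {0..} r * c j (u r j))) \<in> borel_measurable borel"
    by (rule borel_measurable_times[OF _ bounded_rateD(1)[OF b]]) measurable
  then show "(\<lambda>r. indicator {0..} r * run_cost u r j) \<in> borel_measurable borel"
    by (simp add: run_cost_def mult_ac)
  fix r :: real assume r: "0 \<le> r"
  have "\<bar>exp (- \<alpha> * r) * c j (u r j)\<bar> \<le> 1 * C"
    unfolding abs_mult using bounded_rateD(2)[OF b r] r \<alpha> by (intro mult_mono) auto
  then show "\<bar>run_cost u r j\<bar> \<le> C"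
    by (simp add: run_cost_def)
qed

lemma discounted_cost_props:
  assumes u: "u \<in> markov_controls U" and x: "x \<in> cadlag_paths"
  shows discounted_cost_nonneg: "0 \<le> discounted_cost c \<alpha> u x"
    and discounted_cost_le: "discounted_cost c \<alpha> u x \<le> C / \<alpha>"
    and running_tendsto: "(\<lambda>n. running (run_cost u) 0 (real n) x) \<longlonglongrightarrow> discounted_cost c \<alpha> u x"
    and running_le: "0 \<le> t \<Longrightarrow> running (run_cost u) 0 t x \<le> C / \<alpha>"
proof -
  let ?h = "\<lambda>r. run_cost u r (x r)"
  have h: "0 \<le> ?h r" "?h r \<le> C * exp (- \<alpha> * r)" if "0 \<le> r" for r
    using c_nonneg[OF control_in[OF u that]] c_le[OF control_in[OF u that]]
    by (auto simp: run_cost_def mult.commute)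
  \<comment> \<open>The two integrands agree outside the countable set of jump times; the point 0 is
    added because jumps are indexed by positive times.\<close>
  have eq: "discounted_cost c \<alpha> u x = (LINT r:{0..}|lborel. ?h r)"
    unfolding discounted_cost_def set_lebesgue_integral_def
    by (rule integral_discrete_difference[where X="insert 0 {t. 0 < t \<and> left_lim x t \<noteq> x t}"])
       (use countable_jumps[OF x] in \<open>auto simp: run_cost_def indicator_def order_le_less\<close>)
  \<comment> \<open>Joint measurability is available on bounded time intervals, so the half-line is
    exhausted by [0, n].\<close>
  have meas: "(\<lambda>r. indicator {0..} r *\<^sub>R ?h r) \<in> borel_measurable lborel"
  proof (rule borel_measurable_LIMSEQ_real)
    show "(\<lambda>r. indicator {0..real n} r * ?h r) \<in> borel_measurable lborel" for n
      using measurable_path_section[OF bounded_rate_run_cost[OF u] x] by simp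
    fix r :: real
    have "\<forall>\<^sub>F n in sequentially. indicator {0..real n} r * ?h r = indicator {0..} r *\<^sub>R ?h r"
      using eventually_ge_at_top[of "nat \<lceil>r\<rceil>"]
      by eventually_elim (auto simp: indicator_def)
    then show "(\<lambda>n. indicator {0..real n} r * ?h r) \<longlonglongrightarrow> indicator {0..} r *\<^sub>R ?h r"
      by (rule tendsto_eventually)
  qed
  have int_e: "set_integrable lborel {0..} (\<lambda>r. C * exp (- \<alpha> * r))"
    using set_integrable_exp_minus(1)[OF \<alpha>] by (rule set_integrable_mult_right)
  have int: "set_integrable lborel {0..} ?h"
    unfolding set_integrable_def
    by (rule Bochner_Integration.integrable_bound[OF int_e[unfolded set_integrable_def] meas])
       (use h in \<open>auto simp: indicator_def intro: order_trans[OF _ abs_ge_self]\<close>)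
  show "0 \<le> discounted_cost c \<alpha> u x"
    unfolding eq set_lebesgue_integral_def
    by (rule Bochner_Integration.integral_nonneg) (use h in \<open>auto simp: indicator_def\<close>)
  have "(LINT r:{0..}|lborel. C * exp (- \<alpha> * r)) = C / \<alpha>"
    using set_integrable_exp_minus(2)[OF \<alpha>] by simp
  moreover have "discounted_cost c \<alpha> u x \<le> (LINT r:{0..}|lborel. C * exp (- \<alpha> * r))"
    unfolding eq by (rule set_integral_mono[OF int int_e]) (use h in auto)
  ultimately show le: "discounted_cost c \<alpha> u x \<le> C / \<alpha>"
    by simp
  have "((\<lambda>t. running (run_cost u) 0 t x) \<longlongrightarrow> discounted_cost c \<alpha> u x) at_top"
    unfolding eq running_def by (rule tendsto_set_lebesgue_integral_at_top[OF _ int]) auto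
  then show "(\<lambda>n. running (run_cost u) 0 (real n) x) \<longlonglongrightarrow> discounted_cost c \<alpha> u x"
    by (rule filterlim_compose[OF _ filterlim_real_sequentially])
  assume t: "0 \<le> t"
  have "running (run_cost u) 0 t x \<le> discounted_cost c \<alpha> u x"
    unfolding eq running_def set_lebesgue_integral_def
    by (rule integral_mono) (use int set_integrable_subset[OF int, of "{0..t}"] h in \<open>auto simp: set_integrable_def indicator_def\<close>)
  with le show "running (run_cost u) 0 t x \<le> C / \<alpha>" by simp
qed

lemma running_nonneg:
  assumes u: "u \<in> markov_controls U"
  shows "0 \<le> running (run_cost u) 0 t x"
  unfolding running_def set_lebesgue_integral_def
  by (rule Bochner_Integration.integral_nonneg)
     (use c_nonneg control_in[OF u] in \<open>auto simp: run_cost_def indicator_def\<close>)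

lemma measurable_discounted_cost:
  assumes u: "u \<in> markov_controls U"
  shows "discounted_cost c \<alpha> u \<in> borel_measurable (P u i)"
proof -
  interpret jump_law "P u i" "\<lambda>r j k. rate lam j k (u r j)" i M
    by (rule jump_law_control[OF u])
  show ?thesis
    by (rule borel_measurable_LIMSEQ_real[OF running_tendsto[OF u]
          measurable_from_subalg[OF subalg measurable_running[OF bounded_rate_run_cost[OF u]]]])
       (auto simp: space_P)
qed

end

subsection \<open>Verification\<close>

lemma running_cmult: "running (\<lambda>r j. k * h r j) s t x = k * running h s t x"
  by (simp add: running_def)

text \<open>The bound \<open>B0\<close> fixes the boundary value: it forces
  \<open>exp (\<theta> * v \<theta> i)\<close> to tend to 1 as \<theta> tends to 0, which after the
  time change is a condition at infinity.\<close>

locale hjb_candidate = controlled_chain U lam c \<alpha> M C P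
  for U :: "'s::finite \<Rightarrow> 'u::metric_space set" and lam c \<alpha> M C P +
  fixes v :: "real \<Rightarrow> 's \<Rightarrow> real" and B0 :: real
  assumes v_bound: "\<And>\<theta> i. 0 < \<theta> \<Longrightarrow> \<theta> < 1 \<Longrightarrow> \<bar>v \<theta> i\<bar> \<le> B0"
    and v_C1: "\<And>i. (\<lambda>\<theta>. v \<theta> i) C1_differentiable_on {0<..<1}"
    and v_hjb: "\<And>\<theta> i. 0 < \<theta> \<Longrightarrow> \<theta> < 1 \<Longrightarrow>
      \<alpha> * \<theta> * (v \<theta> i + \<theta> * deriv (\<lambda>\<eta>. v \<eta> i) \<theta>) * exp (\<theta> * v \<theta> i)
        = (INF a\<in>U i. hamiltonian lam c v \<theta> i a)"
begin

definition minham :: "real \<Rightarrow> 's \<Rightarrow> real" where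
  "minham \<eta> i = (INF a\<in>U i. hamiltonian lam c v \<eta> i a)"

text \<open>Doubles as the Lipschitz constant of the time-changed solution, whose time derivative is
  minus \<open>minham\<close>.\<close>

definition ham_bound :: real where
  "ham_bound = (C + real CARD('s) * M) * exp B0"

lemma exp_v_le:
  assumes "0 < \<eta>" "\<eta> < 1"
  shows "exp (\<eta> * v \<eta> i) \<le> exp B0"
proof -
  have "\<bar>\<eta> * v \<eta> i\<bar> \<le> 1 * B0"
    unfolding abs_mult using assms v_bound[OF assms] by (intro mult_mono) auto
  then show ?thesis by simp
qed

lemma hamiltonian_abs_le:
  assumes \<eta>: "0 < \<eta>" "\<eta> < 1" and a: "a \<in> U i"
  shows "\<bar>hamiltonian lam c v \<eta> i a\<bar> \<le> ham_bound"
proof -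
  have "\<bar>\<eta> * c i a * exp (\<eta> * v \<eta> i)\<bar> \<le> (1 * C) * exp B0"
    unfolding abs_mult using \<eta> c_nonneg[OF a] c_le[OF a] C_nonneg exp_v_le[OF \<eta>, of i] by (intro mult_mono) auto
  moreover have "\<bar>\<Sum>j\<in>UNIV. rate lam i j a * exp (\<eta> * v \<eta> j)\<bar> \<le> (\<Sum>j\<in>(UNIV::'s set). M * exp B0)"
    by (rule order_trans[OF sum_abs], rule sum_mono)
       (use rate_abs_le[OF a] exp_v_le[OF \<eta>] M_nonneg in \<open>auto simp: abs_mult intro!: mult_mono\<close>)
  ultimately show ?thesis
    by (simp add: hamiltonian_def ham_bound_def algebra_simps)
qed

lemma hamiltonian_bdd_below:
  assumes "0 < \<eta>" "\<eta> < 1"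
  shows "bdd_below (hamiltonian lam c v \<eta> i ` U i)"
  by (rule bdd_belowI2[of _ "- ham_bound"]) (use hamiltonian_abs_le[OF assms] in \<open>force simp: abs_le_iff\<close>)

lemma minham_le:
  assumes "0 < \<eta>" "\<eta> < 1" "a \<in> U i"
  shows "minham \<eta> i \<le> hamiltonian lam c v \<eta> i a"
  unfolding minham_def by (rule cINF_lower[OF hamiltonian_bdd_below]) (use assms in auto)

lemma minham_abs_le:
  assumes \<eta>: "0 < \<eta>" "\<eta> < 1"
  shows "\<bar>minham \<eta> i\<bar> \<le> ham_bound"
proof -
  obtain a where a: "a \<in> U i" using U_nonempty by blast
  have "- ham_bound \<le> minham \<eta> i"
    unfolding minham_def by (rule cINF_greatest[OF U_nonempty]) (use hamiltonian_abs_le[OF \<eta>] in \<open>force simp: abs_le_iff\<close>)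
  moreover have "minham \<eta> i \<le> ham_bound"
    using minham_le[OF \<eta> a] hamiltonian_abs_le[OF \<eta> a] by linarith
  ultimately show ?thesis by simp
qed

lemma v_deriv:
  assumes "0 < \<eta>" "\<eta> < 1"
  shows "((\<lambda>\<eta>. v \<eta> i) has_real_derivative deriv (\<lambda>\<eta>. v \<eta> i) \<eta>) (at \<eta>)"
  using v_C1[of i] assms by (auto simp: C1_differentiable_on_real_iff)

lemma v_continuous: "continuous_on {0<..<1} (\<lambda>\<eta>. v \<eta> i)"
  by (intro continuous_at_imp_continuous_on ballI DERIV_isCont) (auto intro: v_deriv)

text \<open>Read off from the left-hand side of the HJB equation, which is continuous because
  \<open>v\<close> is continuously differentiable.\<close>

lemma minham_continuous: "continuous_on {0<..<1} (\<lambda>\<eta>. minham \<eta> i)"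
proof -
  have "continuous_on {0<..<1} (\<lambda>\<theta>. \<alpha> * \<theta> * (v \<theta> i + \<theta> * deriv (\<lambda>\<eta>. v \<eta> i) \<theta>) * exp (\<theta> * v \<theta> i))"
    using v_C1[of i] by (intro continuous_intros v_continuous) (simp add: C1_differentiable_on_real_iff)
  then show ?thesis
    by (rule continuous_on_cong[THEN iffD1, rotated 2]) (auto simp: minham_def v_hjb)
qed

lemma exp_v_deriv:
  assumes \<eta>: "0 < \<eta>" "\<eta> < 1"
  shows "((\<lambda>\<eta>. exp (\<eta> * v \<eta> i)) has_real_derivative minham \<eta> i / (\<alpha> * \<eta>)) (at \<eta>)"
proof -
  have "((\<lambda>\<eta>. exp (\<eta> * v \<eta> i)) has_real_derivative (v \<eta> i + \<eta> * deriv (\<lambda>\<eta>. v \<eta> i) \<eta>) * exp (\<eta> * v \<eta> i)) (at \<eta>)"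
    by (rule derivative_eq_intros refl v_deriv[OF \<eta>])+ (simp add: algebra_simps)
  moreover have "(v \<eta> i + \<eta> * deriv (\<lambda>\<eta>. v \<eta> i) \<eta>) * exp (\<eta> * v \<eta> i) = minham \<eta> i / (\<alpha> * \<eta>)"
    unfolding minham_def v_hjb[OF \<eta>, symmetric] using \<eta> \<alpha> by simp
  ultimately show ?thesis by simp
qed

end

text \<open>The time change \<open>t \<mapsto> \<theta> exp (- \<alpha> t)\<close> turns the HJB equation into a parabolic one, solved by \<open>\<phi>\<close>.\<close>

locale hjb_time_change = hjb_candidate U lam c \<alpha> M C P v B0
  for U :: "'s::finite \<Rightarrow> 'u::metric_space set" and lam c \<alpha> M C P v B0 +
  fixes \<theta> :: real
  assumes \<theta>: "0 < \<theta>" "\<theta> < 1"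
begin

abbreviation "\<eta> t \<equiv> \<theta> * exp (- \<alpha> * t)"

definition \<phi> :: "real \<Rightarrow> 's \<Rightarrow> real" where
  "\<phi> t i = exp (\<eta> t * v (\<eta> t) i)"

lemma \<eta>_in: "0 \<le> t \<Longrightarrow> 0 < \<eta> t" "0 \<le> t \<Longrightarrow> \<eta> t < 1"
proof -
  assume "0 \<le> t"
  then have "\<theta> * exp (- \<alpha> * t) \<le> \<theta> * 1"
    using \<theta> \<alpha> by (intro mult_left_mono) auto
  with \<theta>(2) show "\<eta> t < 1" by linarith
  show "0 < \<eta> t" using \<theta> by simp
qed

text \<open>The chain-rule factor \<open>- \<alpha> * \<eta> t\<close> cancels the singular
  \<open>1 / (\<alpha> * \<eta>)\<close> in \<open>exp_v_deriv\<close>; this is what the exponential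
  time change is for.\<close>

lemma \<phi>_deriv:
  assumes t: "0 \<le> t"
  shows "((\<lambda>t. \<phi> t i) has_real_derivative - minham (\<eta> t) i) (at t)"
proof -
  have "(\<eta> has_real_derivative - \<alpha> * \<eta> t) (at t)"
    by (auto intro!: derivative_eq_intros)
  from DERIV_chain2[OF exp_v_deriv[OF \<eta>_in[OF t]] this]
  show ?thesis
    using \<theta> \<alpha> by (simp add: \<phi>_def)
qed

lemma minham_\<eta>_continuous:
  assumes "0 \<le> s"
  shows "continuous_on {s..t} (\<lambda>r. minham (\<eta> r) i)"
  by (rule continuous_on_compose2[OF minham_continuous]) (use \<eta>_in assms in \<open>auto intro!: continuous_intros\<close>)

lemma \<phi>_diff:
  assumes s: "0 \<le> s" "s \<le> t"
  shows "\<phi> s i - \<phi> t i = (LINT r:{s..t}|lborel. minham (\<eta> r) i)"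
proof -
  have "(LINT r|lborel. indicator {s..t} r *\<^sub>R minham (\<eta> r) i) = (- \<phi> t i) - (- \<phi> s i)"
  proof (rule integral_FTC_atLeastAtMost[OF s(2) _ minham_\<eta>_continuous[OF s(1)]])
    fix r assume "s \<le> r" "r \<le> t"
    then have "((\<lambda>t. - \<phi> t i) has_real_derivative minham (\<eta> r) i) (at r)"
      using \<phi>_deriv[of r i] s by (auto intro!: derivative_eq_intros)
    then show "((\<lambda>t. - \<phi> t i) has_vector_derivative minham (\<eta> r) i) (at r within {s..t})"
      by (simp add: has_real_derivative_iff_has_vector_derivative has_vector_derivative_at_within)
  qed
  then show ?thesis by (simp add: set_lebesgue_integral_def)
qed

lemma minham_\<eta>_integrable:
  assumes "0 \<le> s"
  shows "set_integrable lborel {s..t} (\<lambda>r. minham (\<eta> r) i)"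
  by (rule borel_integrable_atLeastAtMost'[OF minham_\<eta>_continuous[OF assms]])

lemma \<phi>_lipschitz:
  assumes s: "0 \<le> s" "s \<le> t"
  shows "\<bar>\<phi> t i - \<phi> s i\<bar> \<le> ham_bound * (t - s)"
proof -
  have "\<bar>\<phi> s i - \<phi> t i\<bar> \<le> ham_bound * (t - s)"
    unfolding \<phi>_diff[OF s]
    by (rule set_integral_Icc_abs_le[OF minham_\<eta>_integrable[OF s(1)] minham_abs_le s(2)])
       (use \<eta>_in s in auto)
  then show ?thesis by (simp add: abs_minus_commute)
qed

lemma bounded_rate_\<phi>: "bounded_rate \<phi> (exp B0)"
  unfolding bounded_rate_def
proof (intro conjI allI impI)
  fix i
  have "continuous_on {0..} (\<lambda>t. \<phi> t i)"
    by (intro continuous_at_imp_continuous_on ballI DERIV_isCont[OF \<phi>_deriv]) auto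
  from borel_measurable_continuous_on_indicator[OF _ this]
  show "(\<lambda>r. indicator {0..} r * \<phi> r i) \<in> borel_measurable borel"
    by simp
  show "\<bar>\<phi> t i\<bar> \<le> exp B0" if "0 \<le> t" for t
    using exp_v_le[OF \<eta>_in[OF that]] by (simp add: \<phi>_def)
qed

text \<open>\<open>y\<close> is arbitrary because it will be the path at integer times;
  \<open>B0\<close> bounds \<open>v\<close> uniformly in the state.\<close>

lemma \<phi>_tendsto: "(\<lambda>n. \<phi> (real n) (y n)) \<longlonglongrightarrow> 1"
proof -
  have "(\<lambda>n. \<eta> (real n) * v (\<eta> (real n)) (y n)) \<longlonglongrightarrow> 0"
  proof (rule Lim_null_comparison)
    show "\<forall>\<^sub>F n in sequentially. norm (\<eta> (real n) * v (\<eta> (real n)) (y n)) \<le> \<theta> * exp (- \<alpha> * real n) * B0"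
      using v_bound[OF \<eta>_in] \<theta> by (auto simp: abs_mult intro!: always_eventually mult_left_mono)
    have "(\<lambda>n. exp (- \<alpha> * real n)) \<longlonglongrightarrow> 0"
      using \<alpha> by real_asymp
    then show "(\<lambda>n. \<theta> * exp (- \<alpha> * real n) * B0) \<longlonglongrightarrow> 0"
      by (intro tendsto_mult_left_zero tendsto_mult_right_zero)
  qed
  from tendsto_exp[OF this] show ?thesis
    by (simp add: \<phi>_def)
qed

context
  fixes u :: "real \<Rightarrow> 's \<Rightarrow> 'u" and i :: 's
  assumes u: "u \<in> markov_controls U"
begin

interpretation jump_law "P u i" "\<lambda>r j k. rate lam j k (u r j)" i M
  by (rule jump_law_control[OF u])

interpretation prob_space "P u i" by (rule prob)

definition pot where "pot = (\<lambda>r j. \<theta> * run_cost u r j)"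

lemma bounded_rate_pot: "bounded_rate pot C"
  unfolding bounded_rate_def
proof (intro conjI allI impI)
  fix j
  have "(\<lambda>r. \<theta> * (indicator {0..} r * run_cost u r j)) \<in> borel_measurable borel"
    by (rule borel_measurable_times[OF borel_measurable_const bounded_rateD(1)[OF bounded_rate_run_cost[OF u]]])
  then show "(\<lambda>r. indicator {0..} r * pot r j) \<in> borel_measurable borel"
    by (simp add: pot_def mult_ac)
  fix r :: real assume "0 \<le> r"
  then have "\<bar>\<theta> * run_cost u r j\<bar> \<le> 1 * C"
    unfolding abs_mult using bounded_rateD(2)[OF bounded_rate_run_cost[OF u]] \<theta> by (intro mult_mono) auto
  then show "\<bar>pot r j\<bar> \<le> C" by (simp add: pot_def)
qed

definition "B1 = max C (exp B0)"

text \<open>The factor \<open>\<theta> * exp (- \<alpha> * r)\<close> is at once the weight of the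
  cost and the new argument of \<open>v\<close>, so the HJB equation at varying \<theta> describes
  the discounted problem.\<close>

lemma hamiltonian_eq: "gen (\<phi> r) r j + pot r j * \<phi> r j = hamiltonian lam c v (\<eta> r) j (u r j)"
  by (simp add: hamiltonian_def \<phi>_def pot_def run_cost_def mult_ac)

lemma rates_B1: "bounded_rate pot B1" "bounded_rate \<phi> B1"
  using bounded_rate_mono[OF bounded_rate_pot] bounded_rate_mono[OF bounded_rate_\<phi>] by (auto simp: B1_def)

lemma hamiltonian_integrable:
  "0 \<le> s \<Longrightarrow> set_integrable lborel {s..t} (\<lambda>r. hamiltonian lam c v (\<eta> r) j (u r j))"
  using set_integrable_rate[OF bounded_rate_gen_add[OF rates_B1]] by (simp add: hamiltonian_eq)

text \<open>Minus the time derivative of \<open>\<phi>\<close> is the minimum of the Hamiltonian,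
  hence at most its value at the action chosen by \<open>u\<close>.\<close>

lemma subsolution_\<phi>: "subsolution (P u i) (\<lambda>r j k. rate lam j k (u r j)) i M pot \<phi> B1 ham_bound"
proof (intro subsolution.intro jump_law_axioms subsolution_axioms.intro rates_B1 \<phi>_lipschitz)
  fix s t :: real and j assume s: "0 \<le> s" "s \<le> t"
  show "\<phi> s j - \<phi> t j \<le> (LINT r:{s..t}|lborel. gen (\<phi> r) r j + pot r j * \<phi> r j)"
    unfolding \<phi>_diff[OF s] hamiltonian_eq
    by (rule set_integral_mono[OF minham_\<eta>_integrable[OF s(1)] hamiltonian_integrable[OF s(1)]])
       (use s \<eta>_in control_in[OF u] in \<open>auto intro!: minham_le\<close>)
qed

text \<open>For a minimizing control the subsolution inequality is an equality, and so survives a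
  change of sign.\<close>

lemma subsolution_uminus_\<phi>:
  assumes opt: "\<And>r j. 0 \<le> r \<Longrightarrow> hamiltonian lam c v (\<eta> r) j (u r j) = minham (\<eta> r) j"
  shows "subsolution (P u i) (\<lambda>r j k. rate lam j k (u r j)) i M pot (\<lambda>t j. - \<phi> t j) B1 ham_bound"
proof (intro subsolution.intro jump_law_axioms subsolution_axioms.intro rates_B1)
  show "bounded_rate (\<lambda>t j. - \<phi> t j) B1"
    using rates_B1(2) unfolding bounded_rate_def by auto
  fix s t :: real and j assume s: "0 \<le> s" "s \<le> t"
  show "\<bar>- \<phi> t j - - \<phi> s j\<bar> \<le> ham_bound * (t - s)"
    using \<phi>_lipschitz[OF s, of j] by linarith
  have "(LINT r:{s..t}|lborel. gen (\<lambda>k. - \<phi> r k) r j + pot r j * - \<phi> r j)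
      = (LINT r:{s..t}|lborel. - minham (\<eta> r) j)"
  proof (rule set_lebesgue_integral_cong)
    show "\<forall>r. r \<in> {s..t} \<longrightarrow> gen (\<lambda>k. - \<phi> r k) r j + pot r j * - \<phi> r j = - minham (\<eta> r) j"
    proof (intro allI impI)
      fix r assume "r \<in> {s..t}"
      then have "gen (\<phi> r) r j + pot r j * \<phi> r j = minham (\<eta> r) j"
        unfolding hamiltonian_eq using s by (intro opt) auto
      then show "gen (\<lambda>k. - \<phi> r k) r j + pot r j * - \<phi> r j = - minham (\<eta> r) j"
        by (simp add: sum_negf)
    qed
  qed simp
  also have "\<dots> = - (LINT r:{s..t}|lborel. minham (\<eta> r) j)"
    by (simp add: set_lebesgue_integral_def)
  finally show "- \<phi> s j - - \<phi> t j \<le> (LINT r:{s..t}|lborel. gen (\<lambda>k. - \<phi> r k) r j + pot r j * - \<phi> r j)"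
    unfolding \<phi>_diff[OF s, symmetric] by simp
qed

text \<open>Horizon to infinity: the terminal factor tends to 1, and the total cost bound
  \<open>C / \<alpha>\<close> together with \<theta> < 1 gives a constant dominating
  function.\<close>

lemma integral_tendsto:
  "(\<lambda>n. LINT x|P u i. exp (running pot 0 (real n) x) * \<phi> (real n) (x (real n)))
    \<longlonglongrightarrow> (LINT x|P u i. exp (\<theta> * discounted_cost c \<alpha> u x))"
proof (rule integral_dominated_convergence[where w="\<lambda>_. exp (C / \<alpha>) * exp B0"])
  show "(\<lambda>x. exp (\<theta> * discounted_cost c \<alpha> u x)) \<in> borel_measurable (P u i)"
    using measurable_discounted_cost[OF u] by measurable
  show "(\<lambda>x. exp (running pot 0 (real n) x) * \<phi> (real n) (x (real n))) \<in> borel_measurable (P u i)" for n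
    using measurable_from_subalg[OF subalg measurable_running[OF bounded_rate_pot, of "real n"]]
      measurable_fun_coord[of "real n" "\<phi> (real n)"] by measurable
  show "AE x in P u i. (\<lambda>n. exp (running pot 0 (real n) x) * \<phi> (real n) (x (real n)))
      \<longlonglongrightarrow> exp (\<theta> * discounted_cost c \<alpha> u x)"
  proof (rule AE_I2)
    fix x assume "x \<in> space (P u i)"
    then have "(\<lambda>n. \<theta> * running (run_cost u) 0 (real n) x) \<longlonglongrightarrow> \<theta> * discounted_cost c \<alpha> u x"
      by (intro tendsto_mult_left running_tendsto[OF u]) (simp add: space_P)
    from tendsto_mult[OF tendsto_exp[OF this] \<phi>_tendsto[of "\<lambda>n. x (real n)"]]
    show "(\<lambda>n. exp (running pot 0 (real n) x) * \<phi> (real n) (x (real n)))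
      \<longlonglongrightarrow> exp (\<theta> * discounted_cost c \<alpha> u x)"
      by (simp add: pot_def running_cmult)
  qed
  show "AE x in P u i. norm (exp (running pot 0 (real n) x) * \<phi> (real n) (x (real n))) \<le> exp (C / \<alpha>) * exp B0" for n
  proof (rule AE_I2)
    fix x assume "x \<in> space (P u i)"
    then have "running (run_cost u) 0 (real n) x \<le> C / \<alpha>"
      by (intro running_le[OF u]) (simp_all add: space_P)
    then have "\<theta> * running (run_cost u) 0 (real n) x \<le> 1 * (C / \<alpha>)"
      using \<theta> running_nonneg[OF u] by (intro mult_mono) auto
    then have "exp (running pot 0 (real n) x) \<le> exp (C / \<alpha>)"
      by (simp add: pot_def running_cmult)
    then show "norm (exp (running pot 0 (real n) x) * \<phi> (real n) (x (real n))) \<le> exp (C / \<alpha>) * exp B0"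
      using bounded_rateD(2)[OF bounded_rate_\<phi>, of "real n"] by (auto simp: abs_mult intro!: mult_mono)
  qed
qed simp

lemma \<phi>_0: "\<phi> 0 i = exp (\<theta> * v \<theta> i)"
  by (simp add: \<phi>_def)

lemma exp_v_le_integral: "exp (\<theta> * v \<theta> i) \<le> (LINT x|P u i. exp (\<theta> * discounted_cost c \<alpha> u x))"
  unfolding \<phi>_0[symmetric]
  by (rule LIMSEQ_le_const[OF integral_tendsto]) (auto intro!: exI[of _ 0] subsolution.feynman_kac_le[OF subsolution_\<phi>])

lemma risk_cost_ge: "v \<theta> i \<le> risk_cost P c \<alpha> \<theta> i u"
proof -
  have "\<theta> * v \<theta> i \<le> ln (LINT x|P u i. exp (\<theta> * discounted_cost c \<alpha> u x))"
    using exp_v_le_integral by (subst ln_ge_iff) (auto intro: less_le_trans[OF exp_gt_zero])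
  then show ?thesis
    using \<theta> by (simp add: risk_cost_def field_simps)
qed

text \<open>Both Feynman--Kac inequalities hold here, the upper one coming from
  \<open>- \<phi>\<close>, and both pass to the infinite horizon.\<close>

lemma risk_cost_eq:
  assumes opt: "\<And>r j. 0 \<le> r \<Longrightarrow> hamiltonian lam c v (\<eta> r) j (u r j) = minham (\<eta> r) j"
  shows "risk_cost P c \<alpha> \<theta> i u = v \<theta> i"
proof -
  have "(LINT x|P u i. exp (\<theta> * discounted_cost c \<alpha> u x)) \<le> exp (\<theta> * v \<theta> i)"
    unfolding \<phi>_0[symmetric]
  proof (rule LIMSEQ_le_const2[OF integral_tendsto], intro exI[of _ 0] allI impI)
    fix n
    have "- \<phi> 0 i \<le> (LINT x|P u i. exp (running pot 0 (real n) x) * - \<phi> (real n) (x (real n)))"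
      by (rule subsolution.feynman_kac_le[OF subsolution_uminus_\<phi>[OF opt]]) auto
    then show "(LINT x|P u i. exp (running pot 0 (real n) x) * \<phi> (real n) (x (real n))) \<le> \<phi> 0 i"
      by simp
  qed
  with exp_v_le_integral have "(LINT x|P u i. exp (\<theta> * discounted_cost c \<alpha> u x)) = exp (\<theta> * v \<theta> i)"
    by simp
  then show ?thesis
    using \<theta> by (simp add: risk_cost_def)
qed

end

end

subsection \<open>Existence of a solution\<close>

context controlled_chain
begin

text \<open>The Hamiltonian in the exponential unknown: p stands for \<theta> W at the current
  state, q for W at all states. It is linear in (p, q), and the actions enter only through bounded
  coefficients.\<close>

definition hval :: "'s \<Rightarrow> real \<Rightarrow> ('s \<Rightarrow> real) \<Rightarrow> 'u \<Rightarrow> real" where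
  "hval i p q a = c i a * p + (\<Sum>j\<in>UNIV. rate lam i j a * q j)"

text \<open>A general set \<open>D\<close> is allowed because the measurable selection needs infima
  over subsets of \<open>U i\<close>.\<close>

definition hmin :: "'u set \<Rightarrow> 's \<Rightarrow> real \<Rightarrow> ('s \<Rightarrow> real) \<Rightarrow> real" where
  "hmin D i p q = (INF a\<in>D. hval i p q a)"

lemma hamiltonian_eq_hval:
  "hamiltonian lam c v \<theta> i a = hval i (\<theta> * exp (\<theta> * v \<theta> i)) (\<lambda>j. exp (\<theta> * v \<theta> j)) a"
  by (simp add: hamiltonian_def hval_def mult_ac)

lemma hval_diff_le:
  assumes "a \<in> U i"
  shows "\<bar>hval i p q a - hval i p' q' a\<bar> \<le> C * \<bar>p - p'\<bar> + (\<Sum>j\<in>UNIV. M * \<bar>q j - q' j\<bar>)"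
proof -
  have "hval i p q a - hval i p' q' a = c i a * (p - p') + (\<Sum>j\<in>UNIV. rate lam i j a * (q j - q' j))"
    by (simp add: hval_def algebra_simps sum_subtractf)
  also have "\<bar>\<dots>\<bar> \<le> \<bar>c i a * (p - p')\<bar> + (\<Sum>j\<in>UNIV. \<bar>rate lam i j a * (q j - q' j)\<bar>)"
    by (intro order_trans[OF abs_triangle_ineq] add_left_mono sum_abs)
  also have "\<dots> \<le> C * \<bar>p - p'\<bar> + (\<Sum>j\<in>UNIV. M * \<bar>q j - q' j\<bar>)"
    unfolding abs_mult
    by (intro add_mono sum_mono mult_right_mono) (use assms c_nonneg c_le rate_abs_le in auto)
  finally show ?thesis .
qed

lemma hval_abs_le:
  assumes "a \<in> U i"
  shows "\<bar>hval i p q a\<bar> \<le> C * \<bar>p\<bar> + (\<Sum>j\<in>UNIV. M * \<bar>q j\<bar>)"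
  using hval_diff_le[OF assms, of p q 0 "\<lambda>_. 0"] by (simp add: hval_def)

lemma hval_bdd_below:
  assumes "D \<subseteq> U i"
  shows "bdd_below (hval i p q ` D)"
proof (rule bdd_belowI2)
  fix a assume "a \<in> D"
  with assms show "- (C * \<bar>p\<bar> + (\<Sum>j\<in>UNIV. M * \<bar>q j\<bar>)) \<le> hval i p q a"
    using hval_abs_le[of a i p q] by auto
qed

lemma hmin_le: "D \<subseteq> U i \<Longrightarrow> a \<in> D \<Longrightarrow> hmin D i p q \<le> hval i p q a"
  unfolding hmin_def by (rule cINF_lower[OF hval_bdd_below])

text \<open>An infimum of functions sharing a Lipschitz modulus inherits it, and the modulus in
  \<open>hval_diff_le\<close> is the same for all actions.\<close>

lemma hmin_diff_le:
  assumes D: "D \<subseteq> U i" "D \<noteq> {}"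
  shows "\<bar>hmin D i p q - hmin D i p' q'\<bar> \<le> C * \<bar>p - p'\<bar> + (\<Sum>j\<in>UNIV. M * \<bar>q j - q' j\<bar>)"
proof -
  have *: "hmin D i p q - (C * \<bar>p - p'\<bar> + (\<Sum>j\<in>UNIV. M * \<bar>q j - q' j\<bar>)) \<le> hmin D i p' q'" for p q p' q'
    unfolding hmin_def[of _ _ p']
  proof (rule cINF_greatest[OF D(2)])
    fix a assume a: "a \<in> D"
    then have "a \<in> U i" using D by auto
    from hval_diff_le[OF this, of p q p' q'] hmin_le[OF D(1) a, of p q]
    show "hmin D i p q - (C * \<bar>p - p'\<bar> + (\<Sum>j\<in>UNIV. M * \<bar>q j - q' j\<bar>)) \<le> hval i p' q' a"
      by linarith
  qed
  show ?thesis
    using *[of p q p' q'] *[of p' q' p q] by (simp add: abs_minus_commute abs_le_iff)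
qed

lemma tendsto_hmin:
  assumes D: "D \<subseteq> U i" "D \<noteq> {}" and p: "(p \<longlongrightarrow> p0) F" and q: "\<And>j. ((\<lambda>x. q x j) \<longlongrightarrow> q0 j) F"
  shows "((\<lambda>x. hmin D i (p x) (q x)) \<longlongrightarrow> hmin D i p0 q0) F"
proof (rule LIM_zero_cancel, rule Lim_null_comparison)
  show "\<forall>\<^sub>F x in F. norm (hmin D i (p x) (q x) - hmin D i p0 q0)
      \<le> C * \<bar>p x - p0\<bar> + (\<Sum>j\<in>UNIV. M * \<bar>q x j - q0 j\<bar>)"
    using hmin_diff_le[OF D] by (auto intro: always_eventually)
  have "((\<lambda>x. C * \<bar>p x - p0\<bar> + (\<Sum>j\<in>UNIV. M * \<bar>q x j - q0 j\<bar>)) \<longlongrightarrow> C * \<bar>p0 - p0\<bar> + (\<Sum>j\<in>UNIV. M * \<bar>q0 j - q0 j\<bar>)) F"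
    by (intro tendsto_intros p q)
  then show "((\<lambda>x. C * \<bar>p x - p0\<bar> + (\<Sum>j\<in>UNIV. M * \<bar>q x j - q0 j\<bar>)) \<longlongrightarrow> 0) F"
    by simp
qed

lemma continuous_on_hmin:
  assumes "D \<subseteq> U i" "D \<noteq> {}" "continuous_on S p" "\<And>j. continuous_on S (\<lambda>x. q x j)"
  shows "continuous_on S (\<lambda>x. hmin D i (p x) (q x))"
  using assms unfolding continuous_on_def by (auto intro!: tendsto_hmin)

text \<open>Adding \<open>\<alpha> n\<close> on the diagonal makes the right-hand side of the HJB equation monotone.\<close>

definition order_n :: nat where
  "order_n = Suc (Suc (nat \<lceil>M / \<alpha>\<rceil>))"

text \<open>The second bound offsets the most negative diagonal rate; the first leaves a positive
  power of \<eta> in the integrand.\<close>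

lemma order_n: "2 \<le> order_n" "M \<le> \<alpha> * real order_n"
proof -
  have "M / \<alpha> \<le> real order_n"
    unfolding order_n_def by linarith
  then show "M \<le> \<alpha> * real order_n"
    using \<alpha> by (simp add: field_simps)
qed (simp add: order_n_def)

lemma zero_power_order_n [simp]: "0 ^ order_n = (0::real)" "0 ^ (order_n - Suc 0) = (0::real)"
  using order_n(1) by (simp_all add: power_0_left)

definition hshift :: "real \<Rightarrow> ('s \<Rightarrow> real) \<Rightarrow> 's \<Rightarrow> real" where
  "hshift \<eta> q i = hmin (U i) i (\<eta> * q i) q + \<alpha> * real order_n * q i"

text \<open>Cost and off-diagonal rates are nonnegative, hence their terms are monotone in q; the
  diagonal rate is at least -M, and the shift compensates it.\<close>

lemma hval_shift_mono:
  assumes \<eta>: "0 \<le> \<eta>" and a: "a \<in> U i" and q: "\<And>j. q j \<le> q' j"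
  shows "hval i (\<eta> * q i) q a + \<alpha> * real order_n * q i \<le> hval i (\<eta> * q' i) q' a + \<alpha> * real order_n * q' i"
proof -
  have "rate lam i i a * (q' i - q i) \<le> (\<Sum>j\<in>UNIV. rate lam i j a * (q' j - q j))"
  proof -
    have "(\<Sum>j\<in>UNIV. rate lam i j a * (q' j - q j))
        = rate lam i i a * (q' i - q i) + (\<Sum>j\<in>UNIV - {i}. rate lam i j a * (q' j - q j))"
      by (rule sum.remove) auto
    moreover have "0 \<le> (\<Sum>j\<in>UNIV - {i}. rate lam i j a * (q' j - q j))"
      using rate_nonneg[OF a] q by (intro sum_nonneg mult_nonneg_nonneg) auto
    ultimately show ?thesis by simp
  qed
  moreover have "- (\<alpha> * real order_n) * (q' i - q i) \<le> rate lam i i a * (q' i - q i)"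
    using rate_bound[OF a] order_n(2) q[of i] by (intro mult_right_mono) auto
  moreover have "0 \<le> c i a * (\<eta> * (q' i - q i))"
    using \<eta> c_nonneg[OF a] q by auto
  ultimately show ?thesis
    by (simp add: hval_def algebra_simps sum_subtractf)
qed

lemma hshift_mono:
  assumes "0 \<le> \<eta>" "\<And>j. q j \<le> q' j"
  shows "hshift \<eta> q i \<le> hshift \<eta> q' i"
proof -
  have "hmin (U i) i (\<eta> * q i) q + \<alpha> * real order_n * q i - \<alpha> * real order_n * q' i \<le> hmin (U i) i (\<eta> * q' i) q'"
    unfolding hmin_def[of _ _ "\<eta> * q' i"]
  proof (rule cINF_greatest[OF U_nonempty])
    fix a assume a: "a \<in> U i"
    show "hmin (U i) i (\<eta> * q i) q + \<alpha> * real order_n * q i - \<alpha> * real order_n * q' i \<le> hval i (\<eta> * q' i) q' a"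
      using hval_shift_mono[OF assms(1) a, of q q', OF assms(2)] hmin_le[OF order_refl a, of "\<eta> * q i" q] by linarith
  qed
  then show ?thesis by (simp add: hshift_def)
qed

text \<open>For a constant function the rate terms cancel, as rows sum to zero, leaving a
  nonnegative cost: the constant 1 is a lower barrier.\<close>

lemma hshift_one_ge:
  assumes "0 \<le> \<eta>"
  shows "\<alpha> * real order_n \<le> hshift \<eta> (\<lambda>_. 1) i"
proof -
  have "0 \<le> hmin (U i) i \<eta> (\<lambda>_. 1)"
    unfolding hmin_def
    by (rule cINF_greatest[OF U_nonempty]) (use assms c_nonneg in \<open>simp add: hval_def rate_sum\<close>)
  then show ?thesis by (simp add: hshift_def)
qed

text \<open>Again only the cost survives on constants, so the bound is the right-hand side for the
  constant cost C, whose equation is solved by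
  \<open>exp (\<theta> * (C / \<alpha>))\<close>.\<close>

lemma hshift_const_le:
  assumes "0 \<le> \<eta>" "0 \<le> e"
  shows "hshift \<eta> (\<lambda>_. e) i \<le> (\<eta> * C + \<alpha> * real order_n) * e"
proof -
  obtain a where a: "a \<in> U i" using U_nonempty by blast
  have "hmin (U i) i (\<eta> * e) (\<lambda>_. e) \<le> hval i (\<eta> * e) (\<lambda>_. e) a"
    by (rule hmin_le[OF order_refl a])
  also have "\<dots> = c i a * (\<eta> * e)"
    by (simp add: hval_def rate_sum flip: sum_distrib_right)
  also have "\<dots> \<le> C * (\<eta> * e)"
    using assms c_le[OF a] by (intro mult_right_mono) auto
  finally show ?thesis by (simp add: hshift_def algebra_simps)
qed

section \<open>Weighted Picard operator and its barriers\<close>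

definition integrand :: "(real \<Rightarrow> 's \<Rightarrow> real) \<Rightarrow> 's \<Rightarrow> real \<Rightarrow> real" where
  "integrand W i \<eta> = \<eta> ^ (order_n - 1) * hshift \<eta> (W \<eta>) i"

text \<open>With n for \<open>order_n\<close>, adding \<alpha> n W to both sides and multiplying by
  \<theta>^(n-1) turns the equation into (\<alpha> \<theta>^n W)' = \<open>integrand W\<close>;
  integrating from 0 selects the solution bounded there.\<close>

definition picard :: "(real \<Rightarrow> 's \<Rightarrow> real) \<Rightarrow> real \<Rightarrow> 's \<Rightarrow> real" where
  "picard W \<theta> i = integral {0..\<theta>} (integrand W i) / (\<alpha> * \<theta> ^ order_n)"

text \<open>The endpoint 1 is included so that integrals over all of [0, 1] are available; at 0
  nothing is asked of \<open>W\<close>.\<close>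

definition sandwiched :: "(real \<Rightarrow> 's \<Rightarrow> real) \<Rightarrow> bool" where
  "sandwiched W \<longleftrightarrow> (\<forall>\<theta>\<in>{0<..1}. \<forall>i. 1 \<le> W \<theta> i \<and> W \<theta> i \<le> exp (\<theta> * (C / \<alpha>)))"

definition curve :: "(real \<Rightarrow> 's \<Rightarrow> real) \<Rightarrow> bool" where
  "curve W \<longleftrightarrow> sandwiched W \<and> (\<forall>i. continuous_on {0<..1} (\<lambda>\<theta>. W \<theta> i))"

lemma integrand_0 [simp]: "integrand W i 0 = 0"
  by (simp add: integrand_def)

lemma integrand_bounds:
  assumes W: "sandwiched W" and \<eta>: "\<eta> \<in> {0..1}"
  shows "\<alpha> * real order_n * \<eta> ^ (order_n - 1) \<le> integrand W i \<eta>"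
    and "integrand W i \<eta> \<le> \<eta> ^ (order_n - 1) * ((\<eta> * C + \<alpha> * real order_n) * exp (\<eta> * (C / \<alpha>)))"
proof -
  have "\<alpha> * real order_n * \<eta> ^ (order_n - 1) \<le> integrand W i \<eta> \<and>
    integrand W i \<eta> \<le> \<eta> ^ (order_n - 1) * ((\<eta> * C + \<alpha> * real order_n) * exp (\<eta> * (C / \<alpha>)))"
  proof (cases "\<eta> = 0")
    case True
    then show ?thesis by (simp add: integrand_def)
  next
    case False
    with \<eta> W have b: "1 \<le> W \<eta> j" "W \<eta> j \<le> exp (\<eta> * (C / \<alpha>))" for j
      by (auto simp: sandwiched_def)
    have "\<alpha> * real order_n \<le> hshift \<eta> (W \<eta>) i"
      using hshift_one_ge[of \<eta> i] hshift_mono[of \<eta> "\<lambda>_. 1" "W \<eta>" i] b(1) \<eta> by fastforce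
    moreover have "hshift \<eta> (W \<eta>) i \<le> (\<eta> * C + \<alpha> * real order_n) * exp (\<eta> * (C / \<alpha>))"
      using hshift_const_le[of \<eta> "exp (\<eta> * (C / \<alpha>))" i] hshift_mono[of \<eta> "W \<eta>" "\<lambda>_. exp (\<eta> * (C / \<alpha>))" i] b(2) \<eta>
      by fastforce
    ultimately show ?thesis
      using \<eta> unfolding integrand_def by (auto simp: mult.commute[of "\<alpha> * real order_n"] intro!: mult_left_mono)
  qed
  then show "\<alpha> * real order_n * \<eta> ^ (order_n - 1) \<le> integrand W i \<eta>"
    "integrand W i \<eta> \<le> \<eta> ^ (order_n - 1) * ((\<eta> * C + \<alpha> * real order_n) * exp (\<eta> * (C / \<alpha>)))"
    by auto
qed

definition integrand_bound :: real where
  "integrand_bound = (C + \<alpha> * real order_n) * exp (C / \<alpha>)"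

text \<open>At least one power of \<eta> remains because \<open>order_n\<close> is at least 2; it
  forces continuity at 0, where \<open>W\<close> itself is uncontrolled.\<close>

lemma integrand_abs_le:
  assumes W: "sandwiched W" and \<eta>: "\<eta> \<in> {0..1}"
  shows "\<bar>integrand W i \<eta>\<bar> \<le> \<eta> * integrand_bound"
proof -
  have "0 \<le> integrand W i \<eta>"
    using integrand_bounds(1)[OF W \<eta>, of i] \<eta> \<alpha> by (auto intro: order_trans[rotated])
  moreover have "integrand W i \<eta> \<le> \<eta> * ((1 * C + \<alpha> * real order_n) * exp (1 * (C / \<alpha>)))"
  proof (rule order_trans[OF integrand_bounds(2)[OF W \<eta>]])
    have "\<eta> ^ (order_n - 1) \<le> \<eta> ^ 1"
      using \<eta> order_n(1) by (intro power_decreasing) auto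
    then have a1: "\<eta> ^ (order_n - 1) \<le> \<eta>"
      by simp
    have "\<eta> * C \<le> 1 * C" "\<eta> * (C / \<alpha>) \<le> 1 * (C / \<alpha>)"
      using \<eta> \<alpha> C_nonneg by (intro mult_right_mono; simp)+
    then have a2: "(\<eta> * C + \<alpha> * real order_n) * exp (\<eta> * (C / \<alpha>)) \<le> (1 * C + \<alpha> * real order_n) * exp (1 * (C / \<alpha>))"
      using \<eta> \<alpha> C_nonneg by (intro mult_mono add_right_mono) auto
    show "\<eta> ^ (order_n - 1) * ((\<eta> * C + \<alpha> * real order_n) * exp (\<eta> * (C / \<alpha>)))
        \<le> \<eta> * ((1 * C + \<alpha> * real order_n) * exp (1 * (C / \<alpha>)))"
      by (rule mult_mono[OF a1 a2]) (use \<eta> \<alpha> C_nonneg in auto)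
  qed
  ultimately show ?thesis
    by (simp add: integrand_bound_def)
qed

lemma integrand_continuous:
  assumes W: "curve W"
  shows "continuous_on {0..1} (integrand W i)"
  unfolding continuous_on_eq_continuous_within
proof
  fix x :: real assume x: "x \<in> {0..1}"
  have sw: "sandwiched W" using W by (simp add: curve_def)
  show "continuous (at x within {0..1}) (integrand W i)"
  proof (cases "x = 0")
    case True
    have "(integrand W i \<longlongrightarrow> 0) (at 0 within {0..1})"
    proof (rule Lim_null_comparison)
      show "\<forall>\<^sub>F \<eta> in at 0 within {0..1}. norm (integrand W i \<eta>) \<le> \<eta> * integrand_bound"
        using integrand_abs_le[OF sw] by (auto simp: eventually_at intro!: exI[of _ 1])
      show "((\<lambda>\<eta>. \<eta> * integrand_bound) \<longlongrightarrow> 0) (at 0 within {0..1})"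
        by (rule tendsto_mult_left_zero) (rule tendsto_ident_at)
    qed
    with True show ?thesis by (simp add: continuous_within)
  next
    case False
    have "continuous_on {0<..1} (integrand W i)"
      unfolding integrand_def hshift_def using W
      by (intro continuous_intros continuous_on_hmin U_nonempty) (auto simp: curve_def intro!: continuous_intros)
    then have "continuous (at x within {0<..1}) (integrand W i)"
      using x False by (auto simp: continuous_on_eq_continuous_within)
    moreover have "at x within {0..1} = at x within {0<..1}"
      by (rule at_within_nhd[of _ "{0<..}"]) (use x False in auto)
    ultimately show ?thesis by simp
  qed
qed

lemma integrand_integrable:
  assumes "curve W" "\<theta> \<in> {0<..1}"
  shows "integrand W i integrable_on {0..\<theta>}"
  by (rule integrable_continuous_real, rule continuous_on_subset[OF integrand_continuous[OF assms(1)]])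
     (use assms(2) in auto)

lemma has_integral_lower:
  "0 \<le> \<theta> \<Longrightarrow> ((\<lambda>\<eta>. \<alpha> * real order_n * \<eta> ^ (order_n - 1)) has_integral \<alpha> * \<theta> ^ order_n) {0..\<theta>}"
proof -
  assume "0 \<le> \<theta>"
  then have "((\<lambda>\<eta>. \<alpha> * real order_n * \<eta> ^ (order_n - 1)) has_integral \<alpha> * \<theta> ^ order_n - \<alpha> * 0 ^ order_n) {0..\<theta>}"
    by (intro fundamental_theorem_of_calculus)
       (auto simp: has_real_derivative_iff_has_vector_derivative[symmetric] intro!: derivative_eq_intros)
  then show ?thesis by simp
qed

text \<open>The integrand is the exact derivative of the stated primitive, so the operator preserves
  the upper barrier.\<close>

lemma has_integral_upper:
  assumes "0 \<le> \<theta>"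
  shows "((\<lambda>\<eta>. \<eta> ^ (order_n - 1) * ((\<eta> * C + \<alpha> * real order_n) * exp (\<eta> * (C / \<alpha>)))) has_integral
    \<alpha> * \<theta> ^ order_n * exp (\<theta> * (C / \<alpha>))) {0..\<theta>}"
proof -
  have "((\<lambda>\<eta>. \<eta> ^ (order_n - 1) * ((\<eta> * C + \<alpha> * real order_n) * exp (\<eta> * (C / \<alpha>)))) has_integral
    \<alpha> * \<theta> ^ order_n * exp (\<theta> * (C / \<alpha>)) - \<alpha> * 0 ^ order_n * exp (0 * (C / \<alpha>))) {0..\<theta>}"
  proof (rule fundamental_theorem_of_calculus[OF assms])
    fix \<eta> :: real
    have "\<eta> ^ order_n = \<eta> ^ (order_n - 1) * \<eta>"
      using order_n(1) by (metis One_nat_def Suc_1 Suc_le_D diff_Suc_1 power_Suc2 Suc_leD)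
    then have "((\<lambda>\<eta>. \<alpha> * \<eta> ^ order_n * exp (\<eta> * (C / \<alpha>))) has_real_derivative
        \<eta> ^ (order_n - 1) * ((\<eta> * C + \<alpha> * real order_n) * exp (\<eta> * (C / \<alpha>)))) (at \<eta> within {0..\<theta>})"
      using \<alpha> by (auto intro!: derivative_eq_intros simp: field_simps)
    then show "((\<lambda>\<eta>. \<alpha> * \<eta> ^ order_n * exp (\<eta> * (C / \<alpha>))) has_vector_derivative
        \<eta> ^ (order_n - 1) * ((\<eta> * C + \<alpha> * real order_n) * exp (\<eta> * (C / \<alpha>)))) (at \<eta> within {0..\<theta>})"
      by (simp add: has_real_derivative_iff_has_vector_derivative)
  qed
  then show ?thesis by simp
qed

lemma picard_bounds:
  assumes W: "sandwiched W" and \<theta>: "\<theta> \<in> {0<..1}" and int: "integrand W i integrable_on {0..\<theta>}"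
  shows "1 \<le> picard W \<theta> i" "picard W \<theta> i \<le> exp (\<theta> * (C / \<alpha>))"
proof -
  have \<theta>0: "0 \<le> \<theta>" using \<theta> by simp
  have "\<alpha> * \<theta> ^ order_n \<le> integral {0..\<theta>} (integrand W i)"
    by (rule has_integral_le[OF has_integral_lower[OF \<theta>0] integrable_integral[OF int]
          integrand_bounds(1)[OF W]]) (use \<theta> in auto)
  then show "1 \<le> picard W \<theta> i"
    using \<theta> \<alpha> by (simp add: picard_def)
  have "integral {0..\<theta>} (integrand W i) \<le> \<alpha> * \<theta> ^ order_n * exp (\<theta> * (C / \<alpha>))"
    by (rule has_integral_le[OF integrable_integral[OF int] has_integral_upper[OF \<theta>0]
          integrand_bounds(2)[OF W]]) (use \<theta> in auto)
  then show "picard W \<theta> i \<le> exp (\<theta> * (C / \<alpha>))"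
    using \<theta> \<alpha> by (simp add: picard_def pos_divide_le_eq mult.commute)
qed

lemma picard_continuous:
  assumes "integrand W i integrable_on {0..1}"
  shows "continuous_on {0<..1} (\<lambda>\<theta>. picard W \<theta> i)"
  unfolding picard_def
  by (intro continuous_intros continuous_on_subset[OF indefinite_integral_continuous_1[OF assms]])
     (use \<alpha> in auto)

lemma curve_picard:
  assumes W: "curve W"
  shows "curve (picard W)"
proof -
  have sw: "sandwiched W" using W by (simp add: curve_def)
  show ?thesis
    unfolding curve_def sandwiched_def
    using picard_bounds[OF sw _ integrand_integrable[OF W]] picard_continuous[OF integrand_integrable[OF W]] by auto
qed

lemma picard_mono:
  assumes W: "curve W" "curve W'" and le: "\<And>\<eta> j. \<eta> \<in> {0<..1} \<Longrightarrow> W \<eta> j \<le> W' \<eta> j" and \<theta>: "\<theta> \<in> {0<..1}"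
  shows "picard W \<theta> i \<le> picard W' \<theta> i"
proof -
  have "integral {0..\<theta>} (integrand W i) \<le> integral {0..\<theta>} (integrand W' i)"
  proof (rule integral_le)
    fix \<eta> assume \<eta>: "\<eta> \<in> {0..\<theta>}"
    show "integrand W i \<eta> \<le> integrand W' i \<eta>"
    proof (cases "\<eta> = 0")
      case False
      then show ?thesis
        unfolding integrand_def using \<eta> \<theta> le by (intro mult_left_mono hshift_mono) auto
    qed simp
  qed (use integrand_integrable W \<theta> in auto)
  then show ?thesis
    unfolding picard_def using \<alpha> \<theta> by (intro divide_right_mono) auto
qed

section \<open>Monotone iteration and its limit\<close>

primrec iter :: "nat \<Rightarrow> real \<Rightarrow> 's \<Rightarrow> real" where
  "iter 0 = (\<lambda>_ _. 1)"
| "iter (Suc k) = picard (iter k)"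

lemma curve_iter: "curve (iter k)"
proof (induction k)
  case 0
  show ?case
    using C_nonneg \<alpha> by (auto simp: curve_def sandwiched_def)
qed (simp add: curve_picard)

lemma iter_bounds:
  assumes "\<theta> \<in> {0<..1}"
  shows "1 \<le> iter k \<theta> i" "iter k \<theta> i \<le> exp (\<theta> * (C / \<alpha>))"
  using curve_iter[of k] assms unfolding curve_def sandwiched_def by auto

text \<open>The iteration starts at the lower barrier, so its first step goes up; monotonicity of
  the operator propagates this.\<close>

lemma iter_mono: "\<theta> \<in> {0<..1} \<Longrightarrow> iter k \<theta> i \<le> iter (Suc k) \<theta> i"
proof (induction k arbitrary: \<theta> i)
  case 0
  then show ?case using iter_bounds(1)[of \<theta> "Suc 0" i] by simp
next
  case (Suc k)
  have "picard (iter k) \<theta> i \<le> picard (iter (Suc k)) \<theta> i"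
    by (rule picard_mono[OF curve_iter curve_iter Suc.IH Suc.prems])
  then show ?case by simp
qed

definition sol :: "real \<Rightarrow> 's \<Rightarrow> real" where
  "sol \<theta> i = lim (\<lambda>k. iter k \<theta> i)"

lemma iter_tendsto:
  assumes \<theta>: "\<theta> \<in> {0<..1}"
  shows "(\<lambda>k. iter k \<theta> i) \<longlonglongrightarrow> sol \<theta> i"
proof -
  have "incseq (\<lambda>k. iter k \<theta> i)"
    by (rule incseq_SucI) (rule iter_mono[OF \<theta>])
  moreover have "\<forall>k. iter k \<theta> i \<le> exp (\<theta> * (C / \<alpha>))"
    using iter_bounds(2)[OF \<theta>] by blast
  ultimately have "convergent (\<lambda>k. iter k \<theta> i)"
    by (auto intro: incseq_convergent simp: convergent_def)
  then show ?thesis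
    by (simp add: sol_def convergent_LIMSEQ_iff)
qed

lemma sandwiched_sol: "sandwiched sol"
  unfolding sandwiched_def
  using LIMSEQ_le_const[OF iter_tendsto, of _ 1] LIMSEQ_le_const2[OF iter_tendsto] iter_bounds by blast

text \<open>The limit is not yet known to be continuous, so dominated convergence has to deliver
  integrability as well as the value of the integral.\<close>

lemma sol_fixed_point:
  assumes \<theta>: "\<theta> \<in> {0<..1}"
  shows "integrand sol i integrable_on {0..\<theta>}" "sol \<theta> i = picard sol \<theta> i"
proof -
  have int: "integrand (iter k) i integrable_on {0..\<theta>}" for k
    by (rule integrand_integrable[OF curve_iter \<theta>])
  have bound: "norm (integrand (iter k) i \<eta>) \<le> integrand_bound" if "\<eta> \<in> {0..\<theta>}" for k \<eta>
  proof -
    have "\<bar>integrand (iter k) i \<eta>\<bar> \<le> \<eta> * integrand_bound"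
      by (rule integrand_abs_le) (use that \<theta> curve_iter in \<open>auto simp: curve_def\<close>)
    also have "\<dots> \<le> 1 * integrand_bound"
      using that \<theta> C_nonneg \<alpha> by (intro mult_right_mono) (auto simp: integrand_bound_def)
    finally show ?thesis by simp
  qed
  have conv: "(\<lambda>k. integrand (iter k) i \<eta>) \<longlonglongrightarrow> integrand sol i \<eta>" if "\<eta> \<in> {0..\<theta>}" for \<eta>
  proof (cases "\<eta> = 0")
    case False
    then have "(\<lambda>k. iter k \<eta> j) \<longlonglongrightarrow> sol \<eta> j" for j
      using that \<theta> by (intro iter_tendsto) auto
    then show ?thesis
      unfolding integrand_def hshift_def by (intro tendsto_intros tendsto_hmin order_refl U_nonempty)
  qed simp
  have *: "integrand sol i integrable_on {0..\<theta>}"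
    "(\<lambda>k. integral {0..\<theta>} (integrand (iter k) i)) \<longlonglongrightarrow> integral {0..\<theta>} (integrand sol i)"
    by (rule dominated_convergence[OF int _ bound conv, OF integrable_const_ivl]; assumption)+
  show "integrand sol i integrable_on {0..\<theta>}" by (rule *(1))
  have "(\<lambda>k. iter (Suc k) \<theta> i) \<longlonglongrightarrow> picard sol \<theta> i"
    unfolding iter.simps picard_def using \<theta> \<alpha> by (intro tendsto_intros *(2)) auto
  moreover have "(\<lambda>k. iter (Suc k) \<theta> i) \<longlonglongrightarrow> sol \<theta> i"
    using iter_tendsto[OF \<theta>] by (rule LIMSEQ_Suc)
  ultimately show "sol \<theta> i = picard sol \<theta> i"
    using LIMSEQ_unique by blast
qed

text \<open>Continuity is gained from the fixed-point equation: an indefinite integral is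
  continuous.\<close>

lemma curve_sol: "curve sol"
  unfolding curve_def
proof (intro conjI sandwiched_sol allI)
  fix i
  show "continuous_on {0<..1} (\<lambda>\<theta>. sol \<theta> i)"
    by (rule continuous_on_cong[THEN iffD2, OF refl _ picard_continuous[OF sol_fixed_point(1)[of 1]]])
       (auto simp: sol_fixed_point(2)[symmetric])
qed

text \<open>With the integrand now continuous, the fixed point can be differentiated; the quotient
  rule produces exactly the term that cancels the shift by
  \<open>\<alpha> * real order_n\<close>.\<close>

lemma sol_deriv:
  assumes \<theta>: "0 < \<theta>" "\<theta> < 1"
  shows "((\<lambda>\<theta>. sol \<theta> i) has_real_derivative hmin (U i) i (\<theta> * sol \<theta> i) (sol \<theta>) / (\<alpha> * \<theta>)) (at \<theta>)"
proof -
  let ?I = "\<lambda>\<theta>. integral {0..\<theta>} (integrand sol i)"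
  have "(?I has_real_derivative integrand sol i \<theta>) (at \<theta> within {0..1})"
    by (rule integral_has_real_derivative[OF integrand_continuous[OF curve_sol]]) (use \<theta> in auto)
  moreover have "at \<theta> within {0..1} = at \<theta>"
    using \<theta> by (intro at_within_interior) (auto simp: interior_atLeastAtMost_real)
  ultimately have I: "(?I has_real_derivative integrand sol i \<theta>) (at \<theta>)"
    by simp
  have pow: "\<theta> ^ order_n = \<theta> ^ (order_n - 1) * \<theta>"
    using order_n(1) by (metis One_nat_def Suc_1 Suc_le_D diff_Suc_1 power_Suc2 Suc_leD)
  have sol: "?I \<theta> = sol \<theta> i * (\<alpha> * \<theta> ^ order_n)"
    using sol_fixed_point(2)[of \<theta> i] \<theta> \<alpha> by (simp add: picard_def)
  have "((\<lambda>\<theta>. picard sol \<theta> i) has_real_derivative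
      (integrand sol i \<theta> * (\<alpha> * \<theta> ^ order_n) - ?I \<theta> * (\<alpha> * (real order_n * \<theta> ^ (order_n - 1))))
        / ((\<alpha> * \<theta> ^ order_n) * (\<alpha> * \<theta> ^ order_n))) (at \<theta>)"
    unfolding picard_def
    by (rule DERIV_divide[OF I]) (use \<theta> \<alpha> in \<open>auto intro!: derivative_eq_intros\<close>)
  also have "(integrand sol i \<theta> * (\<alpha> * \<theta> ^ order_n) - ?I \<theta> * (\<alpha> * (real order_n * \<theta> ^ (order_n - 1))))
        / ((\<alpha> * \<theta> ^ order_n) * (\<alpha> * \<theta> ^ order_n)) = hmin (U i) i (\<theta> * sol \<theta> i) (sol \<theta>) / (\<alpha> * \<theta>)"
    using \<theta> \<alpha> unfolding sol integrand_def hshift_def pow by (simp add: field_simps)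
  finally show ?thesis
    by (rule has_field_derivative_transform_within_open[of _ _ _ "{0<..<1}"])
       (use \<theta> in \<open>auto simp: sol_fixed_point(2)[symmetric]\<close>)
qed

text \<open>Undoing the substitution gives v = ln W / \<theta>; the barriers for W become 0 <= v <=
  C / \<alpha>, a bound uniform in \<theta>.\<close>

theorem hjb_candidate_exists: "\<exists>v. hjb_candidate U lam c \<alpha> M C P v (C / \<alpha>)"
proof (intro exI hjb_candidate.intro controlled_chain_axioms hjb_candidate_axioms.intro)
  let ?v = "\<lambda>\<theta> i. ln (sol \<theta> i) / \<theta>"
  let ?h = "\<lambda>\<theta> i. hmin (U i) i (\<theta> * sol \<theta> i) (sol \<theta>)"
  let ?d = "\<lambda>\<theta> i. ?h \<theta> i / (\<alpha> * \<theta>) / sol \<theta> i / \<theta> - ln (sol \<theta> i) / (\<theta> * \<theta>)"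
  have ge: "1 \<le> sol \<theta> i" "sol \<theta> i \<le> exp (\<theta> * (C / \<alpha>))" if "0 < \<theta>" "\<theta> < 1" for \<theta> i
    using sandwiched_sol that by (auto simp: sandwiched_def)
  have pos: "0 < sol \<theta> i" if "0 < \<theta>" "\<theta> < 1" for \<theta> i
    using ge(1)[OF that, of i] by linarith
  have d: "((\<lambda>\<theta>. ?v \<theta> i) has_real_derivative ?d \<theta> i) (at \<theta>)" if \<theta>: "0 < \<theta>" "\<theta> < 1" for \<theta> i
    using \<theta> \<alpha> pos[OF \<theta>, of i]
    by (auto intro!: derivative_eq_intros sol_deriv[OF \<theta>] simp: field_simps)
  have dv: "deriv (\<lambda>\<theta>. ?v \<theta> i) \<theta> = ?d \<theta> i" if \<theta>: "0 < \<theta>" "\<theta> < 1" for \<theta> i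
    by (rule DERIV_imp_deriv[OF d[OF \<theta>]])
  have cont: "continuous_on {0<..<1} (\<lambda>\<theta>. sol \<theta> i)" for i
    by (rule continuous_on_subset[of "{0<..1}"]) (use curve_sol in \<open>auto simp: curve_def\<close>)
  fix i
  have "continuous_on {0<..<1} (\<lambda>\<theta>. ?d \<theta> i)"
    by (intro continuous_intros continuous_on_hmin U_nonempty order_refl cont)
       (use \<alpha> pos in \<open>auto simp: less_imp_neq[symmetric]\<close>)
  then have "continuous_on {0<..<1} (deriv (\<lambda>\<theta>. ?v \<theta> i))"
    by (rule continuous_on_cong[THEN iffD2, rotated 2]) (auto simp: dv)
  then show "(\<lambda>\<theta>. ?v \<theta> i) C1_differentiable_on {0<..<1}"
    unfolding C1_differentiable_on_real_iff using d dv by auto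
  fix \<theta> :: real assume \<theta>: "0 < \<theta>" "\<theta> < 1"
  have "ln (sol \<theta> i) \<le> \<theta> * (C / \<alpha>)"
    using ge[OF \<theta>, of i] pos[OF \<theta>, of i] ln_le_cancel_iff[of "sol \<theta> i" "exp (\<theta> * (C / \<alpha>))"] by simp
  then show "\<bar>?v \<theta> i\<bar> \<le> C / \<alpha>"
    using \<theta> ge(1)[OF \<theta>, of i] by (simp add: divide_le_eq mult.commute)
  have e: "exp (\<theta> * ?v \<theta> j) = sol \<theta> j" for j
    using \<theta> pos[OF \<theta>] by simp
  have "\<alpha> * \<theta> * (?v \<theta> i + \<theta> * ?d \<theta> i) * sol \<theta> i = ?h \<theta> i"
    using \<theta> \<alpha> pos[OF \<theta>, of i] by (simp add: field_simps)
  then show "\<alpha> * \<theta> * (?v \<theta> i + \<theta> * deriv (\<lambda>\<eta>. ?v \<eta> i) \<theta>) * exp (\<theta> * ?v \<theta> i)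
      = (INF a\<in>U i. hamiltonian lam c ?v \<theta> i a)"
    unfolding hamiltonian_eq_hval e dv[OF \<theta>] by (simp only: hmin_def)
qed

end

subsection \<open>Measurable selection\<close>

text \<open>Total boundedness gives finite nets at the scales 1 / (n + 1); their countable union is
  enumerated.\<close>

lemma compact_dense_sequence:
  fixes K :: "'u::metric_space set"
  assumes "compact K" "K \<noteq> {}"
  shows "\<exists>x::nat \<Rightarrow> 'u. \<forall>a\<in>K. \<forall>e>0. \<exists>k. dist (x k) a < e"
proof -
  have "\<exists>F. finite F \<and> F \<subseteq> K \<and> K \<subseteq> (\<Union>y\<in>F. ball y (1 / real (Suc n)))" for n
    using seq_compact_imp_totally_bounded[of K] assms(1) by (simp add: compact_eq_seq_compact_metric)
  then have "\<forall>n. \<exists>F. finite F \<and> F \<subseteq> K \<and> K \<subseteq> (\<Union>y\<in>F. ball y (1 / real (Suc n)))"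
    by blast
  from choice[OF this]
  obtain F where F: "\<And>n. finite (F n)" "\<And>n. K \<subseteq> (\<Union>y\<in>F n. ball y (1 / real (Suc n)))"
    by blast
  have "F 0 \<noteq> {}"
    using F(2)[of 0] assms(2) by auto
  then have "range (from_nat_into (\<Union>n. F n)) = (\<Union>n. F n)"
    using F(1) by (intro range_from_nat_into) (auto intro: countable_finite)
  moreover have "\<exists>y\<in>(\<Union>n. F n). dist y a < e" if a: "a \<in> K" and e: "0 < e" for a e
  proof -
    obtain n where n: "1 / real (Suc n) < e"
      using reals_Archimedean[OF e] by (auto simp: inverse_eq_divide)
    obtain y where "y \<in> F n" "dist y a < 1 / real (Suc n)"
      using F(2)[of n] a by auto
    with n show ?thesis by (intro bexI[of _ y]) auto
  qed
  ultimately have "\<exists>k. dist (from_nat_into (\<Union>n. F n) k) a < e" if "a \<in> K" "0 < e" for a e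
    using that by (metis (no_types, lifting) rangeE)
  then show ?thesis
    by (intro exI[of _ "from_nat_into (\<Union>n. F n)"]) blast
qed

text \<open>A Kuratowski--Ryll-Nardzewski argument: intersect the argmin set successively with balls of radius
  \<open>2\<^sup>-\<^sup>n\<close> around the first admissible point of a dense sequence.\<close>

theorem measurable_argmin:
  fixes h :: "'x \<Rightarrow> 'u::metric_space \<Rightarrow> real"
  assumes K: "compact K" "K \<noteq> {}"
    and cont: "\<And>\<theta>. \<theta> \<in> space M \<Longrightarrow> continuous_on K (h \<theta>)"
    and meas: "\<And>D. D \<subseteq> K \<Longrightarrow> D \<noteq> {} \<Longrightarrow> (\<lambda>\<theta>. INF a\<in>D. h \<theta> a) \<in> borel_measurable M"
  shows "\<exists>s\<in>M \<rightarrow>\<^sub>M borel. \<forall>\<theta>\<in>space M. s \<theta> \<in> K \<and> (\<forall>b\<in>K. h \<theta> (s \<theta>) \<le> h \<theta> b)"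
proof -
  define argmin where "argmin = (\<lambda>\<theta>. {a \<in> K. \<forall>b\<in>K. h \<theta> a \<le> h \<theta> b})"
  define hit where "hit = (\<lambda>\<theta> D. argmin \<theta> \<inter> D \<noteq> {})"
  have attains: "\<exists>a\<in>D. \<forall>b\<in>D. h \<theta> a \<le> h \<theta> b" if "\<theta> \<in> space M" "compact D" "D \<noteq> {}" "D \<subseteq> K" for \<theta> D
    using continuous_attains_inf[OF that(2,3) continuous_on_subset[OF cont[OF that(1)] that(4)]] .
  have hit_UNIV: "hit \<theta> UNIV" if "\<theta> \<in> space M" for \<theta>
    using attains[OF that K] by (auto simp: hit_def argmin_def)
  have compact_argmin: "compact (argmin \<theta>)" if \<theta>: "\<theta> \<in> space M" for \<theta>
  proof -
    obtain a where a: "a \<in> K" "\<forall>b\<in>K. h \<theta> a \<le> h \<theta> b"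
      using attains[OF \<theta> K] by auto
    have "closedin (top_of_set K) (K \<inter> h \<theta> -` {..h \<theta> a})"
      by (rule continuous_closedin_preimage[OF cont[OF \<theta>]]) simp
    then have "compact (K \<inter> h \<theta> -` {..h \<theta> a})"
      by (rule closedin_compact[OF K(1)])
    also have "K \<inter> h \<theta> -` {..h \<theta> a} = argmin \<theta>"
      using a by (auto simp: argmin_def intro: order_trans)
    finally show ?thesis .
  qed
  have INF_attained: "(INF b\<in>D. h \<theta> b) = h \<theta> a" if "a \<in> D" "\<forall>b\<in>D. h \<theta> a \<le> h \<theta> b" for \<theta> D a
    using that by (intro cInf_eq_minimum) auto
  \<comment> \<open>A closed \<open>D\<close> meets the argmin iff minimizing over
    \<open>K \<inter> D\<close> does no worse than over \<open>K\<close>; compactness makes both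
    infima attained. This is why \<open>meas\<close> is asked for subsets of
    \<open>K\<close>.\<close>
  have hit_meas: "Measurable.pred M (\<lambda>\<theta>. hit \<theta> D)" if D: "closed D" for D
  proof (cases "K \<inter> D = {}")
    \<comment> \<open>Treated apart since the infimum over the empty set is an unspecified
      default.\<close>
    case True
    then have "\<not> hit \<theta> D" for \<theta> by (auto simp: hit_def argmin_def)
    then show ?thesis by simp
  next
    case False
    have "hit \<theta> D \<longleftrightarrow> (INF a\<in>K \<inter> D. h \<theta> a) \<le> (INF a\<in>K. h \<theta> a)" if \<theta>: "\<theta> \<in> space M" for \<theta>
    proof -
      obtain a where a: "a \<in> K" "\<forall>b\<in>K. h \<theta> a \<le> h \<theta> b"
        using attains[OF \<theta> K] by auto
      obtain d where d: "d \<in> K \<inter> D" "\<forall>b\<in>K \<inter> D. h \<theta> d \<le> h \<theta> b"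
        using attains[OF \<theta> compact_Int_closed[OF K(1) D] False] by auto
      have "hit \<theta> D \<longleftrightarrow> h \<theta> d \<le> h \<theta> a"
      proof
        assume "hit \<theta> D"
        then obtain e where "e \<in> K \<inter> D" "\<forall>b\<in>K. h \<theta> e \<le> h \<theta> b"
          by (auto simp: hit_def argmin_def)
        then show "h \<theta> d \<le> h \<theta> a" using d(2) a(1) by (blast intro: order_trans)
      next
        assume "h \<theta> d \<le> h \<theta> a"
        then have "d \<in> argmin \<theta> \<inter> D"
          using d(1) a(2) by (auto simp: argmin_def intro: order_trans)
        then show "hit \<theta> D" by (auto simp: hit_def)
      qed
      then show ?thesis
        by (simp add: INF_attained[OF a] INF_attained[OF d])
    qed
    then have "Measurable.pred M (\<lambda>\<theta>. hit \<theta> D) \<longleftrightarrow>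
        Measurable.pred M (\<lambda>\<theta>. (INF a\<in>K \<inter> D. h \<theta> a) \<le> (INF a\<in>K. h \<theta> a))"
      by (rule measurable_cong)
    moreover have "Measurable.pred M (\<lambda>\<theta>. (INF a\<in>K \<inter> D. h \<theta> a) \<le> (INF a\<in>K. h \<theta> a))"
    proof -
      have [measurable]: "(\<lambda>\<theta>. INF a\<in>K \<inter> D. h \<theta> a) \<in> borel_measurable M"
        "(\<lambda>\<theta>. INF a\<in>K. h \<theta> a) \<in> borel_measurable M"
        using meas[OF Int_lower1 False] meas[OF order_refl K(2)] .
      show ?thesis by measurable
    qed
    ultimately show ?thesis by (rule iffD2)
  qed
  from compact_dense_sequence[OF K]
  obtain x :: "nat \<Rightarrow> 'u" where x: "\<forall>a\<in>K. \<forall>e>0. \<exists>k. dist (x k) a < e" ..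
  \<comment> \<open>A list records the indices chosen so far, latest first, and its length sets the
    next radius. Closed balls keep \<open>hit_meas\<close> applicable.\<close>
  define cell where "cell = rec_list UNIV (\<lambda>k ks E. E \<inter> cball (x k) ((1/2) ^ length ks))"
  have cell: "cell [] = UNIV" "cell (k # ks) = cell ks \<inter> cball (x k) ((1/2) ^ length ks)" for k :: nat and ks
    by (simp_all add: cell_def)
  have closed_cell: "closed (cell ks)" for ks
    by (induction ks) (auto simp: cell)
  \<comment> \<open>The whole history is kept as a list of naturals: there are only countably many,
    so each step is a measurable choice among measurable functions.\<close>
  define sel where "sel = (\<lambda>\<theta>. rec_nat [] (\<lambda>_ ks. (LEAST k. hit \<theta> (cell (k # ks))) # ks))"
  have sel: "sel \<theta> 0 = []" "sel \<theta> (Suc n) = (LEAST k. hit \<theta> (cell (k # sel \<theta> n))) # sel \<theta> n" for \<theta> n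
    by (simp_all add: sel_def)
  have length_sel: "length (sel \<theta> n) = n" for \<theta> n
    by (induction n) (simp_all add: sel)
  have hit_sel: "hit \<theta> (cell (sel \<theta> n))" if \<theta>: "\<theta> \<in> space M" for \<theta> n
  proof (induction n)
    case 0
    then show ?case by (simp add: sel cell hit_UNIV[OF \<theta>])
  next
    case (Suc n)
    then obtain a where a: "a \<in> argmin \<theta>" "a \<in> cell (sel \<theta> n)"
      by (auto simp: hit_def)
    then obtain k where "dist (x k) a < (1/2) ^ n"
      using x[rule_format, of a "(1/2) ^ n"] by (auto simp: argmin_def)
    with a have "hit \<theta> (cell (k # sel \<theta> n))"
      by (auto simp: hit_def cell length_sel)
    then show ?case
      unfolding sel by (rule LeastI)
  qed
  have sel_meas: "(\<lambda>\<theta>. sel \<theta> n) \<in> M \<rightarrow>\<^sub>M count_space UNIV" for n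
  proof (induction n)
    case 0
    then show ?case by (simp add: sel)
  next
    case (Suc n)
    have "(\<lambda>\<theta>. (LEAST k. hit \<theta> (cell (k # ks))) # ks) \<in> M \<rightarrow>\<^sub>M count_space UNIV" for ks
      by (rule measurable_compose[OF measurable_Least[OF hit_meas[OF closed_cell]]]) simp
    from measurable_compose_countable[OF this Suc] show ?case
      by (simp add: sel)
  qed
  have "\<exists>a. a \<in> argmin \<theta> \<inter> (\<Inter>n. cell (sel \<theta> n))" if \<theta>: "\<theta> \<in> space M" for \<theta>
  proof -
    have dec: "m \<le> n \<Longrightarrow> cell (sel \<theta> n) \<subseteq> cell (sel \<theta> m)" for m n
      by (induction rule: dec_induct) (auto simp: sel cell)
    \<comment> \<open>Nested closed cells that each meet a compact set have a common point in
      it.\<close>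
    have "argmin \<theta> \<inter> (\<Inter>n\<in>UNIV. cell (sel \<theta> n)) \<noteq> {}"
    proof (rule compact_imp_fip_image[OF compact_argmin[OF \<theta>] closed_cell])
      fix I :: "nat set" assume "finite I"
      then have "cell (sel \<theta> (Max (insert 0 I))) \<subseteq> (\<Inter>n\<in>I. cell (sel \<theta> n))"
        by (intro INT_greatest dec) auto
      with hit_sel[OF \<theta>, of "Max (insert 0 I)"] show "argmin \<theta> \<inter> (\<Inter>n\<in>I. cell (sel \<theta> n)) \<noteq> {}"
        by (auto simp: hit_def)
    qed
    then show ?thesis by auto
  qed
  \<comment> \<open>\<open>s\<close> is chosen pointwise; its measurability is recovered from the
    measurable centres, which approach it at distance at most \<open>(1/2) ^ n\<close>.\<close>
  then obtain s where s: "\<And>\<theta>. \<theta> \<in> space M \<Longrightarrow> s \<theta> \<in> argmin \<theta> \<inter> (\<Inter>n. cell (sel \<theta> n))"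
    by (metis (no_types))
  have "s \<in> M \<rightarrow>\<^sub>M borel"
  proof (rule borel_measurable_LIMSEQ_metric)
    show "(\<lambda>\<theta>. x (hd (sel \<theta> (Suc n)))) \<in> M \<rightarrow>\<^sub>M borel" for n
      by (rule measurable_compose[OF sel_meas]) simp
    fix \<theta> assume \<theta>: "\<theta> \<in> space M"
    have bound: "dist (x (hd (sel \<theta> (Suc n)))) (s \<theta>) \<le> (1/2) ^ n" for n
    proof -
      have "s \<theta> \<in> cell (sel \<theta> (Suc n))"
        using s[OF \<theta>] by blast
      then show ?thesis by (simp add: sel cell length_sel)
    qed
    have "(\<lambda>n. dist (x (hd (sel \<theta> (Suc n)))) (s \<theta>)) \<longlonglongrightarrow> 0"
      by (rule Lim_null_comparison[OF _ LIMSEQ_realpow_zero[of "1/2"]])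
         (use bound in \<open>auto intro: always_eventually\<close>)
    then show "(\<lambda>n. x (hd (sel \<theta> (Suc n)))) \<longlonglongrightarrow> s \<theta>"
      by (rule tendsto_dist_iff[THEN iffD2])
  qed
  with s show ?thesis
    by (auto simp: argmin_def)
qed

subsection \<open>The value function\<close>

lemma C1_differentiable_on_cong_open:
  assumes "f C1_differentiable_on S" "open S" "\<And>x. x \<in> S \<Longrightarrow> f x = g x"
  shows "g C1_differentiable_on S"
  using assms unfolding C1_differentiable_on_def
  by (meson has_vector_derivative_transform_within_open)

context controlled_chain
begin

section \<open>Small-parameter limit of the risk-sensitive cost\<close>

lemma constant_control: "\<exists>u. u \<in> markov_controls U"
proof -
  have "\<forall>i. \<exists>a. a \<in> U i" using U_nonempty by blast
  then obtain a where "\<forall>i. a i \<in> U i" by metis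
  then have "(\<lambda>_. a) \<in> markov_controls U" by (simp add: markov_controls_def)
  then show ?thesis by blast
qed

lemma controls_nonempty: "markov_controls U \<noteq> {}"
  using constant_control by blast

abbreviation mean_cost :: "'s \<Rightarrow> (real \<Rightarrow> 's \<Rightarrow> 'u) \<Rightarrow> real" where
  "mean_cost i u \<equiv> LINT x|P u i. discounted_cost c \<alpha> u x"

text \<open>Jensen below, second-order Taylor expansion above.\<close>

lemma risk_cost_mean_bounds:
  assumes u: "u \<in> markov_controls U" and \<theta>: "0 < \<theta>" "\<theta> < 1"
  shows "mean_cost i u \<le> risk_cost P c \<alpha> \<theta> i u"
    and "risk_cost P c \<alpha> \<theta> i u \<le> mean_cost i u + \<theta> * ((C / \<alpha>)\<^sup>2 * exp (C / \<alpha>))"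
    and "0 \<le> mean_cost i u"
proof -
  interpret jump_law "P u i" "\<lambda>r j k. rate lam j k (u r j)" i M
    by (rule jump_law_control[OF u])
  interpret prob_space "P u i" by (rule prob)
  define Z where "Z = discounted_cost c \<alpha> u"
  define b where "b = C / \<alpha>"
  define m where "m = (LINT x|P u i. Z x)"
  define E where "E = (LINT x|P u i. exp (\<theta> * Z x))"
  have Z: "0 \<le> Z x" "Z x \<le> b" if "x \<in> cadlag_paths" for x
    using discounted_cost_nonneg[OF u that] discounted_cost_le[OF u that] by (auto simp: Z_def b_def)
  have mZ: "Z \<in> borel_measurable (P u i)"
    unfolding Z_def by (rule measurable_discounted_cost[OF u])
  have iZ: "integrable (P u i) Z"
    by (rule integrable_bounded[OF mZ, of b]) (use Z in auto)
  have b0: "0 \<le> b"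
    using C_nonneg \<alpha> by (simp add: b_def)
  have \<theta>Z: "0 \<le> \<theta> * Z x" "\<theta> * Z x \<le> \<theta> * b" "\<theta> * b \<le> b" if "x \<in> cadlag_paths" for x
    using Z[OF that] \<theta> b0 by (auto intro: mult_left_mono mult_left_le_one_le)
  have iE: "integrable (P u i) (\<lambda>x. exp (\<theta> * Z x))"
  proof (rule integrable_bounded[of _ "exp b"])
    show "(\<lambda>x. exp (\<theta> * Z x)) \<in> borel_measurable (P u i)"
      using mZ by measurable
  qed (use \<theta>Z in fastforce)
  have "exp (\<theta> * m) \<le> E"
  proof -
    \<comment> \<open>Jensen for the exponential, via its tangent line at \<theta> m.\<close>
    have "(LINT x|P u i. exp (\<theta> * m) * (1 - \<theta> * m + \<theta> * Z x)) \<le> E"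
      unfolding E_def
    proof (rule integral_mono[OF _ iE])
      show "integrable (P u i) (\<lambda>x. exp (\<theta> * m) * (1 - \<theta> * m + \<theta> * Z x))"
        using iZ by (intro integrable_mult_right Bochner_Integration.integrable_add) auto
      fix x
      have "exp (\<theta> * m) * (1 + (\<theta> * Z x - \<theta> * m)) \<le> exp (\<theta> * m) * exp (\<theta> * Z x - \<theta> * m)"
        by (intro mult_left_mono exp_ge_add_one_self) auto
      then show "exp (\<theta> * m) * (1 - \<theta> * m + \<theta> * Z x) \<le> exp (\<theta> * Z x)"
        by (simp add: exp_diff algebra_simps)
    qed
    also have "(LINT x|P u i. exp (\<theta> * m) * (1 - \<theta> * m + \<theta> * Z x)) = exp (\<theta> * m)"
      using iZ by (simp add: prob_space m_def)
    finally show ?thesis .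
  qed
  moreover from this have E0: "0 < E"
    by (rule less_le_trans[OF exp_gt_zero])
  ultimately have "\<theta> * m \<le> ln E"
    by (simp add: ln_ge_iff)
  with \<theta> show "mean_cost i u \<le> risk_cost P c \<alpha> \<theta> i u"
    by (simp add: risk_cost_def E_def m_def Z_def field_simps)
  have "E \<le> (LINT x|P u i. 1 + \<theta> * Z x + (\<theta> * b)\<^sup>2 * exp b)"
    unfolding E_def
  proof (rule integral_mono[OF iE])
    show "integrable (P u i) (\<lambda>x. 1 + \<theta> * Z x + (\<theta> * b)\<^sup>2 * exp b)"
      using iZ by (intro integrable_mult_right Bochner_Integration.integrable_add) auto
    fix x assume "x \<in> space (P u i)"
    then have x: "x \<in> cadlag_paths" by (simp add: space_P)
    have "\<bar>exp (\<theta> * Z x) - 1 - \<theta> * Z x\<bar> \<le> (\<theta> * Z x)\<^sup>2 * exp b"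
      by (rule exp_second_order_bound) (use \<theta>Z[OF x] in linarith)
    also have "\<dots> \<le> (\<theta> * b)\<^sup>2 * exp b"
      using \<theta>Z[OF x] by (intro mult_right_mono power_mono) auto
    finally show "exp (\<theta> * Z x) \<le> 1 + \<theta> * Z x + (\<theta> * b)\<^sup>2 * exp b"
      by linarith
  qed
  also have "\<dots> = 1 + \<theta> * m + (\<theta> * b)\<^sup>2 * exp b"
    using iZ by (simp add: prob_space m_def)
  \<comment> \<open>The inequality ln E <= E - 1 removes the logarithm and keeps the error of order
    \<theta>^2.\<close>
  finally have "ln E \<le> \<theta> * m + (\<theta> * b)\<^sup>2 * exp b"
    using ln_le_minus_one[OF E0] by linarith
  also have "\<dots> = (m + \<theta> * (b\<^sup>2 * exp b)) * \<theta>"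
    by (simp add: power2_eq_square algebra_simps)
  finally have "ln E / \<theta> \<le> m + \<theta> * (b\<^sup>2 * exp b)"
    using \<theta> by (subst pos_divide_le_eq)
  then show "risk_cost P c \<alpha> \<theta> i u \<le> mean_cost i u + \<theta> * ((C / \<alpha>)\<^sup>2 * exp (C / \<alpha>))"
    by (simp add: risk_cost_def E_def m_def Z_def b_def)
  show "0 \<le> mean_cost i u"
    using Z unfolding Z_def by (intro Bochner_Integration.integral_nonneg) (simp add: space_P)
qed

lemma mean_cost_bdd_below: "bdd_below (mean_cost i ` markov_controls U)"
  \<comment> \<open>Any parameter in (0, 1) would do: the bound on the mean does not mention
    it.\<close>
  by (rule bdd_belowI2[of _ 0]) (rule risk_cost_mean_bounds(3)[of _ "1/2"]; simp)

lemma risk_cost_bdd_below: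
  assumes "0 < \<theta>" "\<theta> < 1"
  shows "bdd_below (risk_cost P c \<alpha> \<theta> i ` markov_controls U)"
  by (rule bdd_belowI2[of _ 0]) (use risk_cost_mean_bounds assms order_trans in blast)

text \<open>The gap between risk-sensitive and mean cost is at most a constant times \<theta>,
  uniformly in the control, so it passes to the infima.\<close>

lemma risk_value_tendsto:
  "((\<lambda>\<theta>. risk_value P U c \<alpha> \<theta> i) \<longlongrightarrow> (INF u\<in>markov_controls U. mean_cost i u)) (at_right 0)"
proof (rule LIM_zero_cancel, rule Lim_null_comparison)
  let ?K = "(C / \<alpha>)\<^sup>2 * exp (C / \<alpha>)" and ?m = "INF u\<in>markov_controls U. mean_cost i u"
  have "\<bar>risk_value P U c \<alpha> \<theta> i - ?m\<bar> \<le> \<theta> * ?K" if \<theta>: "0 < \<theta>" "\<theta> < 1" for \<theta>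
  proof -
    have "?m \<le> risk_value P U c \<alpha> \<theta> i"
      unfolding risk_value_def
    proof (rule cINF_greatest[OF controls_nonempty])
      fix u assume u: "u \<in> markov_controls U"
      show "?m \<le> risk_cost P c \<alpha> \<theta> i u"
        using cINF_lower[OF mean_cost_bdd_below u, of i] risk_cost_mean_bounds(1)[OF u \<theta>, of i] by linarith
    qed
    moreover have "risk_value P U c \<alpha> \<theta> i - \<theta> * ?K \<le> ?m"
    proof (rule cINF_greatest[OF controls_nonempty])
      fix u assume u: "u \<in> markov_controls U"
      show "risk_value P U c \<alpha> \<theta> i - \<theta> * ?K \<le> mean_cost i u"
        using cINF_lower[OF risk_cost_bdd_below[OF \<theta>] u, of i] risk_cost_mean_bounds(2)[OF u \<theta>, of i]
        unfolding risk_value_def by linarith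
    qed
    ultimately show ?thesis
      using \<theta> by (simp add: abs_le_iff)
  qed
  then show "\<forall>\<^sub>F \<theta> in at_right 0. norm (risk_value P U c \<alpha> \<theta> i - ?m) \<le> \<theta> * ?K"
    by (auto simp: eventually_at_right[of 0 "1::real"] intro!: exI[of _ 1])
  show "((\<lambda>\<theta>. \<theta> * ?K) \<longlongrightarrow> 0) (at_right 0)"
    by (rule tendsto_mult_left_zero) (rule tendsto_ident_at)
qed

end

section \<open>Selectors and identification with the value function\<close>

context hjb_candidate
begin

text \<open>Infima of the Hamiltonian over any nonempty subset of \<open>U i\<close> are continuous
  in \<theta> by \<open>continuous_on_hmin\<close>, hence measurable, as the selection theorem
  requires.\<close>

lemma minimizing_selector_exists: "\<exists>us. minimizing_selector U lam c v us"
proof -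
  let ?M = "restrict_space borel {0<..<(1::real)}"
  have "\<exists>s\<in>?M \<rightarrow>\<^sub>M borel. \<forall>\<theta>\<in>space ?M. s \<theta> \<in> U i \<and>
      (\<forall>b\<in>U i. hamiltonian lam c v \<theta> i (s \<theta>) \<le> hamiltonian lam c v \<theta> i b)" for i
  proof (rule measurable_argmin[OF compact_U U_nonempty])
    show "continuous_on (U i) (hamiltonian lam c v \<theta> i)" for \<theta>
      unfolding hamiltonian_def by (intro continuous_intros c_continuous rate_continuous)
    fix D assume D: "D \<subseteq> U i" "D \<noteq> {}"
    have "continuous_on {0<..<1} (\<lambda>\<theta>. hmin D i (\<theta> * exp (\<theta> * v \<theta> i)) (\<lambda>j. exp (\<theta> * v \<theta> j)))"
      by (intro continuous_on_hmin[OF D] continuous_intros v_continuous)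
    from borel_measurable_continuous_on_restrict[OF this]
    show "(\<lambda>\<theta>. INF a\<in>D. hamiltonian lam c v \<theta> i a) \<in> borel_measurable ?M"
      by (simp add: hmin_def hamiltonian_eq_hval)
  qed
  then have "\<forall>i. \<exists>s. s \<in> ?M \<rightarrow>\<^sub>M borel \<and> (\<forall>\<theta>\<in>{0<..<1}. s \<theta> \<in> U i \<and>
      (\<forall>b\<in>U i. hamiltonian lam c v \<theta> i (s \<theta>) \<le> hamiltonian lam c v \<theta> i b))"
    by (fastforce simp: space_restrict_space)
  from choice[OF this] obtain s where s: "\<And>i. s i \<in> ?M \<rightarrow>\<^sub>M borel"
    "\<And>i \<theta>. \<theta> \<in> {0<..<1} \<Longrightarrow> s i \<theta> \<in> U i"
    "\<And>i \<theta> b. \<theta> \<in> {0<..<1} \<Longrightarrow> b \<in> U i \<Longrightarrow> hamiltonian lam c v \<theta> i (s i \<theta>) \<le> hamiltonian lam c v \<theta> i b"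
    by blast
  have "(INF a\<in>U i. hamiltonian lam c v \<theta> i a) = hamiltonian lam c v \<theta> i (s i \<theta>)" if "\<theta> \<in> {0<..<1}" for \<theta> i
    using s(2,3)[OF that] by (intro cInf_eq_minimum) auto
  with s(1,2) have "minimizing_selector U lam c v (\<lambda>\<theta> i. s i \<theta>)"
    by (simp add: minimizing_selector_def)
  then show ?thesis by blast
qed

text \<open>The time change maps nonnegative times into (0, 1), so \<open>us\<close> is evaluated
  only where it is known to be measurable and minimizing.\<close>

lemma selector_control:
  assumes us: "minimizing_selector U lam c v us" and \<theta>: "0 < \<theta>" "\<theta> < 1"
  defines "u \<equiv> \<lambda>t i. us (\<theta> * exp (- \<alpha> * t)) i"
  shows "u \<in> markov_controls U" and "risk_cost P c \<alpha> \<theta> i u = v \<theta> i"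
proof -
  interpret hjb_time_change U lam c \<alpha> M C P v B0 \<theta>
    by unfold_locales (use \<theta> in auto)
  show u: "u \<in> markov_controls U"
    unfolding markov_controls_def u_def
  proof (intro CollectI allI conjI impI)
    fix i
    have "\<eta> \<in> restrict_space borel {0..} \<rightarrow>\<^sub>M restrict_space borel {0<..<1}"
      by (intro measurable_restrict_space2 measurable_restrict_space1)
         (use \<eta>_in in \<open>auto simp: space_restrict_space\<close>)
    from measurable_compose[OF this, of "\<lambda>\<theta>. us \<theta> i" borel] us
    show "(\<lambda>t. us (\<eta> t) i) \<in> restrict_space borel {0..} \<rightarrow>\<^sub>M borel"
      by (simp add: minimizing_selector_def)
    show "us (\<eta> t) i \<in> U i" if "0 \<le> t" for t
      using us \<eta>_in[OF that] by (simp add: minimizing_selector_def)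
  qed
  show "risk_cost P c \<alpha> \<theta> i u = v \<theta> i"
    by (rule risk_cost_eq[OF u]) (use us \<eta>_in in \<open>simp add: minimizing_selector_def minham_def u_def\<close>)
qed

text \<open>A candidate lies below every cost, and its own selector attains it. This determines
  \<open>v\<close> on (0, 1) and so yields uniqueness.\<close>

lemma risk_value_eq:
  assumes \<theta>: "0 < \<theta>" "\<theta> < 1"
  shows "risk_value P U c \<alpha> \<theta> i = v \<theta> i"
proof -
  interpret hjb_time_change U lam c \<alpha> M C P v B0 \<theta>
    by unfold_locales (use \<theta> in auto)
  obtain us where us: "minimizing_selector U lam c v us"
    using minimizing_selector_exists by blast
  show ?thesis
    unfolding risk_value_def
  proof (rule cInf_eq_minimum)
    show "v \<theta> i \<in> risk_cost P c \<alpha> \<theta> i ` markov_controls U"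
      using selector_control[OF us \<theta>] by (metis imageI)
  qed (use risk_cost_ge in auto)
qed

end

context controlled_chain
begin

lemma hjb_solution_candidate:
  assumes "hjb_solution P U lam c \<alpha> v"
  obtains B where "hjb_candidate U lam c \<alpha> M C P v B"
proof -
  obtain B where "\<forall>\<theta>\<in>{0<..<1}. \<forall>i. \<bar>v \<theta> i\<bar> \<le> B"
    using assms by (auto simp: hjb_solution_def)
  with assms have "hjb_candidate U lam c \<alpha> M C P v B"
    by (intro hjb_candidate.intro controlled_chain_axioms hjb_candidate_axioms.intro)
       (simp_all add: hjb_solution_def)
  then show ?thesis by (rule that)
qed

text \<open>The value function agrees on (0, 1) with the constructed candidate, which passes on its
  regularity and its equation; the limit at 0 comes from \<open>risk_value_tendsto\<close>.\<close>

lemma hjb_solution_risk_value: "hjb_solution P U lam c \<alpha> (risk_value P U c \<alpha>)"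
proof -
  obtain v where "hjb_candidate U lam c \<alpha> M C P v (C / \<alpha>)"
    using hjb_candidate_exists by blast
  then interpret hjb_candidate U lam c \<alpha> M C P v "C / \<alpha>" .
  let ?V = "risk_value P U c \<alpha>"
  have V: "?V \<theta> i = v \<theta> i" if "\<theta> \<in> {0<..<1}" for \<theta> i
    using that by (simp add: risk_value_eq)
  \<comment> \<open>\<open>deriv\<close> is local, so agreement on the open interval suffices;
    outside it the two functions may differ.\<close>
  have deriv: "deriv (\<lambda>\<eta>. ?V \<eta> i) \<theta> = deriv (\<lambda>\<eta>. v \<eta> i) \<theta>" if "\<theta> \<in> {0<..<1}" for \<theta> i
    using V that by (intro deriv_cong_ev) (auto simp: eventually_nhds intro!: exI[of _ "{0<..<1}"])
  have ham: "hamiltonian lam c ?V \<theta> i a = hamiltonian lam c v \<theta> i a" if "\<theta> \<in> {0<..<1}" for \<theta> i a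
    using V[OF that] by (simp add: hamiltonian_def)
  show ?thesis
    unfolding hjb_solution_def
  proof (intro conjI ballI allI risk_value_tendsto)
    show "\<exists>B. \<forall>\<theta>\<in>{0<..<1}. \<forall>i. \<bar>?V \<theta> i\<bar> \<le> B"
      using v_bound V by (intro exI[of _ "C / \<alpha>"]) auto
    fix i
    show "continuous_on {0<..<1} (\<lambda>\<theta>. ?V \<theta> i)"
      by (rule continuous_on_cong[THEN iffD2, OF refl V v_continuous])
    show "(\<lambda>\<theta>. ?V \<theta> i) C1_differentiable_on {0<..<1}"
      by (rule C1_differentiable_on_cong_open[OF v_C1]) (auto simp: V)
    fix \<theta> :: real assume \<theta>: "\<theta> \<in> {0<..<1}"
    show "\<alpha> * \<theta> * (?V \<theta> i + \<theta> * deriv (\<lambda>\<eta>. ?V \<eta> i) \<theta>) * exp (\<theta> * ?V \<theta> i)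
        = (INF a\<in>U i. hamiltonian lam c ?V \<theta> i a)"
      using v_hjb[of \<theta> i] \<theta> by (simp add: V deriv ham)
  qed
qed

end

theorem theorem3p5:
  fixes U :: "'s::finite \<Rightarrow> 'u::metric_space set"
    and lam :: "'s \<Rightarrow> 's \<Rightarrow> 'u \<Rightarrow> real"
    and c :: "'s \<Rightarrow> 'u \<Rightarrow> real"
    and \<alpha> M :: real
    and P :: "(real \<Rightarrow> 's \<Rightarrow> 'u) \<Rightarrow> 's \<Rightarrow> (real \<Rightarrow> 's) measure"
  assumes U: "\<And>i. compact (U i)" "\<And>i. U i \<noteq> {}"
    and lam_nonneg: "\<And>i j a. j \<noteq> i \<Longrightarrow> a \<in> U i \<Longrightarrow> 0 \<le> lam i j a"
    and A1: "\<And>i j. j \<noteq> i \<Longrightarrow> continuous_on (U i) (lam i j)"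
    and A2: "\<And>i a. a \<in> U i \<Longrightarrow> - rate lam i i a \<le> M"
    and A3: "\<And>i. uniform_limit (U i) (\<lambda>F a. \<Sum>j\<in>F. lam i j a) (\<lambda>a. \<Sum>j\<in>UNIV - {i}. lam i j a)
               (finite_subsets_at_top (UNIV - {i}))"
    and c_nonneg: "\<And>i a. a \<in> U i \<Longrightarrow> 0 \<le> c i a"
    and c_bounded: "\<exists>C. \<forall>i. \<forall>a\<in>U i. c i a \<le> C"
    and c_cont: "\<And>i. continuous_on (U i) (c i)"
    and \<alpha>: "\<alpha> > 0"
    and P: "\<And>u i. u \<in> markov_controls U \<Longrightarrow> solves_martingale_problem lam u i (P u i)"
  shows "hjb_solution P U lam c \<alpha> (risk_value P U c \<alpha>)
    \<and> (\<forall>v. hjb_solution P U lam c \<alpha> v \<longrightarrow>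
         (\<forall>\<theta>\<in>{0<..<1}. \<forall>i. v \<theta> i = risk_value P U c \<alpha> \<theta> i))
    \<and> (\<exists>us. minimizing_selector U lam c (risk_value P U c \<alpha>) us)
    \<and> (\<forall>us. minimizing_selector U lam c (risk_value P U c \<alpha>) us \<longrightarrow>
         (\<forall>\<theta>\<in>{0<..<1}. optimal_control P U c \<alpha> \<theta> (\<lambda>t i. us (\<theta> * exp (- \<alpha> * t)) i)))"
proof -
  obtain C where C: "\<And>i a. a \<in> U i \<Longrightarrow> c i a \<le> C"
    using c_bounded by auto
  interpret controlled_chain U lam c \<alpha> M C P
    by unfold_locales (use U lam_nonneg A1 A2 c_nonneg C c_cont \<alpha> P in auto)
  \<comment> \<open>The value function is itself a candidate, so the verification applies to the
    selectors formed with it.\<close>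
  obtain B where "hjb_candidate U lam c \<alpha> M C P (risk_value P U c \<alpha>) B"
    using hjb_solution_candidate[OF hjb_solution_risk_value] .
  then interpret V: hjb_candidate U lam c \<alpha> M C P "risk_value P U c \<alpha>" B .
  show ?thesis
  proof (intro conjI allI impI ballI hjb_solution_risk_value V.minimizing_selector_exists)
    fix v \<theta> i assume v: "hjb_solution P U lam c \<alpha> v" and \<theta>: "\<theta> \<in> {0<..<(1::real)}"
    obtain B' where "hjb_candidate U lam c \<alpha> M C P v B'"
      using hjb_solution_candidate[OF v] .
    from hjb_candidate.risk_value_eq[OF this] \<theta> show "v \<theta> i = risk_value P U c \<alpha> \<theta> i"
      by simp
  next
    fix us \<theta> assume "minimizing_selector U lam c (risk_value P U c \<alpha>) us" "\<theta> \<in> {0<..<(1::real)}"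
    then show "optimal_control P U c \<alpha> \<theta> (\<lambda>t i. us (\<theta> * exp (- \<alpha> * t)) i)"
      using V.selector_control by (simp add: optimal_control_def)
  qed
qed

end
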